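(* Let $\mathbf d_q:\mathcal V(\theta_q)\to\mathcal V(\theta_{q-1})$ ($q\ge1$) be the $\mathfrak g$-module homomorphism with $\mathbf d_q(y_n\otimes(e^*_{m+n})^q\otimes1_{\mathcal E})=1\otimes(e^*_{m+n})^{q-1}\otimes1_{\mathcal E}$, and $\mathbf d_0=0$. Then $\mathbf d_q\circ\mathbf d_{q+1}=0$ for all $q\ge0$, and: (1) $\mathcal V(\theta_q)$ is reducible for every $q\ge1$; (2) $\operatorname{Im}\mathbf d_{q+1}\cong L(\theta_q)$ for all $q\ge0$; (3) $\ker\mathbf d_q=\operatorname{Im}\mathbf d_{q+1}$ for all $q\ge0$ with $q\ne m$; (4) $\ker\mathbf d_m/\operatorname{Im}\mathbf d_{m+1}$ is the one-dimensional trivial $\mathfrak g$-module (spanned by the class of $y_1\cdots y_n\otimes e_1^*\cdots e_m^*\otimes1_{\mathcal E}$).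
   Context: $\mathbb F$ algebraically closed of characteristic $0$, $m,n\ge1$. $\mathcal R=\mathbb F[x_1,\dots,x_m]\otimes\Lambda(y_1,\dots,y_n)$ ($x_i$ even, $y_s$ odd). $\mathfrak g=W(m,n)$ the Lie superalgebra of superderivations of $\mathcal R$, free over $\mathcal R$ on even $\partial_i$ and odd $D_t$, with $\mathfrak g_0\cong\mathfrak{gl}(m|n)$ via $x_i\partial_j\mapsto E_{ij}$, $x_iD_s\mapsto E_{i,m+s}$, $y_r\partial_j\mapsto E_{m+r,j}$, $y_rD_s\mapsto E_{m+r,m+s}$. $\mathcal E=\sum_{i=1}^m\epsilon_i-\sum_{j=1}^n\delta_j$, $\theta_q=\mathcal E-q\delta_n$. $L^0(\theta_q)$ is realized as $\Omega^q(V^* )\otimes\mathbb F_{\mathcal E}$, where $V^*$ is the dual of the natural module $\mathbb F^{m|n}$ with dual basis $e_i^*$ ($e^*_i$ even iff $i\le m$), $\Omega^q(V^* )$ its $q$-th super-Grassmann power (even vectors anticommute, odd vectors commute; products written by juxtaposition), and $\mathbb F_{\mathcal E}=\mathbb F1_{\mathcal E}$ the one-dimensional module of weight $\mathcal E$. For dominant integral $\lambda$, $\mathcal V(\lambda)=\mathcal R\otimes L^0(\lambda)$ is the mixed-product module (homogeneous $f,g$, $\xi$ the $\mathfrak g_0$-action: $f\partial_i.(g\otimes v)=f\partial_i(g)\otimes v+\sum_j\partial_j(f)g\otimes\xi(x_j\partial_i)v+(-1)^{\wp(f)+\wp(g)+1}\sum_jD_j(f)g\otimes\xi(y_j\partial_i)v$,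 $fD_i.(g\otimes v)=fD_i(g)\otimes v+(-1)^{\wp(g)}\sum_j\partial_j(f)g\otimes\xi(x_jD_i)v+(-1)^{\wp(f)+1}\sum_jD_j(f)g\otimes\xi(y_jD_i)v$), and $L(\lambda)$ is its unique simple submodule $U(\mathfrak g)(1\otimes L^0(\lambda))$. The vector $y_n\otimes(e^*_{m+n})^q\otimes1_{\mathcal E}$ generates $\mathcal V(\theta_q)$. *)

theory Defs
  imports "HOL-Computational_Algebra.Polynomial"
begin

(* Conventions (0-based indices):
   x_1..x_m  ~ x 0 .. x (m-1);  y_1..y_n ~ y 0 .. y (n-1);
   e*_1..e*_{m+n} ~ indices 0..m+n-1 (index p is odd iff m <= p).
   A monomial of R is (a, S): a :: nat => nat exponents of the x's, S a strictly
   increasing list of y-indices (the product y_{S!0} y_{S!1} ...).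
   A monomial of Omega(V* ) is a nondecreasing word w of e*-indices (the product
   e*_{w!0} e*_{w!1} ...), with no repeated even index.
   V(lambda) elements are finitely supported coefficient functions on pairs
   (R-monomial, Omega-monomial); W(m,n) elements are finitely supported
   coefficient functions on pairs (f, i) with f an R-monomial and i < m+n,
   (f, i) meaning f \<partial>_i for i < m and f D_(i-m) for i >= m. *)

definition alg_closed :: "'k::field itself \<Rightarrow> bool" where
  "alg_closed _ \<longleftrightarrow> (\<forall>p :: 'k poly. 1 \<le> degree p \<longrightarrow> (\<exists>x. poly p x = 0))"

type_synonym rmon = "(nat \<Rightarrow> nat) \<times> nat list"
type_synonym omon = "nat list"
type_synonym vbas = "rmon \<times> omon"
type_synonym gbas = "rmon \<times> nat"

definition inv_pairs :: "nat list \<Rightarrow> (nat \<times> nat) set" where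
  "inv_pairs w = {(r, s). r < s \<and> s < length w \<and> w ! s < w ! r}"

(* sign of sorting a word of anticommuting odd generators y (0 if a repeat) *)
definition ysign :: "nat list \<Rightarrow> int" where
  "ysign w = (if distinct w then (-1) ^ card (inv_pairs w) else 0)"

definition rmul :: "rmon \<Rightarrow> rmon \<Rightarrow> int \<times> rmon" where
  "rmul f g = (ysign (snd f @ snd g), (\<lambda>i. fst f i + fst g i, sort (snd f @ snd g)))"

(* \<partial>_j and D_j (left derivative) of an R-monomial *)
definition rdx :: "nat \<Rightarrow> rmon \<Rightarrow> int \<times> rmon" where
  "rdx j f = (int (fst f j), ((fst f)(j := fst f j - 1), snd f))"

definition rdy :: "nat \<Rightarrow> rmon \<Rightarrow> int \<times> rmon" where
  "rdy j f = (if j \<in> set (snd f) then (-1) ^ length (takeWhile (\<lambda>s. s \<noteq> j) (snd f)) else 0,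
              (fst f, remove1 j (snd f)))"

(* Koszul sign of sorting a word in the super-Grassmann algebra Omega(V* ):
   u v = - (-1)^(|u||v|) v u; 0 if an even vector repeats *)
definition osign :: "nat \<Rightarrow> nat list \<Rightarrow> int" where
  "osign m w = (if \<not> distinct (filter (\<lambda>p. p < m) w) then 0
     else (\<Prod>(r, s) \<in> inv_pairs w. (if m \<le> w ! r \<and> m \<le> w ! s then 1 else -1)))"

definition ipar :: "nat \<Rightarrow> nat \<Rightarrow> nat" where
  "ipar m p = (if m \<le> p then 1 else 0)"

(* xi(E_kl) acting on the basis vector w \<otimes> 1_E of Omega^q(V* ) \<otimes> F_E,
   returned as a coefficient function on Omega-monomials.
   E_kl . e*_p = - (-1)^((|k|+|l|)|k|) delta_pk e*_l  (super dual of the natural module),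
   extended as a super derivation, plus the weight E(E_kl). *)
definition xi :: "nat \<Rightarrow> nat \<Rightarrow> nat \<Rightarrow> omon \<Rightarrow> omon \<Rightarrow> 'k::field" where
  "xi m k l w w' =
     (\<Sum>r<length w. if w ! r = k then
        of_int ((-1) ^ ((ipar m k + ipar m l) * length (filter (\<lambda>p. m \<le> p) (take r w)))
                * (- ((-1) ^ ((ipar m k + ipar m l) * ipar m k)))
                * osign m (w[r := l]))
        * (if w' = sort (w[r := l]) then 1 else 0)
      else 0)
     + (if k = l \<and> w' = w then (if k < m then 1 else -1) else 0)"

definition act_basis :: "nat \<Rightarrow> nat \<Rightarrow> gbas \<Rightarrow> vbas \<Rightarrow> vbas \<Rightarrow> 'k::field" where
  "act_basis m n X v b =
     (let f = fst X; i = snd X; g = fst v; w = snd v;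
          pf = length (snd f); pg = length (snd g);
          dg = (if i < m then rdx i g else rdy (i - m) g);
          t1 = rmul f (snd dg);
          s2 = (if i < m then (1::int) else (-1) ^ pg);
          s3 = (if i < m then (-1) ^ (pf + pg + 1) else (-1) ^ (pf + 1)::int)
      in of_int (fst dg * fst t1) * (if b = (snd t1, w) then 1 else 0)
       + (\<Sum>j<m. of_int (s2 * fst (rdx j f) * fst (rmul (snd (rdx j f)) g))
            * (if fst b = snd (rmul (snd (rdx j f)) g) then xi m j i w (snd b) else 0))
       + (\<Sum>j<n. of_int (s3 * fst (rdy j f) * fst (rmul (snd (rdy j f)) g))
            * (if fst b = snd (rmul (snd (rdy j f)) g) then xi m (m + j) i w (snd b) else 0)))"

definition act :: "nat \<Rightarrow> nat \<Rightarrow> (gbas \<Rightarrow> 'k::field) \<Rightarrow> (vbas \<Rightarrow> 'k) \<Rightarrow> vbas \<Rightarrow> 'k" where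
  "act m n X v b = (\<Sum>gb\<in>{gb. X gb \<noteq> 0}. \<Sum>vb\<in>{vb. v vb \<noteq> 0}. X gb * v vb * act_basis m n gb vb b)"

definition valid_rmon :: "nat \<Rightarrow> nat \<Rightarrow> rmon \<Rightarrow> bool" where
  "valid_rmon m n f \<longleftrightarrow> (\<forall>i. m \<le> i \<longrightarrow> fst f i = 0) \<and> sorted_wrt (<) (snd f) \<and> (\<forall>s\<in>set (snd f). s < n)"

definition valid_omon :: "nat \<Rightarrow> nat \<Rightarrow> nat \<Rightarrow> omon \<Rightarrow> bool" where
  "valid_omon m n q w \<longleftrightarrow> length w = q \<and> sorted w \<and> (\<forall>p\<in>set w. p < m + n)
      \<and> distinct (filter (\<lambda>p. p < m) w)"

(* the mixed product module V(theta_q) = R \<otimes> Omega^q(V* ) \<otimes> F_E *)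
definition Vq :: "nat \<Rightarrow> nat \<Rightarrow> nat \<Rightarrow> (vbas \<Rightarrow> 'k::field) set" where
  "Vq m n q = {v. finite {b. v b \<noteq> 0} \<and>
      (\<forall>b. v b \<noteq> 0 \<longrightarrow> valid_rmon m n (fst b) \<and> valid_omon m n q (snd b))}"

definition Gcar :: "nat \<Rightarrow> nat \<Rightarrow> (gbas \<Rightarrow> 'k::field) set" where
  "Gcar m n = {X. finite {g. X g \<noteq> 0} \<and> (\<forall>g. X g \<noteq> 0 \<longrightarrow> valid_rmon m n (fst g) \<and> snd g < m + n)}"

definition vzero :: "vbas \<Rightarrow> 'k::field" where "vzero = (\<lambda>_. 0)"

definition single :: "vbas \<Rightarrow> vbas \<Rightarrow> 'k::field" where
  "single b = (\<lambda>b'. if b' = b then 1 else 0)"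

definition submodule :: "nat \<Rightarrow> nat \<Rightarrow> nat \<Rightarrow> (vbas \<Rightarrow> 'k::field) set \<Rightarrow> bool" where
  "submodule m n q W \<longleftrightarrow> W \<subseteq> Vq m n q \<and> vzero \<in> W
     \<and> (\<forall>u\<in>W. \<forall>v\<in>W. (\<lambda>b. u b + v b) \<in> W)
     \<and> (\<forall>c u. u \<in> W \<longrightarrow> (\<lambda>b. c * u b) \<in> W)
     \<and> (\<forall>X\<in>Gcar m n. \<forall>u\<in>W. act m n X u \<in> W)"

(* even g-module map between submodules A and B *)
definition gmap :: "nat \<Rightarrow> nat \<Rightarrow> (vbas \<Rightarrow> 'k::field) set \<Rightarrow> (vbas \<Rightarrow> 'k) set
      \<Rightarrow> ((vbas \<Rightarrow> 'k) \<Rightarrow> (vbas \<Rightarrow> 'k)) \<Rightarrow> bool" where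
  "gmap m n A B \<phi> \<longleftrightarrow> (\<forall>u\<in>A. \<phi> u \<in> B)
     \<and> (\<forall>u\<in>A. \<forall>v\<in>A. \<phi> (\<lambda>b. u b + v b) = (\<lambda>b. \<phi> u b + \<phi> v b))
     \<and> (\<forall>c. \<forall>u\<in>A. \<phi> (\<lambda>b. c * u b) = (\<lambda>b. c * \<phi> u b))
     \<and> (\<forall>X\<in>Gcar m n. \<forall>u\<in>A. \<phi> (act m n X u) = act m n X (\<phi> u))"

definition gmod_iso :: "nat \<Rightarrow> nat \<Rightarrow> (vbas \<Rightarrow> 'k::field) set \<Rightarrow> (vbas \<Rightarrow> 'k) set \<Rightarrow> bool" where
  "gmod_iso m n A B \<longleftrightarrow> (\<exists>\<phi>. gmap m n A B \<phi> \<and> bij_betw \<phi> A B)"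

(* L(theta_q) = U(g)(1 \<otimes> L^0(theta_q)): the submodule generated by 1 \<otimes> Omega^q \<otimes> 1_E *)
definition Lmod :: "nat \<Rightarrow> nat \<Rightarrow> nat \<Rightarrow> (vbas \<Rightarrow> 'k::field) set" where
  "Lmod m n q = \<Inter>{W. submodule m n q W \<and>
      (\<forall>w. valid_omon m n q w \<longrightarrow> single ((\<lambda>_. 0, []), w) \<in> W)}"

definition gen_vec :: "nat \<Rightarrow> nat \<Rightarrow> nat \<Rightarrow> vbas \<Rightarrow> 'k::field" where
  "gen_vec m n q = single ((\<lambda>_. 0, [n - 1]), replicate q (m + n - 1))"

definition gen_img :: "nat \<Rightarrow> nat \<Rightarrow> nat \<Rightarrow> vbas \<Rightarrow> 'k::field" where
  "gen_img m n q = single ((\<lambda>_. 0, []), replicate (q - 1) (m + n - 1))"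

definition dprops :: "nat \<Rightarrow> nat \<Rightarrow> (nat \<Rightarrow> (vbas \<Rightarrow> 'k::field) \<Rightarrow> (vbas \<Rightarrow> 'k)) \<Rightarrow> bool" where
  "dprops m n d \<longleftrightarrow> (\<forall>v. d 0 v = vzero)
     \<and> (\<forall>q\<ge>1. gmap m n (Vq m n q) (Vq m n (q - 1)) (d q) \<and> d q (gen_vec m n q) = gen_img m n q)"

end

theory Submission
  imports Defs
begin

text \<open>
  Identify \<open>\<R> \<otimes> \<Omega>(V\<^sup>*)\<close> with a Fock space having one boson and one fermion for each index
  \<open>p < m + n\<close>: for \<open>p < m\<close> the boson is \<open>x\<^sub>p\<close> and the fermion is \<open>e\<^sup>*\<^sub>p\<close>, for \<open>p \<ge> m\<close> the boson
  is \<open>e\<^sup>*\<^sub>p\<close> and the fermion is \<open>y\<close> with index \<open>p - m\<close>.  Up to parity signs the differential is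
  \<open>d = \<Sum>\<^sub>p \<partial>\<^sub>p \<iota>\<^sub>p\<close>, where \<open>\<partial>\<^sub>p\<close> differentiates \<open>\<R>\<close> and \<open>\<iota>\<^sub>p\<close> contracts \<open>\<Omega>(V\<^sup>*)\<close>; its
  summands anticommute, so \<open>d\<^sup>2 = 0\<close>, and \<open>d\<^sub>q = - d / q\<close>.

  Let \<open>E = f e\<^sup>*\<^sub>i\<close> be multiplication by \<open>f\<close> composed with exterior multiplication by \<open>e\<^sup>*\<^sub>i\<close>.
  Cartan's formula says that \<open>f \<partial>\<^sub>i\<close> acts, up to parity signs, as \<open>d E + E d\<close>.  Hence the action
  commutes with \<open>d\<close> and is zero on cohomology.  A signed sum of the diagonal fields \<open>x\<^sub>p \<partial>\<^sub>p\<close> and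
  \<open>y\<^sub>s D\<^sub>s\<close> acts diagonally and counts bosons plus missing fermions, so the cohomology is spanned by
  the state \<open>y\<^sub>1\<cdots>y\<^sub>n \<otimes> e\<^sup>*\<^sub>1\<cdots>e\<^sup>*\<^sub>m\<close> without bosons and with all fermions.

  For \<open>q \<ge> 1\<close> the vector \<open>y\<^sub>n \<otimes> (e\<^sup>*\<^sub>m\<^sub>+\<^sub>n)\<^sup>q\<close> generates: the fields \<open>f D\<^sub>n\<close> send it to nonzero
  multiples of all \<open>f \<otimes> (e\<^sup>*\<^sub>m\<^sub>+\<^sub>n)\<^sup>q\<close>, and then \<open>y\<^sub>n \<partial>\<^sub>l\<close>, \<open>y\<^sub>n D\<^sub>l\<close> replace factors \<open>e\<^sup>*\<^sub>m\<^sub>+\<^sub>n\<close>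
  one at a time.  This makes \<open>d\<^sub>q\<close> unique and identifies its image with \<open>L(\<theta>\<^sub>q\<^sub>-\<^sub>1)\<close>.
\<close>

section \<open>Linear operators on function spaces\<close>

abbreviation (input) scaled :: "'k::times \<Rightarrow> ('b \<Rightarrow> 'k) \<Rightarrow> 'b \<Rightarrow> 'k" (infixr "\<odot>" 75) where
  "c \<odot> u \<equiv> \<lambda>b. c * u b"

typedef (overloaded) ('b, 'k::field) linop =
  "{T :: ('b \<Rightarrow> 'k) \<Rightarrow> 'b \<Rightarrow> 'k.
     (\<forall>u v. T (\<lambda>b. u b + v b) = (\<lambda>b. T u b + T v b)) \<and> (\<forall>c u. T (c \<odot> u) = c \<odot> T u)}"
  morphisms app Linop
  by (rule exI[of _ "\<lambda>v. v"]) auto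

setup_lifting type_definition_linop

instantiation linop :: (type, field) ring_1
begin

lift_definition zero_linop :: "('a, 'b) linop" is "\<lambda>v b. 0" by auto
lift_definition one_linop :: "('a, 'b) linop" is "\<lambda>v. v" by auto
lift_definition plus_linop :: "('a, 'b) linop \<Rightarrow> ('a, 'b) linop \<Rightarrow> ('a, 'b) linop"
  is "\<lambda>S T v b. S v b + T v b" by (auto simp: algebra_simps)
lift_definition minus_linop :: "('a, 'b) linop \<Rightarrow> ('a, 'b) linop \<Rightarrow> ('a, 'b) linop"
  is "\<lambda>S T v b. S v b - T v b" by (auto simp: algebra_simps)
lift_definition uminus_linop :: "('a, 'b) linop \<Rightarrow> ('a, 'b) linop"
  is "\<lambda>S v b. - S v b" by auto
lift_definition times_linop :: "('a, 'b) linop \<Rightarrow> ('a, 'b) linop \<Rightarrow> ('a, 'b) linop"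
  is "\<lambda>S T v. S (T v)" by auto

instance
proof
  show "(0::('a, 'b) linop) \<noteq> 1"
    by transfer (metis zero_neq_one)
  fix a b c :: "('a, 'b) linop"
  show "(a + b) * c = a * c + b * c" by transfer auto
  show "a * (b + c) = a * b + a * c" by transfer auto
qed (transfer; auto simp: algebra_simps)+

end

lemma linop_eqI: "(\<And>v b. app S v b = app T v b) \<Longrightarrow> S = T"
  by (metis app_inject ext)

lemma app_ring_simps [simp]:
  "app 0 v b = 0" "app 1 v = v" "app (S + T) v b = app S v b + app T v b"
  "app (S - T) v b = app S v b - app T v b" "app (- S) v b = - app S v b"
  "app (S * T) v = app S (app T v)"
  by (transfer, simp)+

lemma app_add: "app T (\<lambda>b. u b + v b) = (\<lambda>b. app T u b + app T v b)"
  and app_scaled: "app T (c \<odot> u) = c \<odot> app T u"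
  by (transfer, blast)+

lemma app_zero: "app T (\<lambda>b. 0) = (\<lambda>b. 0)"
  using app_scaled[of T 0 "\<lambda>_. 0"] by simp

lemma app_uminus: "app T (\<lambda>b. - u b) = (\<lambda>b. - app T u b)"
  using app_scaled[of T "- 1" u] by simp

lemma app_sum: "app T (\<lambda>b. \<Sum>i\<in>I. f i b) = (\<lambda>b. \<Sum>i\<in>I. app T (f i) b)"
  by (induction I rule: infinite_finite_induct) (simp_all add: app_zero app_add)

lemma app_sum_linop [simp]: "app (\<Sum>i\<in>I. T i) v b = (\<Sum>i\<in>I. app (T i) v b)"
  by (induction I rule: infinite_finite_induct) simp_all

lemma app_of_nat [simp]: "app (of_nat k) v = of_nat k \<odot> v"
  by (induction k) (simp_all add: algebra_simps fun_eq_iff)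

lemma app_of_int [simp]: "app (of_int k) v = of_int k \<odot> v"
  by (cases k rule: int_cases2) (simp_all add: fun_eq_iff)

lemma app_neg_one_power [simp]: "app ((-1) ^ k) v = (-1) ^ k \<odot> v"
  by (cases "even k") (simp_all add: fun_eq_iff)

lemma linop_add_self_eq_0: "T + T = 0 \<Longrightarrow> T = 0" for T :: "('b, 'k::field_char_0) linop"
proof (rule linop_eqI)
  fix v b assume "T + T = 0"
  then have "app (T + T) v b = 0" by simp
  then have "2 * app T v b = 0" by (simp only: app_ring_simps mult_2)
  then show "app T v b = app 0 v b" by simp
qed

definition weighted_pullback :: "('b \<Rightarrow> 'k) \<Rightarrow> ('b \<Rightarrow> 'b) \<Rightarrow> ('b, 'k::field) linop" where
  "weighted_pullback c t = Linop (\<lambda>v b. c b * v (t b))"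

lemma app_weighted_pullback [simp]: "app (weighted_pullback c t) v b = c b * v (t b)"
  unfolding weighted_pullback_def by (subst Linop_inverse) (auto simp: algebra_simps)

definition ket :: "'b \<Rightarrow> 'b \<Rightarrow> 'k::field" where "ket \<phi> = (\<lambda>\<psi>. if \<psi> = \<phi> then 1 else 0)"

lemma ket_expansion:
  assumes "finite {\<phi>. u \<phi> \<noteq> 0}" shows "u = (\<lambda>\<psi>. \<Sum>\<phi>\<in>{\<phi>. u \<phi> \<noteq> 0}. u \<phi> * ket \<phi> \<psi>)"
proof
  fix \<psi>
  have "(\<Sum>\<phi>\<in>{\<phi>. u \<phi> \<noteq> 0}. u \<phi> * ket \<phi> \<psi>) = (\<Sum>\<phi>\<in>{\<phi>. u \<phi> \<noteq> 0}. if \<phi> = \<psi> then u \<phi> else 0)"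
    by (intro sum.cong) (auto simp: ket_def)
  then show "u \<psi> = (\<Sum>\<phi>\<in>{\<phi>. u \<phi> \<noteq> 0}. u \<phi> * ket \<phi> \<psi>)" using assms by simp
qed

lemma weighted_pullback_ketI:
  assumes "\<And>\<psi>. t \<psi> = \<phi> \<Longrightarrow> c \<psi> \<noteq> 0 \<Longrightarrow> \<psi> = \<phi>'" and "c \<phi>' * (if t \<phi>' = \<phi> then 1 else 0) = c'"
  shows "app (weighted_pullback c t) (ket \<phi>) = c' \<odot> ket \<phi>'"
proof
  fix \<psi>
  show "app (weighted_pullback c t) (ket \<phi>) \<psi> = c' * ket \<phi>' \<psi>"
    using assms by (cases "\<psi> = \<phi>'") (auto simp: ket_def)
qed

section \<open>Identities in rings\<close>

lemma commute_left: "x * y = y * x \<Longrightarrow> x * (y * z) = y * (x * (z :: 'r::semigroup_mult))"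
  by (metis mult.assoc)

lemma anticommute_left: "x * y = - (y * x) \<Longrightarrow> x * (y * z) = - (y * (x * (z :: 'r::ring)))"
  by (simp flip: mult.assoc)

lemma of_int_left_commute: "x * (of_int k * y) = of_int k * (x * (y :: 'r::ring_1))"
  by (metis mult.assoc mult_of_int_commute)

lemma neg_one_power_left_commute: "x * ((-1) ^ k * y) = (-1) ^ k * (x * (y :: 'r::ring_1))"
  by (cases "even k") simp_all

lemma sum_lessThan_add:
  "(\<Sum>p<m+n::nat. g p)
    = (\<Sum>p<m. g p) + (\<Sum>j<n. g (m + j) :: 'a::comm_monoid_add)"
  by (induction n) (simp_all add: add.assoc)

lemma square_sum_anticommuting:
  fixes a :: "'i \<Rightarrow> 'r::ring_1"
  assumes anti: "\<And>r p. r \<in> I \<Longrightarrow> p \<in> I \<Longrightarrow> a r * a p = - (a p * a r)"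
  shows "(\<Sum>r\<in>I. a r) * (\<Sum>r\<in>I. a r) + (\<Sum>r\<in>I. a r) * (\<Sum>r\<in>I. a r) = 0"
proof -
  have "(\<Sum>r\<in>I. a r) * (\<Sum>r\<in>I. a r) = (\<Sum>r\<in>I. \<Sum>p\<in>I. a p * a r)"
    unfolding sum_product by (rule sum.swap)
  also have "\<dots> = (\<Sum>r\<in>I. \<Sum>p\<in>I. - (a r * a p))" by (intro sum.cong refl anti)
  also have "\<dots> = - ((\<Sum>r\<in>I. a r) * (\<Sum>r\<in>I. a r))" by (simp add: sum_product sum_negf)
  finally show ?thesis by (simp only: eq_neg_iff_add_eq_0)
qed

lemma anticommutator_koszul:
  fixes \<delta> \<iota> :: "'i \<Rightarrow> 'r::ring_1"
  assumes "finite I" and i: "i \<in> I"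
    and \<iota>_M: "\<And>r. r \<in> I \<Longrightarrow> \<iota> r * M = M * \<iota> r"
    and e_\<delta>: "\<And>r. r \<in> I \<Longrightarrow> e * \<delta> r = \<delta> r * e"
    and \<iota>_e: "\<And>r. r \<in> I \<Longrightarrow> \<iota> r * e = (if r = i then \<tau> else 0) - e * \<iota> r"
  shows "(\<Sum>r\<in>I. \<delta> r * \<iota> r) * (M * e) + M * e * (\<Sum>r\<in>I. \<delta> r * \<iota> r)
       = \<delta> i * M * \<tau> - (\<Sum>r\<in>I. (\<delta> r * M - M * \<delta> r) * (e * \<iota> r))"
proof -
  have summand: "\<delta> r * \<iota> r * (M * e) + M * e * (\<delta> r * \<iota> r)
      = (if r = i then \<delta> i * M * \<tau> else 0) - (\<delta> r * M - M * \<delta> r) * (e * \<iota> r)" if r: "r \<in> I" for r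
  proof -
    have "\<delta> r * \<iota> r * (M * e) = \<delta> r * M * (\<iota> r * e)"
      by (simp add: mult.assoc commute_left[OF \<iota>_M[OF r]])
    also have "\<dots> = (if r = i then \<delta> i * M * \<tau> else 0) - \<delta> r * M * (e * \<iota> r)"
      by (simp add: \<iota>_e[OF r] right_diff_distrib)
    finally show ?thesis by (simp add: left_diff_distrib mult.assoc commute_left[OF e_\<delta>[OF r]])
  qed
  have "(\<Sum>r\<in>I. \<delta> r * \<iota> r) * (M * e) + M * e * (\<Sum>r\<in>I. \<delta> r * \<iota> r)
      = (\<Sum>r\<in>I. (if r = i then \<delta> i * M * \<tau> else 0) - (\<delta> r * M - M * \<delta> r) * (e * \<iota> r))"
    unfolding sum_distrib_left sum_distrib_right sum.distrib[symmetric]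
    by (intro sum.cong refl summand)
  then show ?thesis using assms(1) i by (simp add: sum_subtractf)
qed

declare split_paired_All [simp del] split_paired_Ex [simp del]

section \<open>Bosonic and fermionic operators\<close>

text \<open>\<open>(\<beta>, F)\<close> is the state with \<open>\<beta> p\<close> bosons of index \<open>p\<close> and the fermions in \<open>F\<close>.  All
  operators are pullbacks of coefficient functions, so the relations need no finiteness; the
  annihilator of a boson, a derivative, reads off the coefficient of the state with one more boson.\<close>
type_synonym fock = "(nat \<Rightarrow> nat) \<times> nat set"

text \<open>The dummy parameter fixes the scalars, which makes type annotations unnecessary.\<close>
locale scalars = fixes scalar_type :: "'k::field itself"
begin

definition boson_ann :: "nat \<Rightarrow> (fock, 'k) linop" where
  "boson_ann p =
     weighted_pullback (\<lambda>(\<beta>, F). of_nat (Suc (\<beta> p))) (\<lambda>(\<beta>, F). (\<beta>(p := Suc (\<beta> p)), F))"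

definition boson_cre :: "nat \<Rightarrow> (fock, 'k) linop" where
  "boson_cre p =
     weighted_pullback (\<lambda>(\<beta>, F). if \<beta> p = 0 then 0 else 1) (\<lambda>(\<beta>, F). (\<beta>(p := \<beta> p - 1), F))"

definition boson_shift :: "(nat \<Rightarrow> nat) \<Rightarrow> (fock, 'k) linop" where
  "boson_shift f =
     weighted_pullback (\<lambda>(\<beta>, F). if \<forall>i. f i \<le> \<beta> i then 1 else 0) (\<lambda>(\<beta>, F). (\<lambda>i. \<beta> i - f i, F))"

definition sign_below :: "nat \<Rightarrow> nat set \<Rightarrow> 'k" where
  "sign_below p F = (-1) ^ card (F \<inter> {..<p})"

definition fermion_ann :: "nat \<Rightarrow> (fock, 'k) linop" where
  "fermion_ann p =
     weighted_pullback (\<lambda>(\<beta>, F). if p \<in> F then 0 else sign_below p F) (\<lambda>(\<beta>, F). (\<beta>, insert p F))"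

definition fermion_cre :: "nat \<Rightarrow> (fock, 'k) linop" where
  "fermion_cre p =
     weighted_pullback (\<lambda>(\<beta>, F). if p \<in> F then sign_below p F else 0) (\<lambda>(\<beta>, F). (\<beta>, F - {p}))"

definition boson_parity :: "nat set \<Rightarrow> (fock, 'k) linop" where
  "boson_parity J = weighted_pullback (\<lambda>(\<beta>, F). (-1) ^ sum \<beta> J) (\<lambda>\<phi>. \<phi>)"

definition fermion_parity :: "nat set \<Rightarrow> (fock, 'k) linop" where
  "fermion_parity J = weighted_pullback (\<lambda>(\<beta>, F). (-1) ^ card (F \<inter> J)) (\<lambda>\<phi>. \<phi>)"

lemma fock_linop_eqI: "(\<And>v \<beta> F. app S v (\<beta>, F) = app T v (\<beta>, F)) \<Longrightarrow> S = T"
  by (rule linop_eqI) (simp add: split_paired_all)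

lemma boson_ann_commute: "boson_ann p * boson_ann q = boson_ann q * boson_ann p"
  by (rule fock_linop_eqI) (auto simp: boson_ann_def fun_upd_twist)

lemma boson_cre_commute: "boson_cre p * boson_cre q = boson_cre q * boson_cre p"
  by (rule fock_linop_eqI) (auto simp: boson_cre_def fun_upd_twist)

lemma boson_ann_cre:
  "boson_ann p * boson_cre q
    = (if p = q then 1 else 0) + boson_cre q * boson_ann p"
  by (rule fock_linop_eqI)
    (auto simp: boson_ann_def boson_cre_def fun_upd_twist algebra_simps split: if_splits)

lemma sign_below_insert:
  "sign_below q (insert p F) = (if p < q \<and> p \<notin> F then - sign_below q F else sign_below q F)"
proof -
  have "insert p F \<inter> {..<q} = (if p < q then insert p (F \<inter> {..<q}) else F \<inter> {..<q})" by auto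
  then show ?thesis by (auto simp: sign_below_def insert_absorb)
qed

lemma sign_below_remove:
  "sign_below q (F - {p}) = (if p < q \<and> p \<in> F then - sign_below q F else sign_below q F)"
proof (cases "p \<in> F")
  case True
  then obtain G where "F = insert p G" "p \<notin> G" by (rule Set.set_insert)
  then show ?thesis by (simp add: sign_below_insert)
qed simp

lemma sign_below_square [simp]:
  "sign_below p F * sign_below p F = 1" "sign_below p F * (sign_below p F * x) = x"
  by (simp_all add: sign_below_def flip: power_add mult.assoc)

lemma fermion_ann_anticommute: "fermion_ann p * fermion_ann q = - (fermion_ann q * fermion_ann p)"
  by (rule fock_linop_eqI) (auto simp: fermion_ann_def sign_below_insert insert_commute)

lemma fermion_cre_anticommute: "fermion_cre p * fermion_cre q = - (fermion_cre q * fermion_cre p)"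
proof (rule fock_linop_eqI)
  fix v :: "fock \<Rightarrow> 'k" and \<beta> F
  have "F - {p} - {q} = F - {q} - {p}" by auto
  then show "app (fermion_cre p * fermion_cre q) v (\<beta>, F)
      = app (- (fermion_cre q * fermion_cre p)) v (\<beta>, F)"
    by (auto simp: fermion_cre_def sign_below_remove)
qed

lemma fermion_ann_cre:
  "fermion_ann p * fermion_cre q = (if p = q then 1 else 0) - fermion_cre q * fermion_ann p"
proof (rule fock_linop_eqI)
  fix v :: "fock \<Rightarrow> 'k" and \<beta> F
  have "p \<noteq> q \<Longrightarrow> insert p F - {q} = insert p (F - {q})" and "p \<notin> F \<Longrightarrow> insert p F - {p} = F" by auto
  then show "app (fermion_ann p * fermion_cre q) v (\<beta>, F)
      = app ((if p = q then 1 else 0) - fermion_cre q * fermion_ann p) v (\<beta>, F)"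
    by (auto simp: fermion_ann_def fermion_cre_def sign_below_remove sign_below_insert
        insert_absorb)
qed

lemma boson_fermion_commute:
  "fermion_ann q * boson_ann p = boson_ann p * fermion_ann q"
  "fermion_cre q * boson_ann p = boson_ann p * fermion_cre q"
  "fermion_ann q * boson_cre p = boson_cre p * fermion_ann q"
  "fermion_cre q * boson_cre p = boson_cre p * fermion_cre q"
  by (rule fock_linop_eqI, auto simp: boson_ann_def boson_cre_def fermion_ann_def fermion_cre_def)+

lemma neg_one_power_card_insert_Int:
  assumes "finite J" "p \<notin> F"
  shows "(-1) ^ card (insert p F \<inter> J)
    = (if p \<in> J then - ((-1) ^ card (F \<inter> J)) else (-1) ^ card (F \<inter> J) :: 'r::ring_1)"
  using assms by (auto simp: Int_insert_left)

lemma neg_one_power_card_remove_Int: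
  assumes "finite J" "p \<in> F"
  shows "(-1) ^ card ((F - {p}) \<inter> J)
    = (if p \<in> J then - ((-1) ^ card (F \<inter> J)) else (-1) ^ card (F \<inter> J) :: 'r::ring_1)"
  using neg_one_power_card_insert_Int[of J p "F - {p}", where 'r = 'r] assms
  by (simp add: insert_absorb)

lemma fermion_parity_ann:
  "finite J \<Longrightarrow> fermion_parity J * fermion_ann p
    = (if p \<in> J then - (fermion_ann p * fermion_parity J) else fermion_ann p * fermion_parity J)"
  by (rule fock_linop_eqI)
    (auto simp: fermion_parity_def fermion_ann_def neg_one_power_card_insert_Int)

lemma fermion_parity_cre:
  "finite J \<Longrightarrow> fermion_parity J * fermion_cre p
    = (if p \<in> J then - (fermion_cre p * fermion_parity J) else fermion_cre p * fermion_parity J)"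
  by (rule fock_linop_eqI)
    (auto simp: fermion_parity_def fermion_cre_def neg_one_power_card_remove_Int split: if_splits)

lemma fermion_parity_boson:
  "fermion_parity J * boson_ann p = boson_ann p * fermion_parity J"
  "fermion_parity J * boson_cre p = boson_cre p * fermion_parity J"
  by (rule fock_linop_eqI, auto simp: boson_ann_def boson_cre_def fermion_parity_def)+

lemma fermion_parity_commute:
  "fermion_parity J * fermion_parity J' = fermion_parity J' * fermion_parity J"
  by (rule fock_linop_eqI) (auto simp: fermion_parity_def)

lemma fermion_parity_square: "fermion_parity J * fermion_parity J = 1"
  by (rule fock_linop_eqI) (auto simp: fermion_parity_def simp flip: power_add mult.assoc)

lemma sum_fun_upd_notin: "p \<notin> J \<Longrightarrow> sum (\<beta>(p := x)) J = sum \<beta> J"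
  by (rule sum.cong) auto

lemma sum_fun_upd_in:
  "finite J \<Longrightarrow> p \<in> J \<Longrightarrow> sum (\<beta>(p := x)) J + \<beta> p = sum \<beta> J + (x :: nat)"
  by (simp add: sum.remove[of J p] sum_fun_upd_notin fun_upd_same del: fun_upd_apply)

lemma boson_parity_ann:
  "finite J \<Longrightarrow> boson_parity J * boson_ann p
    = (if p \<in> J then - (boson_ann p * boson_parity J) else boson_ann p * boson_parity J)"
  by (rule fock_linop_eqI)
    (auto simp: boson_parity_def boson_ann_def sum.remove[of J p] sum_fun_upd_notin
        simp del: fun_upd_apply, simp)

lemma boson_parity_cre:
  assumes "finite J"
  shows "boson_parity J * boson_cre p
    = (if p \<in> J then - (boson_cre p * boson_parity J) else boson_cre p * boson_parity J)"
proof (rule fock_linop_eqI)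
  fix v :: "fock \<Rightarrow> 'k" and \<beta> F
  have "sum \<beta> J = Suc (sum (\<beta>(p := \<beta> p - 1)) J)" if "p \<in> J" "\<beta> p \<noteq> 0"
    using sum_fun_upd_in[OF assms that(1), of \<beta> "\<beta> p - 1"] that(2) by simp
  then show "app (boson_parity J * boson_cre p) v (\<beta>, F)
      = app (if p \<in> J then - (boson_cre p * boson_parity J) else boson_cre p * boson_parity J)
          v (\<beta>, F)"
    by (auto simp: boson_parity_def boson_cre_def sum_fun_upd_notin simp del: fun_upd_apply)
qed

lemma boson_parity_fermion:
  "boson_parity J * fermion_ann p = fermion_ann p * boson_parity J"
  "boson_parity J * fermion_cre p = fermion_cre p * boson_parity J"
  "boson_parity J * fermion_parity J' = fermion_parity J' * boson_parity J"
  by (rule fock_linop_eqI, auto simp: boson_parity_def fermion_ann_def fermion_cre_def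
      fermion_parity_def)+

lemma boson_parity_square: "boson_parity J * boson_parity J = 1"
  by (rule fock_linop_eqI) (auto simp: boson_parity_def simp flip: power_add mult.assoc)

lemma boson_shift_0: "boson_shift (\<lambda>_. 0) = 1"
  by (rule fock_linop_eqI) (auto simp: boson_shift_def)

lemma boson_shift_Suc: "boson_shift (f(p := Suc k)) = boson_cre p * boson_shift (f(p := k))"
proof (rule fock_linop_eqI)
  fix v :: "fock \<Rightarrow> 'k" and \<beta> F
  have support: "(\<forall>i. (f(p := Suc k)) i \<le> \<beta> i)
      \<longleftrightarrow> \<beta> p \<noteq> 0 \<and> (\<forall>i. (f(p := k)) i \<le> (\<beta>(p := \<beta> p - 1)) i)"
    by (cases "\<beta> p") auto
  have target: "(\<lambda>i. \<beta> i - (f(p := Suc k)) i) = (\<lambda>i. (\<beta>(p := \<beta> p - 1)) i - (f(p := k)) i)"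
    by auto
  show "app (boson_shift (f(p := Suc k))) v (\<beta>, F)
      = app (boson_cre p * boson_shift (f(p := k))) v (\<beta>, F)"
    unfolding boson_shift_def boson_cre_def app_ring_simps app_weighted_pullback prod.case
      support target by simp
qed

lemma boson_cre_shift: "boson_cre p * boson_shift f = boson_shift f * boson_cre p"
proof (rule fock_linop_eqI)
  fix v :: "fock \<Rightarrow> 'k" and \<beta> F
  have support: "\<beta> p \<noteq> 0 \<and> (\<forall>i. f i \<le> (\<beta>(p := \<beta> p - 1)) i) \<longleftrightarrow> (\<forall>i. f i \<le> \<beta> i) \<and> \<beta> p - f p \<noteq> 0"
    (is "?l \<longleftrightarrow> ?r")
  proof -
    have "?l \<longleftrightarrow> (\<forall>i. i \<noteq> p \<longrightarrow> f i \<le> \<beta> i) \<and> f p < \<beta> p" by auto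
    also have "\<dots> \<longleftrightarrow> ?r" by (auto, metis less_imp_le_nat)
    finally show ?thesis .
  qed
  have target: "(\<lambda>i. (\<beta>(p := \<beta> p - 1)) i - f i) = (\<lambda>i. \<beta> i - f i)(p := \<beta> p - f p - 1)" by auto
  have "app (boson_cre p * boson_shift f) v (\<beta>, F)
      = (if \<beta> p \<noteq> 0 \<and> (\<forall>i. f i \<le> (\<beta>(p := \<beta> p - 1)) i)
         then v (\<lambda>i. (\<beta>(p := \<beta> p - 1)) i - f i, F) else 0)"
    by (simp add: boson_cre_def boson_shift_def del: fun_upd_apply)
  also have "\<dots> = app (boson_shift f * boson_cre p) v (\<beta>, F)"
    unfolding support target by (simp add: boson_cre_def boson_shift_def del: fun_upd_apply)
  finally show "app (boson_cre p * boson_shift f) v (\<beta>, F)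
      = app (boson_shift f * boson_cre p) v (\<beta>, F)" .
qed

lemma boson_ann_shift:
  "boson_ann p * boson_shift f
      = of_nat (f p) * boson_shift (f(p := f p - 1)) + boson_shift f * boson_ann p"
proof (induction "f p" arbitrary: f)
  case 0
  show ?case
  proof (rule fock_linop_eqI)
    fix v :: "fock \<Rightarrow> 'k" and \<beta> F
    have "(\<forall>i. f i \<le> (\<beta>(p := Suc (\<beta> p))) i) \<longleftrightarrow> (\<forall>i. f i \<le> \<beta> i)"
      using 0 by (auto, metis le0)
    moreover have "(\<lambda>i. (\<beta>(p := Suc (\<beta> p))) i - f i) = (\<lambda>i. \<beta> i - f i)(p := Suc (\<beta> p))"
      using 0 by auto
    ultimately show "app (boson_ann p * boson_shift f) v (\<beta>, F)
        = app (of_nat (f p) * boson_shift (f(p := f p - 1)) + boson_shift f * boson_ann p) v (\<beta>, F)"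
      using 0 by (simp add: boson_ann_def boson_shift_def del: fun_upd_apply)
  qed
next
  case (Suc k)
  define g where "g = f(p := k)"
  have g: "g p = k" "g(p := Suc k) = f" "f(p := f p - 1) = g"
    by (simp_all add: g_def Suc(2) fun_upd_idem flip: Suc(2))
  have shift_f: "boson_shift f = boson_cre p * boson_shift g"
    using boson_shift_Suc[of g p k] g by (simp add: g_def)
  have "of_nat k * (boson_cre p * boson_shift (g(p := k - 1))) = of_nat k * boson_shift g"
    using g(1) by (cases k) (simp_all add: fun_upd_idem flip: boson_shift_Suc)
  moreover have "boson_ann p * boson_shift f
      = boson_shift g + boson_cre p * (boson_ann p * boson_shift g)"
    by (simp add: shift_f boson_ann_cre distrib_right flip: mult.assoc)
  moreover have "boson_ann p * boson_shift g
      = of_nat k * boson_shift (g(p := k - 1)) + boson_shift g * boson_ann p"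
    using Suc(1)[of g] g(1) by simp
  moreover have "boson_cre p * (of_nat k * x) = of_nat k * (boson_cre p * x)" for x
    by (metis mult.assoc mult_of_nat_commute)
  ultimately show ?case
    unfolding g(3) using shift_f Suc(2)[symmetric]
    by (simp add: distrib_left distrib_right mult.assoc)
qed

lemma boson_shift_commute:
  "fermion_ann p * boson_shift f = boson_shift f * fermion_ann p"
  "fermion_cre p * boson_shift f = boson_shift f * fermion_cre p"
  "fermion_parity J * boson_shift f = boson_shift f * fermion_parity J"
  by (rule fock_linop_eqI, auto simp: boson_shift_def fermion_ann_def fermion_cre_def
      fermion_parity_def)+

lemma boson_parity_shift:
  assumes "\<And>p. p \<in> J \<Longrightarrow> f p = 0"
  shows "boson_parity J * boson_shift f = boson_shift f * boson_parity J"
proof (rule fock_linop_eqI)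
  fix v :: "fock \<Rightarrow> 'k" and \<beta> F
  have "(\<Sum>p\<in>J. \<beta> p - f p) = sum \<beta> J" by (rule sum.cong) (simp_all add: assms)
  then show "app (boson_parity J * boson_shift f) v (\<beta>, F)
      = app (boson_shift f * boson_parity J) v (\<beta>, F)"
    by (simp add: boson_parity_def boson_shift_def)
qed

lemma boson_ann_ket: "app (boson_ann p) (ket (\<beta>, F)) = of_nat (\<beta> p) \<odot> ket (\<beta>(p := \<beta> p - 1), F)"
  unfolding boson_ann_def
  by (intro weighted_pullback_ketI; cases "\<beta> p")
    (auto simp: fun_upd_idem, metis fun_upd_same nat.distinct(1))

lemma boson_cre_ket: "app (boson_cre p) (ket (\<beta>, F)) = ket (\<beta>(p := Suc (\<beta> p)), F)"
proof -
  have "app (boson_cre p) (ket (\<beta>, F)) = 1 \<odot> ket (\<beta>(p := Suc (\<beta> p)), F)"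
    unfolding boson_cre_def by (rule weighted_pullback_ketI) (auto split: if_splits)
  then show ?thesis by simp
qed

lemma boson_shift_ket: "app (boson_shift f) (ket (\<beta>, F)) = ket (\<lambda>i. f i + \<beta> i, F)"
proof -
  have "app (boson_shift f) (ket (\<beta>, F)) = 1 \<odot> ket (\<lambda>i. f i + \<beta> i, F)"
    unfolding boson_shift_def by (rule weighted_pullback_ketI) (auto split: if_splits)
  then show ?thesis by simp
qed

lemma fermion_ann_ket:
  "app (fermion_ann p) (ket (\<beta>, F)) = (if p \<in> F then sign_below p F else 0) \<odot> ket (\<beta>, F - {p})"
  unfolding fermion_ann_def
  by (rule weighted_pullback_ketI) (auto simp: sign_below_remove split: if_splits)

lemma fermion_cre_ket:
  "app (fermion_cre p) (ket (\<beta>, F)) = (if p \<in> F then 0 else sign_below p F) \<odot> ket (\<beta>, insert p F)"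
  unfolding fermion_cre_def
  by (rule weighted_pullback_ketI) (auto simp: sign_below_insert split: if_splits)

lemma boson_parity_ket: "app (boson_parity J) (ket (\<beta>, F)) = (-1) ^ sum \<beta> J \<odot> ket (\<beta>, F)"
  by (rule ext) (auto simp: boson_parity_def ket_def)

lemma fermion_parity_ket: "app (fermion_parity J) (ket (\<beta>, F)) = (-1) ^ card (F \<inter> J) \<odot> ket (\<beta>, F)"
  by (rule ext) (auto simp: fermion_parity_def ket_def)

end

section \<open>The differential and Cartan's formula\<close>

locale witt = scalars scalar_type for scalar_type :: "'k::field itself" +
  fixes m n :: nat
begin

text \<open>The parities of the numbers of \<open>e\<^sup>*\<^sub>p\<close> with \<open>p < m\<close>, of \<open>y\<close>'s, and of \<open>e\<^sup>*\<^sub>p\<close> with \<open>p \<ge> m\<close>.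
  They are inserted below so that operators on \<open>\<R>\<close> commute with operators on \<open>\<Omega>(V\<^sup>*)\<close>, and so that
  \<open>partial p\<close> has an ordinary (not super) commutator with multiplication by an element of \<open>\<R>\<close>.\<close>
definition even_form_parity :: "(fock, 'k) linop" where "even_form_parity = fermion_parity {..<m}"
definition y_parity :: "(fock, 'k) linop" where "y_parity = fermion_parity {m..<m+n}"
definition odd_form_parity :: "(fock, 'k) linop" where "odd_form_parity = boson_parity {m..<m+n}"

definition y_mult :: "nat \<Rightarrow> (fock, 'k) linop"
  where "y_mult s = fermion_cre (m + s) * even_form_parity"
definition y_deriv :: "nat \<Rightarrow> (fock, 'k) linop"
  where "y_deriv s = fermion_ann (m + s) * even_form_parity"

definition super_partial :: "nat \<Rightarrow> (fock, 'k) linop" where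
  "super_partial p = (if p < m then boson_ann p else y_deriv (p - m))"
definition partial :: "nat \<Rightarrow> (fock, 'k) linop" where
  "partial p = (if p < m then boson_ann p else y_deriv (p - m) * y_parity)"
definition contract :: "nat \<Rightarrow> (fock, 'k) linop" where
  "contract p = (if p < m then fermion_ann p else boson_ann p * even_form_parity)"
definition wedge :: "nat \<Rightarrow> (fock, 'k) linop" where
  "wedge p = (if p < m then fermion_cre p else boson_cre p * even_form_parity)"

definition differential :: "(fock, 'k) linop" where
  "differential = (\<Sum>p<m+n. partial p * contract p)"

text \<open>Composing an odd operator with the total parity \<open>y_parity * odd_form_parity\<close> makes it even.\<close>
definition total_parity :: "nat \<Rightarrow> (fock, 'k) linop" where
  "total_parity i = (if i < m then 1 else y_parity * odd_form_parity)"
definition form_twist :: "nat \<Rightarrow> (fock, 'k) linop" where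
  "form_twist i = (if i < m then 1 else odd_form_parity)"
definition relative_parity :: "nat \<Rightarrow> nat \<Rightarrow> (fock, 'k) linop" where
  "relative_parity p i = (if p < m \<longleftrightarrow> i < m then 1 else y_parity)"

lemma parity_square:
  "even_form_parity * even_form_parity = 1" "y_parity * y_parity = 1"
  "odd_form_parity * odd_form_parity = 1"
  by (simp_all add: even_form_parity_def y_parity_def odd_form_parity_def fermion_parity_square
      boson_parity_square)

lemma parity_cancel_left:
  "even_form_parity * (even_form_parity * z) = z" "y_parity * (y_parity * z) = z"
  "odd_form_parity * (odd_form_parity * z) = z"
  by (simp_all add: parity_square flip: mult.assoc)

lemma parity_commute:
  "y_parity * even_form_parity = even_form_parity * y_parity"
  "odd_form_parity * even_form_parity = even_form_parity * odd_form_parity"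
  "odd_form_parity * y_parity = y_parity * odd_form_parity"
  by (simp_all add: even_form_parity_def y_parity_def odd_form_parity_def fermion_parity_commute
      boson_parity_fermion)

lemma even_form_parity_commute:
  "even_form_parity * boson_ann p = boson_ann p * even_form_parity"
  "even_form_parity * boson_cre p = boson_cre p * even_form_parity"
  "m \<le> p \<Longrightarrow> even_form_parity * fermion_ann p = fermion_ann p * even_form_parity"
  "m \<le> p \<Longrightarrow> even_form_parity * fermion_cre p = fermion_cre p * even_form_parity"
  by (simp_all add: even_form_parity_def fermion_parity_ann fermion_parity_cre fermion_parity_boson)

lemma even_form_parity_anticommute:
  "p < m \<Longrightarrow> even_form_parity * fermion_ann p = - (fermion_ann p * even_form_parity)"
  "p < m \<Longrightarrow> even_form_parity * fermion_cre p = - (fermion_cre p * even_form_parity)"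
  by (simp_all add: even_form_parity_def fermion_parity_ann fermion_parity_cre)

lemma y_parity_commute:
  "y_parity * boson_ann p = boson_ann p * y_parity"
  "y_parity * boson_cre p = boson_cre p * y_parity"
  "p < m \<Longrightarrow> y_parity * fermion_ann p = fermion_ann p * y_parity"
  "p < m \<Longrightarrow> y_parity * fermion_cre p = fermion_cre p * y_parity"
  by (simp_all add: y_parity_def fermion_parity_ann fermion_parity_cre fermion_parity_boson)

lemma y_parity_anticommute:
  "m \<le> p \<Longrightarrow> p < m + n \<Longrightarrow> y_parity * fermion_ann p = - (fermion_ann p * y_parity)"
  "m \<le> p \<Longrightarrow> p < m + n \<Longrightarrow> y_parity * fermion_cre p = - (fermion_cre p * y_parity)"
  by (simp_all add: y_parity_def fermion_parity_ann fermion_parity_cre)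

lemma odd_form_parity_commute:
  "odd_form_parity * fermion_ann p = fermion_ann p * odd_form_parity"
  "odd_form_parity * fermion_cre p = fermion_cre p * odd_form_parity"
  "p < m \<Longrightarrow> odd_form_parity * boson_ann p = boson_ann p * odd_form_parity"
  "p < m \<Longrightarrow> odd_form_parity * boson_cre p = boson_cre p * odd_form_parity"
  by (simp_all add: odd_form_parity_def boson_parity_ann boson_parity_cre boson_parity_fermion)

lemma odd_form_parity_anticommute:
  "m \<le> p \<Longrightarrow> p < m + n \<Longrightarrow> odd_form_parity * boson_ann p = - (boson_ann p * odd_form_parity)"
  "m \<le> p \<Longrightarrow> p < m + n \<Longrightarrow> odd_form_parity * boson_cre p = - (boson_cre p * odd_form_parity)"
  by (simp_all add: odd_form_parity_def boson_parity_ann boson_parity_cre)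

lemma distinct_modes:
  "p \<noteq> q \<Longrightarrow> fermion_ann p * fermion_cre q = - (fermion_cre q * fermion_ann p)"
  "p \<noteq> q \<Longrightarrow> boson_ann p * boson_cre q = boson_cre q * boson_ann p"
  by (simp_all add: fermion_ann_cre boson_ann_cre)

lemma ann_cre_left:
  "fermion_ann p * (fermion_cre q * z)
      = (if p = q then z else 0) - fermion_cre q * (fermion_ann p * z)"
  "boson_ann p * (boson_cre q * z) = (if p = q then z else 0) + boson_cre q * (boson_ann p * z)"
  by (simp_all add: fermion_ann_cre boson_ann_cre left_diff_distrib distrib_right flip: mult.assoc)

lemmas commuting = parity_commute even_form_parity_commute y_parity_commute odd_form_parity_commute
  boson_fermion_commute
lemmas anticommuting = even_form_parity_anticommute y_parity_anticommute odd_form_parity_anticommute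

text \<open>These rules move bosons to the left of fermions and parities to the right of both.\<close>
lemmas normal_order = parity_square parity_cancel_left commuting commuting[THEN commute_left]
  anticommuting anticommuting[THEN anticommute_left] mult.assoc

lemmas distinct_modes_left = distinct_modes(1)[THEN anticommute_left]
    distinct_modes(2)[THEN commute_left]

lemma contract_wedge:
  assumes "r < m + n" "p < m + n"
  shows "contract r * wedge p
      = (if r = p then 1 else 0) - (-1) ^ (ipar m r * ipar m p) * (wedge p * contract r)"
  using assms by (cases "r < m"; cases "p < m")
    (auto simp: contract_def wedge_def ipar_def normal_order fermion_ann_cre boson_ann_cre
        ann_cre_left)

lemma wedge_wedge:
  assumes "r < m + n" "p < m + n"
  shows "wedge r * wedge p = - ((-1) ^ (ipar m r * ipar m p) * (wedge p * wedge r))"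
  using assms by (cases "r < m"; cases "p < m")
    (simp_all add: wedge_def ipar_def normal_order boson_cre_commute[of r p]
      fermion_cre_anticommute[of r p] commute_left[OF boson_cre_commute[of r p]])

lemma wedge_partial: "r < m + n \<Longrightarrow> p < m + n \<Longrightarrow> wedge r * partial p = partial p * wedge r"
  by (cases "r < m"; cases "p < m")
    (simp_all add: wedge_def partial_def y_deriv_def normal_order distinct_modes
        distinct_modes_left)

lemma contract_partial: "r < m + n \<Longrightarrow> p < m + n \<Longrightarrow> contract r * partial p = partial p * contract r"
  by (cases "r < m"; cases "p < m")
    (simp_all add: contract_def partial_def y_deriv_def normal_order boson_ann_commute[of r p]
      fermion_ann_anticommute[of r p] commute_left[OF boson_ann_commute[of r p]]
      anticommute_left[OF fermion_ann_anticommute[of r p]])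

lemma contract_form_twist:
  assumes "r < m + n"
  shows "contract r * form_twist p = (-1) ^ (ipar m r * ipar m p) * (form_twist p * contract r)"
  using assms by (auto simp: contract_def form_twist_def ipar_def normal_order)

lemma partial_form_twist: "p < m + n \<Longrightarrow> form_twist i * partial p = partial p * form_twist i"
  by (auto simp: form_twist_def partial_def y_deriv_def normal_order)

lemma contract_wedge_form_twist:
  assumes "r < m + n" "p < m + n"
  shows "contract r * (wedge p * form_twist p)
      = (if r = p then form_twist p else 0) - wedge p * form_twist p * contract r"
proof -
  have "contract r * (wedge p * form_twist p) = contract r * wedge p * form_twist p"
    by (simp add: mult.assoc)
  also have "\<dots> = (if r = p then form_twist p else 0)
      - (-1) ^ (ipar m r * ipar m p) * (wedge p * (contract r * form_twist p))"
    unfolding contract_wedge[OF assms] left_diff_distrib by (simp add: mult.assoc)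
  also have "\<dots> = (if r = p then form_twist p else 0) - wedge p * form_twist p * contract r"
    unfolding contract_form_twist[OF assms(1)]
    by (cases "even (ipar m r * ipar m p)") (simp_all add: mult.assoc)
  finally show ?thesis .
qed

lemma differential_summands_anticommute:
  assumes "r < m + n" "p < m + n"
  shows "partial r * contract r * (partial p * contract p)
      = - (partial p * contract p * (partial r * contract r))"
  using assms by (cases "r < m"; cases "p < m")
    (simp_all add: contract_def partial_def y_deriv_def normal_order boson_ann_commute[of r p]
      fermion_ann_anticommute[of r p] commute_left[OF boson_ann_commute[of r p]]
      anticommute_left[OF fermion_ann_anticommute[of r p]])

lemma differential_total_parity: "differential * total_parity i = total_parity i * differential"
proof -
  have "partial p * contract p * total_parity i = total_parity i * (partial p * contract p)"
    if "p < m + n" for p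
    using that by (cases "p < m")
      (simp_all add: total_parity_def partial_def contract_def y_deriv_def normal_order)
  then show ?thesis by (simp add: differential_def sum_distrib_left sum_distrib_right)
qed

definition y_word :: "nat list \<Rightarrow> (fock, 'k) linop" where "y_word S = prod_list (map y_mult S)"

definition rmult :: "rmon \<Rightarrow> (fock, 'k) linop" where "rmult f = boson_shift (fst f) * y_word (snd f)"

definition rderiv :: "nat \<Rightarrow> rmon \<Rightarrow> int \<times> rmon" where
  "rderiv p f = (if p < m then rdx p f else rdy (p - m) f)"

definition deriv_sign :: "nat \<Rightarrow> rmon \<Rightarrow> int" where
  "deriv_sign p f = (if p < m then 1 else (-1) ^ (length (snd f) + 1))"

text \<open>\<open>\<xi>(E\<^sub>k\<^sub>l)\<close> on \<open>\<Omega>(V\<^sup>*) \<otimes> \<F>\<^sub>\<E>\<close>.\<close>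
definition form_rep :: "nat \<Rightarrow> nat \<Rightarrow> (fock, 'k) linop" where
  "form_rep k l = of_int (- ((-1) ^ ((ipar m k + ipar m l) * ipar m k))) * (wedge l * contract k)
     + (if k = l then if k < m then 1 else - 1 else 0)"

text \<open>The operator of the vector field \<open>f \<partial>\<^sub>i\<close>, or \<open>f D\<^sub>i\<^sub>-\<^sub>m\<close> if \<open>m \<le> i\<close>.\<close>
definition witt_op :: "rmon \<Rightarrow> nat \<Rightarrow> (fock, 'k) linop" where
  "witt_op f i = rmult f * super_partial i
     + (\<Sum>p<m+n. of_int (deriv_sign p f * fst (rderiv p f))
          * (rmult (snd (rderiv p f)) * (relative_parity p i * form_rep p i)))"

definition field_wedge :: "rmon \<Rightarrow> nat \<Rightarrow> (fock, 'k) linop" where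
  "field_wedge f i = rmult f * (wedge i * form_twist i)"

lemma y_word_simps [simp]: "y_word [] = 1" "y_word (s # S) = y_mult s * y_word S"
  by (simp_all add: y_word_def)

lemma y_word_append: "y_word (S @ T) = y_word S * y_word T"
  by (simp add: y_word_def)

lemma y_mult_commute:
  "s < n \<Longrightarrow> r < m + n \<Longrightarrow> contract r * y_mult s = y_mult s * contract r"
  "s < n \<Longrightarrow> r < m + n \<Longrightarrow> wedge r * y_mult s = y_mult s * wedge r"
  "odd_form_parity * y_mult s = y_mult s * odd_form_parity"
  "boson_ann p * y_mult s = y_mult s * boson_ann p"
  by (auto simp: contract_def wedge_def y_mult_def normal_order distinct_modes distinct_modes_left
      fermion_cre_anticommute[of "m + s"] anticommute_left[OF fermion_cre_anticommute[of "m + s"]])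

lemma y_parity_y_mult: "s < n \<Longrightarrow> y_parity * y_mult s = - (y_mult s * y_parity)"
  by (simp add: y_mult_def normal_order)

lemma y_deriv_y_mult: "y_deriv j * y_mult s = (if j = s then 1 else 0) - y_mult s * y_deriv j"
  by (simp add: y_deriv_def y_mult_def normal_order fermion_ann_cre ann_cre_left)

lemma y_word_commute:
  "(\<And>s. s \<in> set S \<Longrightarrow> x * y_mult s = y_mult s * x) \<Longrightarrow> x * y_word S = y_word S * x"
proof (induction S)
  case (Cons s S)
  then show ?case using commute_left[of x "y_mult s" "y_word S"] by (simp add: mult.assoc)
qed simp

lemma y_parity_y_word:
  "\<forall>s\<in>set S. s < n \<Longrightarrow> y_parity * y_word S = of_int ((-1) ^ length S) * (y_word S * y_parity)"
  by (induction S)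
    (simp_all add: mult.assoc anticommute_left[OF y_parity_y_mult] neg_one_power_left_commute)

lemma y_deriv_y_word:
  "distinct S \<Longrightarrow> y_deriv j * y_word S = of_int (fst (rdy j (a, S))) * y_word (remove1 j S)
    + of_int ((-1) ^ length S) * (y_word S * y_deriv j)"
proof (induction S)
  case (Cons s S)
  have IH: "y_deriv j * y_word S = of_int (fst (rdy j (a, S))) * y_word (remove1 j S)
      + of_int ((-1) ^ length S) * (y_word S * y_deriv j)"
    using Cons by simp
  have step: "y_deriv j * y_word (s # S) = (if j = s then y_word S else 0)
      - of_int (fst (rdy j (a, S))) * (y_mult s * y_word (remove1 j S))
      + of_int ((-1) ^ length (s # S)) * (y_word (s # S) * y_deriv j)"
  proof -
    have "y_deriv j * y_word (s # S)
        = (if j = s then y_word S else 0) - y_mult s * (y_deriv j * y_word S)"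
      by (simp add: y_deriv_y_mult left_diff_distrib flip: mult.assoc)
    then show ?thesis
      unfolding IH by (simp add: distrib_left of_int_left_commute neg_one_power_left_commute
          mult.assoc)
  qed
  show ?case
  proof (cases "j = s")
    case True
    with Cons.prems show ?thesis unfolding step by (simp add: rdy_def)
  next
    case False
    then have "fst (rdy j (a, s # S)) = - fst (rdy j (a, S))" by (auto simp: rdy_def)
    with False show ?thesis unfolding step by simp
  qed
qed (simp add: rdy_def)

lemma rmult_commute:
  assumes "x * boson_shift (fst f) = boson_shift (fst f) * x"
    and "\<And>s. s \<in> set (snd f) \<Longrightarrow> x * y_mult s = y_mult s * x"
  shows "x * rmult f = rmult f * x"
  using y_word_commute[OF assms(2)] by (simp add: rmult_def mult.assoc commute_left[OF assms(1)])

lemma rmult_commutes: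
  assumes f: "valid_rmon m n f" and r: "r < m + n"
  shows "contract r * rmult f = rmult f * contract r" "wedge r * rmult f = rmult f * wedge r"
    "form_twist i * rmult f = rmult f * form_twist i"
proof -
  have s: "s < n" if "s \<in> set (snd f)" for s using f that by (auto simp: valid_rmon_def)
  have f0: "m \<le> p \<Longrightarrow> fst f p = 0" for p using f by (simp add: valid_rmon_def)
  have even: "even_form_parity * boson_shift (fst f) = boson_shift (fst f) * even_form_parity"
    by (simp add: even_form_parity_def boson_shift_commute)
  have ann: "boson_ann r * boson_shift (fst f) = boson_shift (fst f) * boson_ann r" if "\<not> r < m"
    using f0[of r] that by (simp add: boson_ann_shift)
  show "contract r * rmult f = rmult f * contract r"
    using y_mult_commute(1)[OF s r]
    by (intro rmult_commute)
      (auto simp: contract_def boson_shift_commute even commute_left[OF ann] mult.assoc)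
  show "wedge r * rmult f = rmult f * wedge r"
    using y_mult_commute(2)[OF s r]
    by (intro rmult_commute)
      (auto simp: wedge_def boson_shift_commute even commute_left[OF boson_cre_shift] mult.assoc)
  have "odd_form_parity * boson_shift (fst f) = boson_shift (fst f) * odd_form_parity"
    unfolding odd_form_parity_def by (rule boson_parity_shift) (simp add: f0)
  then show "form_twist i * rmult f = rmult f * form_twist i"
    using y_mult_commute(3) by (auto simp: form_twist_def intro: rmult_commute)
qed

lemma boson_ann_rmult:
  "boson_ann p * rmult f - rmult f * boson_ann p = of_nat (fst f p) * rmult (snd (rdx p f))"
proof -
  have "boson_ann p * y_word (snd f) = y_word (snd f) * boson_ann p"
    by (rule y_word_commute) (rule y_mult_commute)
  moreover have "boson_ann p * rmult f = boson_ann p * boson_shift (fst f) * y_word (snd f)"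
    by (simp add: rmult_def mult.assoc)
  ultimately show ?thesis by (simp add: rmult_def rdx_def mult.assoc distrib_right boson_ann_shift)
qed

lemma y_deriv_y_parity_rmult:
  assumes f: "valid_rmon m n f"
  shows "y_deriv j * y_parity * rmult f - rmult f * (y_deriv j * y_parity)
    = of_int ((-1) ^ length (snd f) * fst (rdy j f)) * (rmult (snd (rdy j f)) * y_parity)"
proof -
  let ?sign = "of_int ((-1) ^ length (snd f)) :: (fock, 'k) linop" and ?a = "fst f" and ?S = "snd f"
  have S: "distinct ?S" "\<forall>s\<in>set ?S. s < n" using f by (auto simp: valid_rmon_def strict_sorted_iff)
  have shift: "y_parity * boson_shift ?a = boson_shift ?a * y_parity"
      "y_deriv j * boson_shift ?a = boson_shift ?a * y_deriv j"
    by (simp_all add: y_parity_def y_deriv_def even_form_parity_def boson_shift_commute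
        commute_left[OF boson_shift_commute(1)] mult.assoc)
  have sign: "?sign * (?sign * z) = z" for z
    by (cases "even (length (snd f))") simp_all
  have "y_deriv j * y_parity * rmult f = boson_shift ?a * (y_deriv j * (y_parity * y_word ?S))"
    unfolding rmult_def
    by (simp add: mult.assoc commute_left[OF shift(1)] commute_left[OF shift(2)])
  also have "y_deriv j * (y_parity * y_word ?S) = ?sign * (y_deriv j * y_word ?S * y_parity)"
    unfolding y_parity_y_word[OF S(2)] by (simp only: of_int_left_commute mult.assoc)
  also have "\<dots> = of_int ((-1) ^ length ?S * fst (rdy j f)) * (y_word (remove1 j ?S) * y_parity)
      + y_word ?S * y_deriv j * y_parity"
    unfolding y_deriv_y_word[OF S(1), of j ?a] distrib_left distrib_right of_int_mult mult.assoc
        sign by simp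
  finally show ?thesis
    by (simp add: rmult_def rdy_def distrib_left of_int_left_commute[of "boson_shift ?a"] mult.assoc
        del: of_int_mult of_int_power)
qed

lemma partial_rmult:
  assumes "valid_rmon m n f"
  shows "partial p * rmult f - rmult f * partial p
    = of_int (deriv_sign p f * fst (rderiv p f))
        * (rmult (snd (rderiv p f)) * (if p < m then 1 else - y_parity))"
  using boson_ann_rmult[of p f] y_deriv_y_parity_rmult[OF assms, of "p - m"]
  by (auto simp: partial_def deriv_sign_def rderiv_def rdx_def)

lemma form_rep_total_parity:
  assumes "p < m + n" "i < m + n"
  shows "relative_parity p i * form_rep p i * total_parity i
    = (if p < m then 1 else - y_parity)
        * ((if p = i then form_twist i else 0) - wedge i * form_twist i * contract p)"
  using assms
  by (cases "p < m"; cases "i < m")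
    (auto simp: relative_parity_def form_rep_def total_parity_def form_twist_def ipar_def
      contract_def wedge_def normal_order distrib_left distrib_right left_diff_distrib
      right_diff_distrib)

theorem cartan_formula:
  assumes f: "valid_rmon m n f" and i: "i < m + n"
  shows "witt_op f i * total_parity i
      = differential * field_wedge f i + field_wedge f i * differential"
proof -
  have "super_partial i * total_parity i = partial i * form_twist i"
    by (simp add: super_partial_def partial_def total_parity_def form_twist_def mult.assoc)
  then have "witt_op f i * total_parity i = rmult f * partial i * form_twist i
      + (\<Sum>p<m+n. of_int (deriv_sign p f * fst (rderiv p f))
          * (rmult (snd (rderiv p f)) * (relative_parity p i * form_rep p i * total_parity i)))"
    by (simp add: witt_op_def distrib_right sum_distrib_right mult.assoc del: of_int_mult)
  also have "\<dots> = rmult f * partial i * form_twist i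
      + (\<Sum>p<m+n. (partial p * rmult f - rmult f * partial p)
      * ((if p = i then form_twist i else 0) - wedge i * form_twist i * contract p))"
  proof (intro arg_cong2[of _ _ _ _ "(+)"] sum.cong refl)
    fix p assume "p \<in> {..<m + n}"
    then have "relative_parity p i * form_rep p i * total_parity i
        = (if p < m then 1 else - y_parity)
            * ((if p = i then form_twist i else 0) - wedge i * form_twist i * contract p)"
      by (intro form_rep_total_parity i) simp
    then show "of_int (deriv_sign p f * fst (rderiv p f))
          * (rmult (snd (rderiv p f)) * (relative_parity p i * form_rep p i * total_parity i))
        = (partial p * rmult f - rmult f * partial p)
          * ((if p = i then form_twist i else 0) - wedge i * form_twist i * contract p)"
      unfolding partial_rmult[OF f] by (simp only: mult.assoc)
  qed
  also have "\<dots> = partial i * rmult f * form_twist i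
      - (\<Sum>p<m+n. (partial p * rmult f - rmult f * partial p)
          * (wedge i * form_twist i * contract p))"
    using i by (simp add: right_diff_distrib sum_subtractf left_diff_distrib if_distrib[of "(*) _"]
        cong: if_cong)
  also have "\<dots> = differential * field_wedge f i + field_wedge f i * differential"
    unfolding differential_def field_wedge_def
    by (intro anticommutator_koszul[symmetric])
      (simp_all add: i rmult_commutes(1)[OF f] contract_wedge_form_twist mult.assoc
        partial_form_twist commute_left[OF wedge_partial[OF i]])
  finally show ?thesis .
qed

lemma total_parity_square: "total_parity i * total_parity i = 1"
  by (simp add: total_parity_def normal_order)

lemma witt_op_cartan:
  assumes "valid_rmon m n f" "i < m + n"
  shows "witt_op f i = (differential * field_wedge f i + field_wedge f i * differential)
      * total_parity i"
  by (simp add: mult.assoc total_parity_square flip: cartan_formula[OF assms])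

lemma witt_op_closed:
  assumes "valid_rmon m n f" "i < m + n" and closed: "app differential u = (\<lambda>_. 0)"
  shows "app (witt_op f i) u = app differential (app (field_wedge f i * total_parity i) u)"
proof -
  have "app differential (app (total_parity i) u) = (\<lambda>_. 0)"
    using closed app_zero by (metis app_ring_simps(6) differential_total_parity)
  then show ?thesis unfolding witt_op_cartan[OF assms(1,2)] by (intro ext) (simp add: app_zero)
qed

section \<open>The homotopy\<close>

definition coordinate :: "nat \<Rightarrow> rmon" where
  "coordinate p = (if p < m then ((\<lambda>_. 0)(p := 1), []) else (\<lambda>_. 0, [p - m]))"

definition homotopy :: "(fock, 'k) linop" where
  "homotopy = (\<Sum>p<m+n. (if p < m then 1 else - 1)
      * (field_wedge (coordinate p) p * total_parity p))"

definition excess :: "fock \<Rightarrow> nat" where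
  "excess \<phi> = (\<Sum>p<m+n. fst \<phi> p + (if p \<in> snd \<phi> then 0 else 1))"

definition excess_op :: "(fock, 'k) linop" where
  "excess_op = weighted_pullback (\<lambda>\<phi>. of_nat (excess \<phi>)) (\<lambda>\<phi>. \<phi>)"

lemma app_excess_op: "app excess_op u \<phi> = of_nat (excess \<phi>) * u \<phi>"
  by (simp add: excess_op_def)

lemma valid_rmon_coordinate: "p < m + n \<Longrightarrow> valid_rmon m n (coordinate p)"
  by (auto simp: coordinate_def valid_rmon_def)

lemma rmult_coordinate: "rmult (coordinate p) = (if p < m then boson_cre p else y_mult (p - m))"
  using boson_shift_Suc[of "\<lambda>_. 0" p 0]
  by (simp add: coordinate_def rmult_def boson_shift_0 fun_upd_idem)

lemma witt_op_coordinate: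
  assumes p: "p < m + n"
  shows "witt_op (coordinate p) i
    = rmult (coordinate p) * super_partial i + relative_parity p i * form_rep p i"
proof -
  have "fst (rderiv q (coordinate p)) = (if q = p then 1 else 0)" for q
    by (cases "q < m"; cases "p < m") (auto simp: rderiv_def rdx_def rdy_def coordinate_def)
  moreover have "snd (rderiv p (coordinate p)) = (\<lambda>_. 0, [])" "deriv_sign p (coordinate p) = 1"
    by (simp_all add: rderiv_def rdx_def rdy_def coordinate_def deriv_sign_def fun_upd_idem)
  moreover have "rmult (\<lambda>_. 0, []) = 1" by (simp add: rmult_def boson_shift_0)
  ultimately have "of_int (deriv_sign q (coordinate p) * fst (rderiv q (coordinate p)))
      * (rmult (snd (rderiv q (coordinate p))) * T) = (if q = p then T else 0)" for q T
    by auto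
  then show ?thesis using p by (simp add: witt_op_def del: of_int_mult)
qed

lemma witt_op_coordinate_diagonal:
  assumes "p < m + n"
  shows "(if p < m then 1 else - 1) * witt_op (coordinate p) p
    = weighted_pullback (\<lambda>(\<beta>, F). of_nat (\<beta> p) + (if p \<in> F then 0 else 1)) (\<lambda>\<phi>. \<phi>)"
proof (cases "p < m")
  case True
  then show ?thesis
    unfolding witt_op_coordinate[OF assms] rmult_coordinate
    by (intro fock_linop_eqI)
      (auto simp: super_partial_def relative_parity_def form_rep_def ipar_def
        wedge_def contract_def boson_ann_def boson_cre_def fermion_ann_def fermion_cre_def
        sign_below_insert sign_below_remove insert_absorb algebra_simps)
next
  case False
  have eq: "(if p < m then 1 else - 1) * witt_op (coordinate p) p
      = boson_cre p * boson_ann p + 1 - fermion_cre p * fermion_ann p"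
    using False unfolding witt_op_coordinate[OF assms] rmult_coordinate
    by (simp add: super_partial_def relative_parity_def form_rep_def ipar_def
        wedge_def contract_def y_mult_def y_deriv_def normal_order)
  show ?thesis
    unfolding eq by (intro fock_linop_eqI)
      (auto simp: boson_ann_def boson_cre_def fermion_ann_def fermion_cre_def
        sign_below_insert sign_below_remove insert_absorb algebra_simps)
qed

theorem homotopy_formula: "differential * homotopy + homotopy * differential = excess_op"
proof -
  have "differential * ((if p < m then 1 else - 1)
      * (field_wedge (coordinate p) p * total_parity p))
      + (if p < m then 1 else - 1) * (field_wedge (coordinate p) p * total_parity p) * differential
    = (if p < m then 1 else - 1) * witt_op (coordinate p) p" if "p < m + n" for p
    using that by (simp add: witt_op_cartan[OF valid_rmon_coordinate] distrib_right mult.assoc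
        differential_total_parity)
  then have "differential * homotopy + homotopy * differential
      = (\<Sum>p<m+n. (if p < m then 1 else - 1) * witt_op (coordinate p) p)"
    by (simp add: homotopy_def sum_distrib_left sum_distrib_right flip: sum.distrib)
  also have "\<dots> = (\<Sum>p<m+n.
      weighted_pullback (\<lambda>(\<beta>, F). of_nat (\<beta> p) + (if p \<in> F then 0 else 1)) (\<lambda>\<phi>. \<phi>))"
    by (intro sum.cong refl witt_op_coordinate_diagonal) simp
  also have "\<dots> = excess_op"
  proof (rule fock_linop_eqI)
    fix v :: "fock \<Rightarrow> 'k" and \<beta> F
    have "of_nat (excess (\<beta>, F)) = (\<Sum>p<m+n. of_nat (\<beta> p) + (if p \<in> F then 0 else 1) :: 'k)"
      by (auto simp: excess_def intro: sum.cong)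
    then show "app (\<Sum>p<m+n. weighted_pullback (\<lambda>(\<beta>, F). of_nat (\<beta> p)
        + (if p \<in> F then 0 else 1)) (\<lambda>\<phi>. \<phi>)) v (\<beta>, F)
        = app excess_op v (\<beta>, F)"
      by (simp add: app_excess_op sum_distrib_right)
  qed
  finally show ?thesis .
qed

section \<open>The grading of the Fock space\<close>

definition fock_states :: "fock set" where
  "fock_states = {\<phi>. (\<forall>p\<ge>m+n. fst \<phi> p = 0) \<and> snd \<phi> \<subseteq> {..<m+n}}"

definition fock_degree :: "fock \<Rightarrow> int" where
  "fock_degree \<phi> = int (card (snd \<phi> \<inter> {..<m})) + int (sum (fst \<phi>) {m..<m+n})"

definition fock_space :: "int \<Rightarrow> (fock \<Rightarrow> 'k) set" where
  "fock_space d = {u. finite {\<phi>. u \<phi> \<noteq> 0} \<and> (\<forall>\<phi>. u \<phi> \<noteq> 0 \<longrightarrow> \<phi> \<in> fock_states \<and> fock_degree \<phi> = d)}"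

definition has_degree :: "(fock, 'k) linop \<Rightarrow> int \<Rightarrow> bool" where
  "has_degree T k \<longleftrightarrow> (\<forall>d. \<forall>u\<in>fock_space d. app T u \<in> fock_space (d + k))"

lemma fock_space_add:
  assumes "u \<in> fock_space d" "v \<in> fock_space d"
  shows "(\<lambda>\<phi>. u \<phi> + v \<phi>) \<in> fock_space d"
proof -
  have "{\<phi>. u \<phi> + v \<phi> \<noteq> 0} \<subseteq> {\<phi>. u \<phi> \<noteq> 0} \<union> {\<phi>. v \<phi> \<noteq> 0}" by auto
  moreover have "finite ({\<phi>. u \<phi> \<noteq> 0} \<union> {\<phi>. v \<phi> \<noteq> 0})" using assms by (simp add: fock_space_def)
  ultimately have "finite {\<phi>. u \<phi> + v \<phi> \<noteq> 0}" by (rule finite_subset)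
  moreover have "\<phi> \<in> fock_states \<and> fock_degree \<phi> = d" if "u \<phi> + v \<phi> \<noteq> 0" for \<phi>
    using assms that by (cases "u \<phi> = 0") (auto simp: fock_space_def)
  ultimately show ?thesis by (simp add: fock_space_def)
qed

lemma fock_space_times:
  assumes "u \<in> fock_space d" shows "(\<lambda>\<phi>. c \<phi> * u \<phi>) \<in> fock_space d"
proof -
  have "{\<phi>. c \<phi> * u \<phi> \<noteq> 0} \<subseteq> {\<phi>. u \<phi> \<noteq> 0}" by auto
  then show ?thesis using assms by (auto simp: fock_space_def intro: finite_subset)
qed

lemma fock_space_zero: "(\<lambda>\<phi>. 0) \<in> fock_space d" by (simp add: fock_space_def)

lemma fock_space_sum: "(\<And>i. i \<in> I \<Longrightarrow> u i \<in> fock_space d) \<Longrightarrow> (\<lambda>\<phi>. \<Sum>i\<in>I. u i \<phi>) \<in> fock_space d"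
  by (induction I rule: infinite_finite_induct) (simp_all add: fock_space_zero fock_space_add)

lemma scaled_ket_in_fock_space_iff:
  assumes "c \<noteq> 0" shows "c \<odot> ket \<phi> \<in> fock_space d \<longleftrightarrow> \<phi> \<in> fock_states \<and> fock_degree \<phi> = d"
  using assms by (auto simp: fock_space_def ket_def)

lemma ket_in_fock_space_iff: "ket \<phi> \<in> fock_space d \<longleftrightarrow> \<phi> \<in> fock_states \<and> fock_degree \<phi> = d"
  using scaled_ket_in_fock_space_iff[of 1] by simp

lemma fock_space_negative:
  assumes "u \<in> fock_space d" "d < 0" shows "u = (\<lambda>_. 0)"
proof
  fix \<phi>
  have "0 \<le> fock_degree \<phi>" by (simp add: fock_degree_def del: of_nat_sum)
  then have "fock_degree \<phi> \<noteq> d" using assms(2) by linarith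
  then show "u \<phi> = 0" using assms(1) by (auto simp: fock_space_def)
qed

lemma has_degreeD: "has_degree T k \<Longrightarrow> u \<in> fock_space d \<Longrightarrow> d + k = d' \<Longrightarrow> app T u \<in> fock_space d'"
  by (auto simp: has_degree_def)

lemma has_degree_ketI:
  assumes "\<And>\<beta> F. (\<beta>, F) \<in> fock_states \<Longrightarrow> app T (ket (\<beta>, F)) \<in> fock_space (fock_degree (\<beta>, F) + k)"
  shows "has_degree T k"
  unfolding has_degree_def
proof (intro allI ballI)
  fix d u assume u: "u \<in> fock_space d"
  have "app T u = (\<lambda>\<psi>. \<Sum>\<phi>\<in>{\<phi>. u \<phi> \<noteq> 0}. u \<phi> * app T (ket \<phi>) \<psi>)"
    by (subst ket_expansion[of u]) (use u in \<open>simp_all add: fock_space_def app_sum app_scaled\<close>)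
  moreover have "app T (ket \<phi>) \<in> fock_space (d + k)" if "u \<phi> \<noteq> 0" for \<phi>
    using assms[of "fst \<phi>" "snd \<phi>"] u that by (auto simp: fock_space_def)
  then have "(\<lambda>\<psi>. \<Sum>\<phi>\<in>{\<phi>. u \<phi> \<noteq> 0}. u \<phi> * app T (ket \<phi>) \<psi>) \<in> fock_space (d + k)"
    by (intro fock_space_sum fock_space_times) simp
  ultimately show "app T u \<in> fock_space (d + k)" by simp
qed

lemma has_degree_times: "has_degree S k \<Longrightarrow> has_degree T l \<Longrightarrow> j = k + l \<Longrightarrow> has_degree (S * T) j"
  unfolding has_degree_def[of "S * T"] by (auto intro!: has_degreeD[of S] has_degreeD[of T])

lemma has_degree_times_right: "has_degree S k \<Longrightarrow> has_degree T 0 \<Longrightarrow> has_degree (S * T) k"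
  using has_degree_times[of S k T 0 k] by simp

lemma has_degree_add: "has_degree S k \<Longrightarrow> has_degree T k \<Longrightarrow> has_degree (S + T) k"
proof -
  assume "has_degree S k" "has_degree T k"
  moreover have "app (S + T) u = (\<lambda>\<phi>. app S u \<phi> + app T u \<phi>)" for u by auto
  ultimately show ?thesis by (simp add: has_degree_def fock_space_add)
qed

lemma has_degree_of_int: "has_degree (of_int c) 0"
  by (simp add: has_degree_def fock_space_times)

lemma has_degree_uminus: "has_degree T k \<Longrightarrow> has_degree (- T) k"
  using has_degree_times[OF has_degree_of_int, of T k k "- 1"] by simp

lemma has_degree_one: "has_degree 1 0"
  using has_degree_of_int[of 1] by simp

lemma has_degree_zero: "has_degree 0 k"
proof -
  have "app 0 u = (\<lambda>_. 0)" for u :: "fock \<Rightarrow> 'k" by auto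
  then show ?thesis by (simp add: has_degree_def fock_space_zero)
qed

lemma has_degree_sum: "(\<And>i. i \<in> I \<Longrightarrow> has_degree (T i) k) \<Longrightarrow> has_degree (\<Sum>i\<in>I. T i) k"
  by (induction I rule: infinite_finite_induct) (simp_all add: has_degree_zero has_degree_add)

lemma fock_degree_boson_upd:
  assumes "p < m + n"
  shows "fock_degree (\<beta>(p := x), F) = fock_degree (\<beta>, F) + (if p < m then 0 else int x - int (\<beta> p))"
proof (cases "p < m")
  case False
  then show ?thesis using sum_fun_upd_in[of "{m..<m+n}" p \<beta> x] assms
    by (simp add: fock_degree_def del: fun_upd_apply of_nat_sum)
qed (simp add: fock_degree_def sum_fun_upd_notin del: fun_upd_apply)

lemma fock_degree_fermion_insert:
  "p \<notin> F \<Longrightarrow> fock_degree (\<beta>, insert p F) = fock_degree (\<beta>, F) + (if p < m then 1 else 0)"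
  by (simp add: fock_degree_def)

lemma fock_degree_fermion_remove:
  assumes "p \<in> F" shows "fock_degree (\<beta>, F - {p}) = fock_degree (\<beta>, F) - (if p < m then 1 else 0)"
  using fock_degree_fermion_insert[of p "F - {p}" \<beta>] assms by (simp add: insert_absorb)

lemma has_degree_boson_ann: "p < m + n \<Longrightarrow> has_degree (boson_ann p) (if p < m then 0 else - 1)"
proof (rule has_degree_ketI)
  fix \<beta> F assume state: "p < m + n" "(\<beta>, F) \<in> fock_states"
  show "app (boson_ann p) (ket (\<beta>, F))
      \<in> fock_space (fock_degree (\<beta>, F) + (if p < m then 0 else - 1))"
  proof (cases "of_nat (\<beta> p) = (0 :: 'k)")
    case False
    then have "\<beta> p \<noteq> 0" by (metis of_nat_0)
    then show ?thesis
      using False state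
      by (auto simp: boson_ann_ket scaled_ket_in_fock_space_iff fock_degree_boson_upd
          fock_states_def)
  qed (simp add: boson_ann_ket fock_space_zero)
qed

lemma has_degree_boson_cre: "p < m + n \<Longrightarrow> has_degree (boson_cre p) (if p < m then 0 else 1)"
  by (rule has_degree_ketI)
    (auto simp: boson_cre_ket ket_in_fock_space_iff fock_degree_boson_upd fock_states_def)

lemma has_degree_fermion_ann: "p < m + n \<Longrightarrow> has_degree (fermion_ann p) (if p < m then - 1 else 0)"
  by (rule has_degree_ketI)
    (auto simp: fermion_ann_ket fock_space_zero scaled_ket_in_fock_space_iff
        fock_degree_fermion_remove fock_states_def sign_below_def)

lemma has_degree_fermion_cre: "p < m + n \<Longrightarrow> has_degree (fermion_cre p) (if p < m then 1 else 0)"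
  by (rule has_degree_ketI)
    (auto simp: fermion_cre_ket fock_space_zero scaled_ket_in_fock_space_iff
        fock_degree_fermion_insert fock_states_def sign_below_def)

lemma has_degree_parity:
  "has_degree even_form_parity 0" "has_degree y_parity 0" "has_degree odd_form_parity 0"
  unfolding even_form_parity_def y_parity_def odd_form_parity_def
  by (rule has_degree_ketI, simp add: fermion_parity_ket boson_parity_ket
      scaled_ket_in_fock_space_iff)+

lemma has_degree_y_mult: "s < n \<Longrightarrow> has_degree (y_mult s) 0"
  using has_degree_fermion_cre[of "m + s"]
  by (auto simp: y_mult_def intro: has_degree_times_right has_degree_parity)

lemma has_degree_super_partial: "p < m + n \<Longrightarrow> has_degree (super_partial p) 0"
  using has_degree_boson_ann[of p] has_degree_fermion_ann[of p]
  by (auto simp: super_partial_def y_deriv_def intro: has_degree_times_right has_degree_parity)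

lemma has_degree_partial: "p < m + n \<Longrightarrow> has_degree (partial p) 0"
  using has_degree_super_partial[of p]
  by (auto simp: partial_def super_partial_def intro: has_degree_times_right has_degree_parity)

lemma has_degree_contract: "p < m + n \<Longrightarrow> has_degree (contract p) (- 1)"
  using has_degree_boson_ann[of p] has_degree_fermion_ann[of p]
  by (auto simp: contract_def intro: has_degree_times_right has_degree_parity)

lemma has_degree_wedge: "p < m + n \<Longrightarrow> has_degree (wedge p) 1"
  using has_degree_boson_cre[of p] has_degree_fermion_cre[of p]
  by (auto simp: wedge_def intro: has_degree_times_right has_degree_parity)

lemma has_degree_differential: "has_degree differential (- 1)"
  unfolding differential_def
  by (auto intro!: has_degree_sum intro: has_degree_times has_degree_partial has_degree_contract)

lemma has_degree_rmult:
  assumes "valid_rmon m n f" shows "has_degree (rmult f) 0"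
proof -
  have "has_degree (boson_shift (fst f)) 0"
    using assms by (intro has_degree_ketI)
      (auto simp: boson_shift_ket ket_in_fock_space_iff fock_states_def fock_degree_def
          valid_rmon_def)
  moreover have "\<forall>s\<in>set S. s < n \<Longrightarrow> has_degree (y_word S) 0" for S
    by (induction S) (auto intro: has_degree_one has_degree_times_right has_degree_y_mult)
  ultimately show ?thesis
    using assms unfolding rmult_def by (intro has_degree_times_right) (simp_all add: valid_rmon_def)
qed

lemma has_degree_relative_parity: "has_degree (relative_parity p i) 0"
  and has_degree_form_twist: "has_degree (form_twist i) 0"
  and has_degree_total_parity: "has_degree (total_parity i) 0"
  by (auto simp: relative_parity_def form_twist_def total_parity_def
      intro: has_degree_one has_degree_parity has_degree_times_right)

lemma has_degree_field_wedge: "valid_rmon m n f \<Longrightarrow> i < m + n \<Longrightarrow> has_degree (field_wedge f i) 1"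
  unfolding field_wedge_def
  by (rule has_degree_times[OF has_degree_rmult
        has_degree_times_right[OF has_degree_wedge has_degree_form_twist]]) simp_all

lemma has_degree_homotopy: "has_degree homotopy 1"
proof -
  have "has_degree (if p < m then 1 else - 1) 0" for p
    by (simp add: has_degree_one has_degree_uminus)
  then show ?thesis
    unfolding homotopy_def
    by (intro has_degree_sum has_degree_times[of _ 0 _ 1]
        has_degree_times_right[OF has_degree_field_wedge]
        valid_rmon_coordinate has_degree_total_parity) simp_all
qed

lemma has_degree_form_rep: "k < m + n \<Longrightarrow> l < m + n \<Longrightarrow> has_degree (form_rep k l) 0"
  unfolding form_rep_def
  by (intro has_degree_add has_degree_times[OF has_degree_of_int]
      has_degree_times[OF has_degree_wedge has_degree_contract])
    (auto simp: has_degree_one has_degree_zero intro: has_degree_uminus)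

lemma valid_rmon_rderiv: "valid_rmon m n f \<Longrightarrow> valid_rmon m n (snd (rderiv p f))"
  by (auto simp: valid_rmon_def rderiv_def rdx_def rdy_def strict_sorted_iff sorted_remove1
      dest: notin_set_remove1)

lemma has_degree_witt_op:
  assumes "valid_rmon m n f" "i < m + n" shows "has_degree (witt_op f i) 0"
  unfolding witt_op_def using assms
  by (intro has_degree_add has_degree_sum has_degree_times_right has_degree_of_int has_degree_rmult
      has_degree_super_partial has_degree_relative_parity has_degree_form_rep valid_rmon_rderiv)
    simp_all

end

section \<open>The cohomology of the Fock space\<close>

locale witt_char_0 = witt scalar_type m n for scalar_type :: "'k::field_char_0 itself" and m n
begin

lemma differential_square: "differential * differential = 0"
  unfolding differential_def
  by (rule linop_add_self_eq_0[OF square_sum_anticommuting],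
      rule differential_summands_anticommute) simp_all

lemma app_differential_square: "app differential (app differential u) = (\<lambda>_. 0)"
  using differential_square by (intro ext) (metis app_ring_simps(1,6))

lemma differential_witt_op:
  assumes "valid_rmon m n f" "i < m + n"
  shows "differential * witt_op f i = witt_op f i * differential"
proof -
  let ?L = "differential * field_wedge f i + field_wedge f i * differential"
  have "differential * (differential * z) = 0" for z
    by (simp add: differential_square flip: mult.assoc)
  then have commute: "differential * ?L = ?L * differential"
    by (simp add: distrib_left distrib_right mult.assoc differential_square)
  have "differential * (?L * total_parity i) = differential * ?L * total_parity i"
    by (simp only: mult.assoc)
  also have "\<dots> = ?L * total_parity i * differential"
    by (simp only: commute mult.assoc differential_total_parity)
  finally show ?thesis unfolding witt_op_cartan[OF assms] .
qed

definition top_fock :: fock where "top_fock = (\<lambda>_. 0, {..<m+n})"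

lemma top_fock_state: "top_fock \<in> fock_states"
  by (simp add: top_fock_def fock_states_def)

lemma fock_degree_top: "fock_degree top_fock = int m"
proof -
  have "{..<m + n} \<inter> {..<m} = {..<m}" by auto
  then show ?thesis by (simp add: top_fock_def fock_degree_def)
qed

lemma excess_eq_0_iff:
  assumes "\<phi> \<in> fock_states" shows "excess \<phi> = 0 \<longleftrightarrow> \<phi> = top_fock"
proof
  assume "excess \<phi> = 0"
  then have occupation: "fst \<phi> p = 0 \<and> p \<in> snd \<phi>" if "p < m + n" for p
    using that by (auto simp: excess_def split: if_splits)
  then have "fst \<phi> p = 0" for p using assms by (cases "p < m + n") (auto simp: fock_states_def)
  moreover have "snd \<phi> = {..<m+n}" using occupation assms by (auto simp: fock_states_def)
  ultimately show "\<phi> = top_fock" by (auto simp: top_fock_def prod_eq_iff)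
qed (simp add: excess_def top_fock_def)

lemma differential_at_top: "app differential u top_fock = 0"
proof -
  have "app (partial p * contract p) u top_fock = 0" if "p < m + n" for p
  proof -
    have "\<exists>T. partial p * contract p = fermion_ann p * T"
      by (auto simp: partial_def contract_def y_deriv_def mult.assoc
          boson_fermion_commute(1)[symmetric])
    moreover have "app (fermion_ann p) v top_fock = 0" for v
      using that by (simp add: fermion_ann_def top_fock_def)
    ultimately show ?thesis by (metis app_ring_simps(6))
  qed
  then show ?thesis by (simp add: differential_def del: app_ring_simps(6))
qed

lemma differential_ket_top: "app differential (ket top_fock) = (\<lambda>_. 0)"
proof -
  have "app (partial p) (app (contract p) (ket top_fock)) = (\<lambda>_. 0)" if "p < m + n" for p
    by (cases "p < m")
      (simp_all add: partial_def contract_def top_fock_def even_form_parity_def fermion_parity_ket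
        fermion_ann_ket boson_ann_ket app_scaled app_zero)
  then show ?thesis by (simp add: differential_def fun_eq_iff)
qed

lemma excess_op_differential: "excess_op * differential = differential * excess_op"
proof -
  have "excess_op * differential
      = differential * homotopy * differential + homotopy * (differential * differential)"
    by (simp add: homotopy_formula[symmetric] distrib_right mult.assoc)
  moreover have "differential * excess_op
      = differential * differential * homotopy + differential * homotopy * differential"
    by (simp add: homotopy_formula[symmetric] distrib_left mult.assoc)
  ultimately show ?thesis by (simp add: differential_square)
qed

lemma closed_if_excess_op_closed:
  assumes u: "u \<in> fock_space d" and closed: "app differential (app excess_op u) = (\<lambda>_. 0)"
  shows "app differential u = (\<lambda>_. 0)"
proof
  fix \<phi>
  have "app differential u \<in> fock_space (d - 1)" using has_degree_differential u
    by (rule has_degreeD) simp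
  moreover have "app excess_op (app differential u) = (\<lambda>_. 0)"
    using closed excess_op_differential by (metis app_ring_simps(6))
  then have "excess \<phi> = 0 \<or> app differential u \<phi> = 0"
    using app_excess_op[of "app differential u" \<phi>] by simp
  ultimately show "app differential u \<phi> = 0"
    using excess_eq_0_iff[of \<phi>] differential_at_top by (auto simp: fock_space_def)
qed

theorem poincare_lemma:
  assumes u: "u \<in> fock_space d" and closed: "app differential u = (\<lambda>_. 0)"
  obtains z where "z \<in> fock_space (d + 1)"
      "u = (\<lambda>\<phi>. app differential z \<phi> + u top_fock * ket top_fock \<phi>)"
proof
  define w where "w = (\<lambda>\<phi>. inverse (of_nat (excess \<phi>)) * u \<phi>)"
  have w: "w \<in> fock_space d" unfolding w_def by (rule fock_space_times[OF u])
  have excess_w: "app excess_op w = (\<lambda>\<phi>. u \<phi> + - u top_fock * ket top_fock \<phi>)"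
  proof
    fix \<phi>
    show "app excess_op w \<phi> = u \<phi> + - u top_fock * ket top_fock \<phi>"
      using excess_eq_0_iff[of \<phi>] top_fock_state u
      by (cases "\<phi> \<in> fock_states") (auto simp: app_excess_op w_def ket_def fock_space_def)
  qed
  have "app differential (app excess_op w) = (\<lambda>_. 0)"
    unfolding excess_w app_add app_scaled closed differential_ket_top by simp
  then have "app differential w = (\<lambda>_. 0)" by (rule closed_if_excess_op_closed[OF w])
  then have boundary: "app excess_op w = app differential (app homotopy w)"
    by (intro ext) (simp add: app_zero flip: homotopy_formula)
  show "u = (\<lambda>\<phi>. app differential (app homotopy w) \<phi> + u top_fock * ket top_fock \<phi>)"
    unfolding boundary[symmetric] excess_w by simp
  show "app homotopy w \<in> fock_space (d + 1)" using has_degree_homotopy w by (rule has_degreeD) simp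
qed

end

section \<open>Signs of words\<close>

lemma finite_inv_pairs: "finite (inv_pairs w)"
  by (rule finite_subset[of _ "{..<length w} \<times> {..<length w}"]) (auto simp: inv_pairs_def)

lemma inv_pairs_Nil: "inv_pairs [] = {}"
  by (simp add: inv_pairs_def)

lemma inv_pairs_Cons:
  "inv_pairs (p # w) =
     (\<lambda>s. (0, Suc s)) ` {s. s < length w \<and> w ! s < p} \<union> map_prod Suc Suc ` inv_pairs w"
  (is "_ = ?front \<union> ?rest")
proof (intro set_eqI iffI)
  fix x assume "x \<in> inv_pairs (p # w)"
  then obtain r s where x: "x = (r, s)" "r < s" "s < Suc (length w)" "(p # w) ! s < (p # w) ! r"
    by (auto simp: inv_pairs_def)
  then obtain s' where s: "s = Suc s'" using not0_implies_Suc by (metis less_nat_zero_code)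
  show "x \<in> ?front \<union> ?rest"
  proof (cases r)
    case (Suc r')
    then have "(r', s') \<in> inv_pairs w" using x s by (auto simp: inv_pairs_def)
    then show ?thesis using x s Suc by force
  qed (use x s in auto)
qed (auto simp: inv_pairs_def)

lemma inv_pairs_sorted: "sorted w \<Longrightarrow> inv_pairs w = {}"
  by (auto simp: inv_pairs_def sorted_iff_nth_mono_less) (meson dual_order.strict_trans leD)

text \<open>The sign of moving \<open>e\<^sup>*\<^sub>p\<close> from the front of \<open>e\<^sup>*\<^sub>p w\<close> to its place in the sorted word.\<close>
definition front_sign :: "nat \<Rightarrow> nat \<Rightarrow> nat list \<Rightarrow> int" where
  "front_sign m p w = (if p < m \<and> p \<in> set w then 0
     else (-1) ^ length (filter (\<lambda>b. b < (if p < m then p else m)) w))"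

lemma osign_Cons: "osign m (p # w) = front_sign m p w * osign m w"
proof (cases "distinct (filter (\<lambda>p. p < m) (p # w))")
  case False
  then show ?thesis by (auto simp: osign_def front_sign_def split: if_splits)
next
  case True
  let ?sign = "\<lambda>w (r, s). if m \<le> w ! r \<and> m \<le> w ! s then 1 else -1 :: int"
  let ?front = "{s. s < length w \<and> w ! s < p}" and ?bound = "if p < m then p else m"
  have "prod (?sign (p # w)) (inv_pairs (p # w))
      = prod (?sign (p # w)) ((\<lambda>s. (0, Suc s)) ` ?front)
        * prod (?sign (p # w)) (map_prod Suc Suc ` inv_pairs w)"
    unfolding inv_pairs_Cons by (intro prod.union_disjoint) (auto simp: finite_inv_pairs)
  also have "prod (?sign (p # w)) (map_prod Suc Suc ` inv_pairs w) = prod (?sign w) (inv_pairs w)"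
    by (subst prod.reindex) (auto simp: inj_on_def intro!: prod.cong)
  also have "prod (?sign (p # w)) ((\<lambda>s. (0, Suc s)) ` ?front)
      = (\<Prod>s\<in>?front. if m \<le> p \<and> m \<le> w ! s then 1 else -1)"
    by (subst prod.reindex) (auto simp: inj_on_def intro!: prod.cong)
  also have "\<dots> = (-1) ^ card {s. s < length w \<and> w ! s < ?bound}"
  proof -
    have "{s \<in> ?front. \<not> (m \<le> p \<and> m \<le> w ! s)} = {s. s < length w \<and> w ! s < ?bound}" by auto
    then show ?thesis by (subst prod.If_cases) (auto simp: Int_def)
  qed
  also have "card {s. s < length w \<and> w ! s < ?bound} = length (filter (\<lambda>b. b < ?bound) w)"
    by (simp add: length_filter_conv_card)
  finally show ?thesis using True by (auto simp: osign_def front_sign_def split: if_splits)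
qed

lemma osign_sorted: "sorted w \<Longrightarrow> distinct (filter (\<lambda>p. p < m) w) \<Longrightarrow> osign m w = 1"
  by (simp add: osign_def inv_pairs_sorted)

lemma ysign_eq_osign:
  assumes "\<forall>s\<in>set S. s < m" shows "ysign S = osign m S"
proof -
  have "filter (\<lambda>p. p < m) S = S" using assms by simp
  moreover have "(\<Prod>(r, s)\<in>inv_pairs S. if m \<le> S ! r \<and> m \<le> S ! s then 1 else - 1)
      = (\<Prod>_\<in>inv_pairs S. -1 :: int)"
    using assms by (intro prod.cong) (auto simp: inv_pairs_def not_le[symmetric])
  ultimately show ?thesis by (simp add: ysign_def osign_def)
qed

lemma ysign_Cons:
  "ysign (s # S) = (if s \<in> set S then 0 else (-1) ^ length (filter (\<lambda>b. b < s) S)) * ysign S"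
proof -
  obtain N where "\<forall>t\<in>set (s # S). t < N" by (metis List.finite_set finite_nat_set_iff_bounded)
  then show ?thesis using ysign_eq_osign[of "s # S" N] ysign_eq_osign[of S N]
    by (auto simp: osign_Cons front_sign_def)
qed

lemma ysign_sorted: "sorted_wrt (<) S \<Longrightarrow> ysign S = 1"
  by (simp add: ysign_def inv_pairs_sorted strict_sorted_iff)

section \<open>Words and letter counts\<close>

lemma count_list_sort: "count_list (sort w) p = count_list w p"
  by (metis count_mset mset_sort)

lemma count_list_replicate: "count_list (replicate k p) r = (if r = p then k else 0)"
  by (induction k) auto

lemma count_list_eq_length: "count_list w p = length w \<Longrightarrow> w = replicate (length w) p"
proof (induction w)
  case (Cons a w)
  then show ?case using count_le_length[of w p] by (auto split: if_splits)
qed simp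

lemma distinct_filter_iff_count_list: "distinct (filter P w) \<longleftrightarrow> (\<forall>p. P p \<longrightarrow> count_list w p \<le> 1)"
proof (induction w)
  case (Cons a w)
  have "count_list (a # w) p \<le> 1 \<longleftrightarrow> (p = a \<longrightarrow> a \<notin> set w) \<and> count_list w p \<le> 1" for p
    using count_list_0_iff[of w a] by (cases "p = a") auto
  then show ?case using Cons by (simp del: count_list.simps) blast
qed simp

lemma sorted_eqI_count_list:
  assumes "sorted v" "sorted w" "\<And>p. count_list v p = count_list w p"
  shows "v = w"
proof -
  have "mset v = mset w" using assms(3) by (intro multiset_eqI) (simp add: count_mset)
  then show ?thesis using assms(1,2) by (metis properties_for_sort)
qed

lemma ex_sorted_count_list:
  assumes "\<And>p. N \<le> p \<Longrightarrow> c p = 0"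
  shows "\<exists>w :: nat list. sorted w \<and> (\<forall>p. count_list w p = c p)"
  using assms
proof (induction N arbitrary: c)
  case 0
  then show ?case by (intro exI[of _ "[]"]) simp
next
  case (Suc N)
  have "(c(N := 0)) p = 0" if "N \<le> p" for p using Suc.prems[of p] that by (cases "p = N") auto
  from Suc.IH[of "c(N := 0)", OF this] obtain w
    where w: "sorted w" "\<And>p. count_list w p = (c(N := 0)) p" by blast
  have "p < N" if "p \<in> set w" for p
  proof -
    have "c p \<noteq> 0" "p \<noteq> N" using that w(2)[of p] count_list_0_iff[of w p] by (auto split: if_splits)
    then show ?thesis using Suc.prems[of p] by (metis Suc_leI linorder_neqE_nat)
  qed
  then have "sorted (w @ replicate (c N) N)" using w(1) by (auto simp: sorted_append less_imp_le)
  then show ?case using w(2)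
    by (intro exI[of _ "w @ replicate (c N) N"]) (simp add: count_list_replicate)
qed

section \<open>Monomials as Fock states\<close>

lemma valid_rmon_rmul:
  "valid_rmon m n f \<Longrightarrow> valid_rmon m n g \<Longrightarrow> fst (rmul f g) \<noteq> 0 \<Longrightarrow> valid_rmon m n (snd (rmul f g))"
  by (auto simp: valid_rmon_def rmul_def ysign_def strict_sorted_iff split: if_splits)

lemma rmul_one: "valid_rmon m n f \<Longrightarrow> rmul f (\<lambda>_. 0, []) = (1, f)"
  by (simp add: rmul_def ysign_sorted valid_rmon_def strict_sorted_iff sorted_sort_id)

lemma xi_nonzero_valid:
  assumes w: "valid_omon m n (length w) w" and "l < m + n" and nz: "xi m k l w u \<noteq> (0 :: 'a::field)"
  shows "valid_omon m n (length w) u"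
proof (cases "u = w")
  case False
  with nz obtain r where "r \<in> {..<length w}" and "(if w ! r = k then
        of_int ((-1) ^ ((ipar m k + ipar m l) * length (filter (\<lambda>p. m \<le> p) (take r w)))
          * (- ((-1) ^ ((ipar m k + ipar m l) * ipar m k))) * osign m (w[r := l]))
        * (if u = sort (w[r := l]) then 1 else 0) else 0 :: 'a) \<noteq> 0"
    unfolding xi_def by (auto elim!: sum.not_neutral_contains_not_neutral)
  then have r: "r < length w" "osign m (w[r := l]) \<noteq> 0" "u = sort (w[r := l])"
    by (auto split: if_splits)
  then have "distinct (filter (\<lambda>p. p < m) u)" by (auto simp: osign_def filter_sort split: if_splits)
  then show ?thesis
    using w assms(2) r set_update_subset_insert[of w r l] by (auto simp: valid_omon_def)
qed (use w in simp)

context witt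
begin

definition valid_vbas :: "vbas \<Rightarrow> bool" where
  "valid_vbas b \<longleftrightarrow> valid_rmon m n (fst b) \<and> valid_omon m n (length (snd b)) (snd b)"

definition bosons :: "vbas \<Rightarrow> nat \<Rightarrow> nat" where
  "bosons b = (\<lambda>p. if p < m then fst (fst b) p else count_list (snd b) p)"

definition fermions :: "vbas \<Rightarrow> nat set" where
  "fermions b = {p \<in> set (snd b). p < m} \<union> (+) m ` set (snd (fst b))"

definition fock_of :: "vbas \<Rightarrow> fock" where "fock_of b = (bosons b, fermions b)"

abbreviation vket :: "vbas \<Rightarrow> fock \<Rightarrow> 'k" where "vket b \<equiv> ket (fock_of b)"

lemma fermions_simps:
  "p < m \<Longrightarrow> p \<in> fermions (g, w) \<longleftrightarrow> p \<in> set w" "m + s \<in> fermions (g, w) \<longleftrightarrow> s \<in> set (snd g)"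
  "fermions (g, w) \<inter> {..<m} = {p \<in> set w. p < m}"
  by (auto simp: fermions_def)

lemma fock_of_sort: "fock_of ((a, sort S), w) = fock_of ((a, S), w)"
    "fock_of (g, sort w) = fock_of (g, w)"
  by (simp_all add: fock_of_def bosons_def fermions_def count_list_sort cong: if_cong)

lemma fock_of_Cons:
  "p < m \<Longrightarrow> fock_of (g, p # w) = (bosons (g, w), insert p (fermions (g, w)))"
  "\<not> p < m \<Longrightarrow> fock_of (g, p # w) = ((bosons (g, w))(p := Suc (bosons (g, w) p)), fermions (g, w))"
  "fock_of ((a, s # S), w) = (bosons ((a, S), w), insert (m + s) (fermions ((a, S), w)))"
  by (auto simp: fock_of_def bosons_def fermions_def)

lemma count_list_fock_of:
  assumes "valid_vbas b"
  shows "count_list (snd b) p = (if p < m then if p \<in> fermions b then 1 else 0 else bosons b p)"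
proof (cases "p < m")
  case True
  have "count_list (snd b) p \<le> 1"
    using assms True by (simp add: valid_vbas_def valid_omon_def distinct_filter_iff_count_list)
  moreover have "p \<in> fermions b \<longleftrightarrow> count_list (snd b) p \<noteq> 0"
    using True fermions_simps(1)[of p "fst b" "snd b"] by (simp add: count_list_0_iff)
  ultimately show ?thesis using True by auto
qed (simp add: bosons_def)

lemma fock_of_inj: "inj_on fock_of {b. valid_vbas b}"
proof (rule inj_onI; simp)
  fix b b' assume b: "valid_vbas b" and b': "valid_vbas b'" and "fock_of b = fock_of b'"
  then have bosons: "bosons b = bosons b'" and fermions: "fermions b = fermions b'"
    by (simp_all add: fock_of_def)
  have "fst (fst b) p = fst (fst b') p" for p
    using fun_cong[OF bosons, of p] b b'
    by (auto simp: bosons_def valid_vbas_def valid_rmon_def split: if_splits)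
  then have "fst (fst b) = fst (fst b')" by auto
  moreover have "snd (fst b) = snd (fst b')"
    using b b' fermions fermions_simps(2)[of _ "fst b" "snd b"]
      fermions_simps(2)[of _ "fst b'" "snd b'"]
    by (intro sorted_distinct_set_unique)
      (auto simp: valid_vbas_def valid_rmon_def strict_sorted_iff)
  moreover have "sorted (snd b)" "sorted (snd b')"
    using b b' by (simp_all add: valid_vbas_def valid_omon_def)
  then have "snd b = snd b'"
    by (rule sorted_eqI_count_list) (simp add: count_list_fock_of b b' bosons fermions)
  ultimately show "b = b'" by (simp add: prod_eq_iff)
qed

lemma fock_of_state: "valid_vbas b \<Longrightarrow> fock_of b \<in> fock_states"
  by (auto simp: fock_states_def fock_of_def bosons_def fermions_def valid_vbas_def valid_rmon_def
      valid_omon_def count_list_0_iff)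

lemma ex_fock_of:
  assumes "\<phi> \<in> fock_states" obtains b where "valid_vbas b" "fock_of b = \<phi>"
proof -
  obtain \<beta> F where \<phi>: "\<phi> = (\<beta>, F)" by fastforce
  have \<beta>: "\<And>p. m + n \<le> p \<Longrightarrow> \<beta> p = 0" and F: "F \<subseteq> {..<m+n}" using assms
    by (auto simp: fock_states_def \<phi>)
  define S where "S = sorted_list_of_set {s. m + s \<in> F}"
  have "{s. m + s \<in> F} \<subseteq> {..<n}" using F by auto
  then have S: "set S = {s. m + s \<in> F}" "sorted_wrt (<) S" by (simp_all add: S_def finite_subset)
  define a where "a = (\<lambda>p. if p < m then \<beta> p else 0)"
  obtain w where w: "sorted w"
      "\<And>p. count_list w p = (if p < m then if p \<in> F then 1 else 0 else \<beta> p)"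
    using ex_sorted_count_list[of "m + n" "\<lambda>p. if p < m then if p \<in> F then 1 else 0 else \<beta> p"] \<beta>
    by auto
  have set_w: "p \<in> set w \<longleftrightarrow> (if p < m then p \<in> F else \<beta> p \<noteq> 0)" for p
    using w(2)[of p] count_list_0_iff[of w p] by (auto split: if_splits)
  have "valid_vbas ((a, S), w)"
    using S F \<beta> w set_w
    by (auto simp: valid_vbas_def valid_rmon_def valid_omon_def distinct_filter_iff_count_list
        a_def not_less[symmetric])
  moreover have "bosons ((a, S), w) = \<beta>" using w(2) by (auto simp: bosons_def a_def)
  moreover have "p \<in> fermions ((a, S), w) \<longleftrightarrow> p \<in> F" for p
    using fermions_simps(1)[of p] fermions_simps(2)[of "p - m"] set_w S(1) by (cases "p < m") force+
  then have "fermions ((a, S), w) = F" by blast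
  ultimately show ?thesis using that[of "((a, S), w)"] by (simp add: fock_of_def \<phi>)
qed

lemma fock_degree_fock_of:
  assumes "valid_vbas b" shows "fock_degree (fock_of b) = int (length (snd b))"
proof -
  have "set (snd b) \<subseteq> {..<m+n}" using assms by (auto simp: valid_vbas_def valid_omon_def)
  then have "length (snd b) = (\<Sum>p<m+n. count_list (snd b) p)"
    using sum_count_set[of "snd b" "{..<m+n}"] by simp
  also have "\<dots> = (\<Sum>p<m. count_list (snd b) p) + (\<Sum>p\<in>{m..<m+n}. count_list (snd b) p)"
    by (metis atLeast0LessThan le_add1 sum.atLeastLessThan_concat zero_le)
  also have "(\<Sum>p<m. count_list (snd b) p) = (\<Sum>p<m. if p \<in> fermions b then 1 else 0)"
    using assms by (intro sum.cong) (simp_all add: count_list_fock_of)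
  also have "\<dots> = card (fermions b \<inter> {..<m})"
    by (simp add: sum.If_cases Int_commute Int_def)
  also have "(\<Sum>p\<in>{m..<m+n}. count_list (snd b) p) = sum (bosons b) {m..<m+n}"
    by (intro sum.cong) (simp_all add: bosons_def)
  finally show ?thesis by (simp add: fock_degree_def fock_of_def)
qed

section \<open>The operators on monomials\<close>

lemma wedge_vket:
  assumes "distinct (filter (\<lambda>p. p < m) w)"
  shows "app (wedge p) (vket (g, w)) = of_int (front_sign m p w) \<odot> vket (g, p # w)"
proof (cases "p < m")
  case True
  have "fermions (g, w) \<inter> {..<p} = set (filter (\<lambda>b. b < p) w)" using True
    by (auto simp: fermions_def)
  moreover have "filter (\<lambda>b. b < p) w = filter (\<lambda>b. b < p) (filter (\<lambda>b. b < m) w)"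
    using True by (auto intro: filter_cong)
  then have "distinct (filter (\<lambda>b. b < p) w)" by (metis assms distinct_filter)
  ultimately have "sign_below p (fermions (g, w)) = (-1) ^ length (filter (\<lambda>b. b < p) w)"
    using distinct_card[of "filter (\<lambda>b. b < p) w"] by (simp add: sign_below_def)
  then show ?thesis
    using True by (simp add: wedge_def fock_of_Cons front_sign_def)
      (simp add: fock_of_def fermion_cre_ket fermions_simps)
next
  case False
  have "card (fermions (g, w) \<inter> {..<m}) = length (filter (\<lambda>b. b < m) w)"
    using distinct_card[OF assms] by (simp add: fermions_simps)
  then show ?thesis
    using False by (simp add: wedge_def fock_of_Cons front_sign_def)
      (simp add: fock_of_def even_form_parity_def fermion_parity_ket boson_cre_ket app_scaled)
qed

definition form_word :: "nat list \<Rightarrow> (fock, 'k) linop" where "form_word w = prod_list (map wedge w)"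

lemma form_word_simps [simp]: "form_word [] = 1" "form_word (p # w) = wedge p * form_word w"
  by (simp_all add: form_word_def)

lemma form_word_vket: "app (form_word w) (vket (g, [])) = of_int (osign m w) \<odot> vket (g, w)"
proof (induction w)
  case (Cons p w)
  have "\<not> distinct (filter (\<lambda>p. p < m) w) \<Longrightarrow> osign m w = 0" by (simp add: osign_def)
  with Cons show ?case
    by (cases "distinct (filter (\<lambda>p. p < m) w)")
      (simp_all add: app_scaled wedge_vket osign_Cons mult.commute mult.left_commute app_zero)
qed (simp add: osign_def inv_pairs_Nil)

lemma y_mult_vket:
  assumes "distinct S"
  shows "app (y_mult s) (vket ((a, S), w))
    = of_int (if s \<in> set S then 0 else (-1) ^ length (filter (\<lambda>b. b < s) S)) \<odot> vket ((a, s # S), w)"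
proof -
  let ?F = "fermions ((a, S), w)"
  have "?F \<inter> {..<m+s} = (?F \<inter> {..<m}) \<union> (+) m ` set (filter (\<lambda>b. b < s) S)"
    by (auto simp: fermions_def)
  then have "card (?F \<inter> {..<m+s}) = card (?F \<inter> {..<m}) + card ((+) m ` set (filter (\<lambda>b. b < s) S))"
    by (simp only:) (intro card_Un_disjoint; auto simp: fermions_def)
  also have "card ((+) m ` set (filter (\<lambda>b. b < s) S)) = length (filter (\<lambda>b. b < s) S)"
    using distinct_card[of "filter (\<lambda>b. b < s) S"] assms by (simp add: card_image)
  finally have "(-1) ^ card (?F \<inter> {..<m}) * sign_below (m + s) ?F
      = (-1) ^ length (filter (\<lambda>b. b < s) S)"
    by (simp add: sign_below_def power_add flip: mult.assoc)
  then show ?thesis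
    by (simp add: y_mult_def fock_of_Cons)
      (simp add: fock_of_def even_form_parity_def fermion_parity_ket fermion_cre_ket fermions_simps
          app_scaled
        flip: mult.assoc)
qed

lemma y_word_vket: "app (y_word S) (vket ((a, []), w)) = of_int (ysign S) \<odot> vket ((a, S), w)"
proof (induction S)
  case (Cons s S)
  have "\<not> distinct S \<Longrightarrow> ysign S = 0" by (simp add: ysign_def)
  with Cons show ?case
    by (cases "distinct S")
      (simp_all add: app_scaled y_mult_vket ysign_Cons mult.commute mult.left_commute app_zero)
qed (simp add: ysign_def inv_pairs_Nil)

lemma rmult_vket:
  assumes f: "valid_rmon m n f" and g: "valid_rmon m n g"
  shows "app (rmult f) (vket (g, w)) = of_int (fst (rmul f g)) \<odot> vket (snd (rmul f g), w)"
proof -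
  have "ysign (snd g) = 1" using g by (intro ysign_sorted) (simp add: valid_rmon_def)
  then have "vket (g, w) = app (y_word (snd g)) (vket ((fst g, []), w))" by (simp add: y_word_vket)
  then have "app (rmult f) (vket (g, w))
      = app (boson_shift (fst f)) (app (y_word (snd f @ snd g)) (vket ((fst g, []), w)))"
    by (simp add: rmult_def y_word_append)
  also have "\<dots> = of_int (fst (rmul f g))
      \<odot> app (boson_shift (fst f)) (vket ((fst g, snd f @ snd g), w))"
    by (simp add: y_word_vket app_scaled rmul_def)
  also have "app (boson_shift (fst f)) (vket ((fst g, snd f @ snd g), w))
      = vket (snd (rmul f g), w)"
  proof -
    have "(\<lambda>i. fst f i + bosons ((fst g, S), w) i) = bosons ((\<lambda>i. fst f i + fst g i, S), w)" for S
      using f by (auto simp: bosons_def valid_rmon_def)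
    then show ?thesis
      by (simp add: rmul_def fock_of_sort) (simp add: fock_of_def boson_shift_ket fermions_def)
  qed
  finally show ?thesis .
qed

lemma boson_ann_vket:
  "p < m \<Longrightarrow> app (boson_ann p) (vket (g, w)) = of_int (fst (rdx p g)) \<odot> vket (snd (rdx p g), w)"
proof -
  assume "p < m"
  then have "(bosons (g, w))(p := bosons (g, w) p - 1) = bosons (snd (rdx p g), w)"
      "bosons (g, w) p = fst g p"
    by (auto simp: bosons_def rdx_def)
  then show ?thesis by (simp add: fock_of_def boson_ann_ket) (simp add: rdx_def fermions_def)
qed

lemma y_deriv_vket:
  assumes g: "valid_rmon m n g"
  shows "app (y_deriv j) (vket (g, w)) = of_int (fst (rdy j g)) \<odot> vket (snd (rdy j g), w)"
proof -
  have S: "distinct (snd g)" "sorted_wrt (<) (snd g)" "sorted_wrt (<) (remove1 j (snd g))"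
    using g by (auto simp: valid_rmon_def strict_sorted_iff sorted_remove1)
  have "app (y_deriv j) (vket ((fst g, []), w)) = (\<lambda>_. 0)"
    by (simp add: y_deriv_def fock_of_def even_form_parity_def fermion_parity_ket fermion_ann_ket
        fermions_simps app_scaled)
  then have "app (y_deriv j * y_word (snd g)) (vket ((fst g, []), w))
      = of_int (fst (rdy j g)) \<odot> app (y_word (remove1 j (snd g))) (vket ((fst g, []), w))"
    unfolding y_deriv_y_word[OF S(1), of j "fst g"] by (intro ext) (simp add: app_zero)
  then show ?thesis by (simp add: y_word_vket ysign_sorted S rdy_def)
qed

lemma super_partial_vket:
  assumes "valid_rmon m n g"
  shows "app (super_partial p) (vket (g, w))
      = of_int (fst (rderiv p g)) \<odot> vket (snd (rderiv p g), w)"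
  using assms by (simp add: super_partial_def rderiv_def boson_ann_vket y_deriv_vket)

lemma y_parity_vket:
  assumes "valid_rmon m n g"
  shows "app y_parity (vket (g, w)) = (-1) ^ length (snd g) \<odot> vket (g, w)"
proof -
  have "fermions (g, w) \<inter> {m..<m+n} = (+) m ` set (snd g)" using assms
    by (auto simp: fermions_def valid_rmon_def)
  moreover have "distinct (snd g)" using assms by (auto simp: valid_rmon_def strict_sorted_iff)
  ultimately have "card (fermions (g, w) \<inter> {m..<m+n}) = length (snd g)"
    by (simp add: card_image distinct_card)
  then show ?thesis by (simp add: y_parity_def fock_of_def fermion_parity_ket)
qed

lemma contract_vacuum: "app (contract k) (vket (g, [])) = (\<lambda>_. 0)"
  by (simp add: contract_def fock_of_def even_form_parity_def fermion_parity_ket fermion_ann_ket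
      boson_ann_ket fermions_simps bosons_def app_scaled)

text \<open>\<open>wedge l * contract k\<close> is a superderivation of \<open>\<Omega>(V\<^sup>*)\<close> of the parity of \<open>E\<^sub>k\<^sub>l\<close>.\<close>
lemma wedge_contract_wedge:
  assumes "k < m + n" "l < m + n" "p < m + n"
  shows "wedge l * contract k * wedge p = (if k = p then wedge l else 0)
    + (-1) ^ ((ipar m k + ipar m l) * ipar m p) * (wedge p * (wedge l * contract k))"
proof -
  have "wedge l * contract k * wedge p = wedge l * (contract k * wedge p)"
    by (simp only: mult.assoc)
  also have "\<dots> = (if k = p then wedge l else 0)
      - (-1) ^ (ipar m k * ipar m p) * (wedge l * wedge p * contract k)"
    unfolding contract_wedge[OF assms(1,3)]
    by (simp add: right_diff_distrib neg_one_power_left_commute[of "wedge l"] mult.assoc)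
  also have "\<dots> = (if k = p then wedge l else 0)
      + (-1) ^ ((ipar m k + ipar m l) * ipar m p) * (wedge p * (wedge l * contract k))"
    unfolding wedge_wedge[OF assms(2,3)] by (simp add: ipar_def mult.assoc)
  finally show ?thesis .
qed

lemma wedge_contract_form_word:
  assumes "k < m + n" "l < m + n" "\<forall>p\<in>set w. p < m + n"
  shows "wedge l * contract k * form_word w =
    (\<Sum>r<length w. if w ! r = k then
       (-1) ^ ((ipar m k + ipar m l) * length (filter ((\<le>) m) (take r w)))
         * form_word (w[r := l]) else 0)
    + (-1) ^ ((ipar m k + ipar m l) * length (filter ((\<le>) m) w))
        * (form_word w * (wedge l * contract k))"
  using assms(3)
proof (induction w)
  case (Cons p w)
  let ?e = "ipar m k + ipar m l"
  have "wedge l * contract k * form_word (p # w) = (if k = p then wedge l * form_word w else 0)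
      + (-1) ^ (?e * ipar m p) * (wedge p * (wedge l * contract k * form_word w))"
    using wedge_contract_wedge[OF assms(1,2), of p] Cons.prems
    by (simp add: distrib_right flip: mult.assoc)
  also have "wedge l * contract k * form_word w =
    (\<Sum>r<length w. if w ! r = k then
       (-1) ^ (?e * length (filter ((\<le>) m) (take r w))) * form_word (w[r := l]) else 0)
    + (-1) ^ (?e * length (filter ((\<le>) m) w)) * (form_word w * (wedge l * contract k))"
    using Cons by simp
  finally show ?case
    by (simp add: sum.lessThan_Suc_shift distrib_left sum_distrib_left
        neg_one_power_left_commute[of "wedge p"] power_add
        ipar_def[of m p] if_distrib[of "(*) _"] mult.assoc del: sum.lessThan_Suc cong: if_cong)
qed simp

lemma vket_form_word: "valid_omon m n (length w) w \<Longrightarrow> vket (g, w) = app (form_word w) (vket (g, []))"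
  by (simp add: form_word_vket osign_sorted valid_omon_def)

lemma wedge_contract_vket:
  assumes w: "valid_omon m n (length w) w" and kl: "k < m + n" "l < m + n"
  shows "app (wedge l * contract k) (vket (g, w)) = (\<lambda>\<psi>. \<Sum>r<length w. if w ! r = k then
    of_int ((-1) ^ ((ipar m k + ipar m l) * length (filter ((\<le>) m) (take r w)))
        * osign m (w[r := l]))
      * vket (g, w[r := l]) \<psi> else 0)"
proof
  fix \<psi>
  have "\<forall>p\<in>set w. p < m + n" using w by (simp add: valid_omon_def)
  note wedge_contract = wedge_contract_form_word[OF kl this]
  have "app (wedge l * contract k) (vket (g, w)) \<psi>
      = app (wedge l * contract k * form_word w) (vket (g, [])) \<psi>"
    by (simp add: vket_form_word[OF w])
  also have "\<dots> = (\<Sum>r<length w. if w ! r = k then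
      of_int ((-1) ^ ((ipar m k + ipar m l) * length (filter ((\<le>) m) (take r w)))
          * osign m (w[r := l]))
        * vket (g, w[r := l]) \<psi> else 0)"
    unfolding wedge_contract
    by (auto simp: contract_vacuum app_zero form_word_vket mult.assoc intro!: sum.cong)
  finally show "app (wedge l * contract k) (vket (g, w)) \<psi> = \<dots>" .
qed

definition xi_words :: "nat \<Rightarrow> nat list \<Rightarrow> nat list set" where
  "xi_words l w = insert w ((\<lambda>r. sort (w[r := l])) ` {..<length w})"

lemma finite_xi_words: "finite (xi_words l w)"
  by (simp add: xi_words_def)

lemma xi_outside: "u \<notin> xi_words l w \<Longrightarrow> xi m k l w u = 0"
  by (auto simp: xi_words_def xi_def intro!: sum.neutral)

lemma form_rep_vket:
  assumes w: "valid_omon m n (length w) w" and kl: "k < m + n" "l < m + n"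
  shows "app (form_rep k l) (vket (g, w)) = (\<lambda>\<psi>. \<Sum>u\<in>xi_words l w. xi m k l w u * vket (g, u) \<psi>)"
proof
  fix \<psi>
  let ?c = "\<lambda>r. if w ! r = k
      then of_int ((-1) ^ ((ipar m k + ipar m l) * length (filter ((\<le>) m) (take r w)))
      * (- ((-1) ^ ((ipar m k + ipar m l) * ipar m k))) * osign m (w[r := l])) else (0 :: 'k)"
  let ?d = "if k = l then if k < m then 1 else - 1 else (0 :: 'k)"
  have delta: "(\<Sum>u\<in>xi_words l w. (if u = v then 1 else 0) * vket (g, u) \<psi>) = vket (g, v) \<psi>"
    if "v \<in> xi_words l w" for v
    using that finite_xi_words by (simp add: if_distrib[of "\<lambda>x. x * _"] cong: if_cong)
  have xi: "xi m k l w u = (\<Sum>r<length w. ?c r * (if u = sort (w[r := l]) then 1 else 0))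
      + ?d * (if u = w then 1 else 0)" for u
    by (auto simp: xi_def intro!: arg_cong2[of _ _ _ _ "(+)"] sum.cong)
  have "(\<Sum>u\<in>xi_words l w. xi m k l w u * vket (g, u) \<psi>)
      = (\<Sum>r<length w. ?c r
          * (\<Sum>u\<in>xi_words l w. (if u = sort (w[r := l]) then 1 else 0) * vket (g, u) \<psi>))
        + ?d * (\<Sum>u\<in>xi_words l w. (if u = w then 1 else 0) * vket (g, u) \<psi>)"
    unfolding xi distrib_right sum.distrib sum_distrib_left sum_distrib_right mult.assoc
    by (subst sum.swap) simp
  also have "\<dots> = (\<Sum>r<length w. ?c r * vket (g, w[r := l]) \<psi>) + ?d * vket (g, w) \<psi>"
  proof -
    have "w \<in> xi_words l w" "\<And>r. r < length w \<Longrightarrow> sort (w[r := l]) \<in> xi_words l w"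
      by (auto simp: xi_words_def)
    then show ?thesis
      by (intro arg_cong2[of _ _ _ _ "(+)"] arg_cong2[of _ _ _ _ "(*)"] sum.cong refl)
        (simp_all add: delta fock_of_sort)
  qed
  also have "(\<Sum>r<length w. ?c r * vket (g, w[r := l]) \<psi>)
      = of_int (- ((-1) ^ ((ipar m k + ipar m l) * ipar m k)))
        * app (wedge l * contract k) (vket (g, w)) \<psi>"
    unfolding wedge_contract_vket[OF w kl] sum_distrib_left by (intro sum.cong) auto
  also have "\<dots> + ?d * vket (g, w) \<psi> = app (form_rep k l) (vket (g, w)) \<psi>"
    by (simp add: form_rep_def)
  finally show "app (form_rep k l) (vket (g, w)) \<psi>
      = (\<Sum>u\<in>xi_words l w. xi m k l w u * vket (g, u) \<psi>)" ..
qed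

end

section \<open>The action of the Witt algebra\<close>

lemma sum_if_eq_restrict:
  assumes "finite A" "\<And>x. x \<notin> A \<Longrightarrow> f x = 0"
  shows "(\<Sum>x\<in>A. f x * (if x = a then 1 else 0)) = (f a :: 'r::semiring_1)"
  using assms by (cases "a \<in> A") (simp_all add: if_distrib cong: if_cong)

context witt
begin

definition of_fock :: "(fock \<Rightarrow> 'k) \<Rightarrow> vbas \<Rightarrow> 'k" where
  "of_fock u b = (if valid_vbas b then u (fock_of b) else 0)"

definition to_fock :: "(vbas \<Rightarrow> 'k) \<Rightarrow> fock \<Rightarrow> 'k" where
  "to_fock v \<phi> = (if \<phi> \<in> fock_states then v (inv_into {b. valid_vbas b} fock_of \<phi>) else 0)"

definition fock_act :: "(gbas \<Rightarrow> 'k) \<Rightarrow> (fock \<Rightarrow> 'k) \<Rightarrow> fock \<Rightarrow> 'k" where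
  "fock_act X u = (\<lambda>\<psi>. \<Sum>x\<in>{x. X x \<noteq> 0}. X x * app (witt_op (fst x) (snd x)) u \<psi>)"

lemma of_fock_linear:
  "of_fock (\<lambda>\<phi>. u \<phi> + v \<phi>) = (\<lambda>b. of_fock u b + of_fock v b)" "of_fock (c \<odot> u) = c \<odot> of_fock u"
  "of_fock (\<lambda>\<phi>. \<Sum>i\<in>I. w i \<phi>) = (\<lambda>b. \<Sum>i\<in>I. of_fock (w i) b)" "of_fock (\<lambda>_. 0) = vzero"
  by (auto simp: of_fock_def vzero_def)

lemma to_fock_linear:
  "to_fock (\<lambda>b. u b + v b) = (\<lambda>\<phi>. to_fock u \<phi> + to_fock v \<phi>)" "to_fock (c \<odot> u) = c \<odot> to_fock u"
  "to_fock vzero = (\<lambda>_. 0)"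
  by (auto simp: to_fock_def vzero_def)

lemma fock_of_eq_iff: "valid_vbas b \<Longrightarrow> valid_vbas b' \<Longrightarrow> fock_of b = fock_of b' \<longleftrightarrow> b = b'"
  using fock_of_inj by (auto simp: inj_on_def)

lemma of_fock_vket: "valid_vbas b \<Longrightarrow> of_fock (vket b) = single b"
  by (auto simp: of_fock_def single_def ket_def fock_of_eq_iff)

lemma to_fock_fock_of: "valid_vbas b \<Longrightarrow> to_fock v (fock_of b) = v b"
  using fock_of_inj by (simp add: to_fock_def fock_of_state inv_into_f_f)

lemma Vq_valid: "v \<in> Vq m n q \<Longrightarrow> v b \<noteq> 0 \<Longrightarrow> valid_vbas b \<and> length (snd b) = q"
  by (auto simp: Vq_def valid_vbas_def valid_omon_def)

lemma to_fock_nonzero: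
  assumes "to_fock v \<phi> \<noteq> 0" obtains b where "valid_vbas b" "\<phi> = fock_of b" "v b \<noteq> 0"
proof -
  have "\<phi> \<in> fock_states" using assms by (auto simp: to_fock_def split: if_splits)
  then obtain b where "valid_vbas b" "fock_of b = \<phi>" by (rule ex_fock_of)
  then show ?thesis using assms that to_fock_fock_of by metis
qed

lemma to_fock_in_fock_space:
  assumes v: "v \<in> Vq m n q" shows "to_fock v \<in> fock_space (int q)"
proof -
  have "finite (fock_of ` {b. v b \<noteq> 0})" using v by (simp add: Vq_def)
  moreover have "{\<phi>. to_fock v \<phi> \<noteq> 0} \<subseteq> fock_of ` {b. v b \<noteq> 0}" by (auto elim: to_fock_nonzero)
  ultimately have "finite {\<phi>. to_fock v \<phi> \<noteq> 0}" by (rule rev_finite_subset)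
  moreover have "\<phi> \<in> fock_states \<and> fock_degree \<phi> = int q" if "to_fock v \<phi> \<noteq> 0" for \<phi>
    using that Vq_valid[OF v]
    by (auto elim!: to_fock_nonzero simp: fock_of_state fock_degree_fock_of)
  ultimately show ?thesis by (simp add: fock_space_def)
qed

lemma of_fock_in_Vq:
  assumes "u \<in> fock_space (int q)" shows "of_fock u \<in> Vq m n q"
proof -
  have "fock_of ` {b. of_fock u b \<noteq> 0} \<subseteq> {\<phi>. u \<phi> \<noteq> 0}" by (auto simp: of_fock_def)
  then have "finite (fock_of ` {b. of_fock u b \<noteq> 0})" using assms
    by (auto simp: fock_space_def intro: finite_subset)
  moreover have "inj_on fock_of {b. of_fock u b \<noteq> 0}"
    by (rule inj_on_subset[OF fock_of_inj]) (auto simp: of_fock_def)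
  ultimately have "finite {b. of_fock u b \<noteq> 0}" by (rule finite_imageD)
  moreover have "valid_rmon m n (fst b) \<and> valid_omon m n q (snd b)" if "of_fock u b \<noteq> 0" for b
  proof -
    have b: "valid_vbas b" "u (fock_of b) \<noteq> 0" using that
      by (auto simp: of_fock_def split: if_splits)
    then have "length (snd b) = q" using assms fock_degree_fock_of[OF b(1)]
      by (simp add: fock_space_def)
    then show ?thesis using b by (auto simp: valid_vbas_def)
  qed
  ultimately show ?thesis by (auto simp: Vq_def)
qed

lemma of_fock_to_fock: "v \<in> Vq m n q \<Longrightarrow> of_fock (to_fock v) = v"
proof
  fix b assume "v \<in> Vq m n q"
  then show "of_fock (to_fock v) b = v b" using Vq_valid[of v q b]
    by (auto simp: of_fock_def to_fock_fock_of)
qed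

lemma to_fock_of_fock:
  assumes "u \<in> fock_space d" shows "to_fock (of_fock u) = u"
proof
  fix \<phi>
  show "to_fock (of_fock u) \<phi> = u \<phi>"
  proof (cases "\<phi> \<in> fock_states")
    case True
    then obtain b where "valid_vbas b" "fock_of b = \<phi>" by (rule ex_fock_of)
    then show ?thesis using to_fock_fock_of[of b "of_fock u"] by (simp add: of_fock_def)
  next
    case False
    then show ?thesis using assms by (auto simp: to_fock_def fock_space_def)
  qed
qed

lemma vket_in_fock_space: "valid_vbas b \<Longrightarrow> vket b \<in> fock_space (int (length (snd b)))"
  by (simp add: ket_in_fock_space_iff fock_of_state fock_degree_fock_of)

lemma to_fock_single: "valid_vbas b \<Longrightarrow> to_fock (single b) = vket b"
  using to_fock_of_fock[OF vket_in_fock_space] by (simp add: of_fock_vket)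

lemma to_fock_expansion:
  assumes v: "v \<in> Vq m n q" shows "to_fock v = (\<lambda>\<psi>. \<Sum>b\<in>{b. v b \<noteq> 0}. v b * vket b \<psi>)"
proof -
  have "to_fock (\<lambda>b'. \<Sum>b\<in>I. v b * single b b') = (\<lambda>\<psi>. \<Sum>b\<in>I. v b * to_fock (single b) \<psi>)" for I
    by (auto simp: to_fock_def)
  moreover have "v = (\<lambda>b'. \<Sum>b\<in>{b. v b \<noteq> 0}. v b * single b b')"
    using ket_expansion[of v] v by (simp add: ket_def single_def Vq_def)
  ultimately have "to_fock v = (\<lambda>\<psi>. \<Sum>b\<in>{b. v b \<noteq> 0}. v b * to_fock (single b) \<psi>)" by metis
  also have "\<dots> = (\<lambda>\<psi>. \<Sum>b\<in>{b. v b \<noteq> 0}. v b * vket b \<psi>)"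
    by (intro ext sum.cong refl) (use Vq_valid[OF v] in \<open>simp add: to_fock_single\<close>)
  finally show ?thesis .
qed

lemma of_fock_form_rep:
  assumes w: "valid_omon m n (length w) w" and kl: "k < m + n" "l < m + n" and g: "valid_rmon m n g"
  shows "of_fock (\<lambda>\<psi>. \<Sum>u\<in>xi_words l w. xi m k l w u * vket (g, u) \<psi>) b
    = (if fst b = g then xi m k l w (snd b) else 0)"
proof -
  have summand: "xi m k l w u * of_fock (vket (g, u)) b
      = (if fst b = g then 1 else 0) * (xi m k l w u * (if u = snd b then 1 else 0))" for u
  proof (cases "xi m k l w u = (0 :: 'k)")
    case False
    then have "valid_omon m n (length w) u" using xi_nonzero_valid[OF w kl(2)] by blast
    then have "valid_vbas (g, u)" using g by (simp add: valid_vbas_def valid_omon_def)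
    then show ?thesis by (auto simp: of_fock_vket single_def prod_eq_iff)
  qed simp
  have "of_fock (\<lambda>\<psi>. \<Sum>u\<in>xi_words l w. xi m k l w u * vket (g, u) \<psi>) b
      = (if fst b = g then 1 else 0)
        * (\<Sum>u\<in>xi_words l w. xi m k l w u * (if u = snd b then 1 else 0))"
    by (simp only: of_fock_linear summand flip: sum_distrib_left)
  then show ?thesis
    using sum_if_eq_restrict[OF finite_xi_words, of l w "xi m k l w :: omon \<Rightarrow> 'k" "snd b"]
    by (simp add: xi_outside)
qed

lemma act_basis_rderiv:
  "act_basis m n (f, i) (g, w) b =
    of_int (fst (rderiv i g) * fst (rmul f (snd (rderiv i g))))
      * (if b = (snd (rmul f (snd (rderiv i g))), w) then 1 else 0)
    + (\<Sum>p<m+n. of_int (deriv_sign p f * fst (rderiv p f)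
          * (if p < m \<longleftrightarrow> i < m then 1 else (-1) ^ length (snd g))
          * fst (rmul (snd (rderiv p f)) g))
        * (if fst b = snd (rmul (snd (rderiv p f)) g) then xi m p i w (snd b) else 0))"
  unfolding act_basis_def Let_def sum_lessThan_add
  by (simp add: rderiv_def deriv_sign_def power_add ac_simps cong: if_cong)

lemma witt_op_summand_vket:
  assumes h: "valid_rmon m n h" and pi: "p < m + n" "i < m + n"
    and g: "valid_rmon m n g" and w: "valid_omon m n (length w) w"
  shows "app (rmult h * (relative_parity p i * form_rep p i)) (vket (g, w))
    = of_int ((if p < m \<longleftrightarrow> i < m then 1 else (-1) ^ length (snd g)) * fst (rmul h g))
      \<odot> (\<lambda>\<psi>. \<Sum>u\<in>xi_words i w. xi m p i w u * vket (snd (rmul h g), u) \<psi>)"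
proof -
  have "app (rmult h) (app (relative_parity p i) (vket (g, u)))
      = of_int ((if p < m \<longleftrightarrow> i < m then 1 else (-1) ^ length (snd g)) * fst (rmul h g))
        \<odot> vket (snd (rmul h g), u)" for u
    by (simp add: relative_parity_def y_parity_vket[OF g] rmult_vket[OF h g] app_scaled mult.assoc)
  then show ?thesis
    by (simp add: form_rep_vket[OF w pi] app_sum app_scaled sum_distrib_left mult.left_commute)
qed

lemma of_fock_scaled_vket:
  assumes "c \<noteq> 0 \<Longrightarrow> valid_vbas b'"
  shows "of_fock (c \<odot> vket b') b = c * (if b = b' then 1 else 0)"
proof (cases "c = 0")
  case False
  then show ?thesis using assms by (simp add: of_fock_linear of_fock_vket single_def)
qed (simp add: of_fock_def)

lemma act_basis_eq_witt_op:
  assumes f: "valid_rmon m n f" and i: "i < m + n" and v: "valid_vbas v"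
  shows "act_basis m n (f, i) v b = of_fock (app (witt_op f i) (vket v)) b"
proof -
  obtain g w where v_eq: "v = (g, w)" by fastforce
  have g: "valid_rmon m n g" and w: "valid_omon m n (length w) w" using v
    by (auto simp: v_eq valid_vbas_def)
  let ?D = "rderiv i g" and ?f' = "\<lambda>p. snd (rderiv p f)"
  let ?sign = "\<lambda>p. if p < m \<longleftrightarrow> i < m then 1 else (-1) ^ length (snd g)"
  have "of_fock (app (rmult f * super_partial i) (vket v)) b
      = of_fock (of_int (fst ?D * fst (rmul f (snd ?D))) \<odot> vket (snd (rmul f (snd ?D)), w)) b"
    by (simp add: v_eq super_partial_vket[OF g] rmult_vket[OF f valid_rmon_rderiv[OF g]] app_scaled
        mult.assoc)
  also have "\<dots> = of_int (fst ?D * fst (rmul f (snd ?D)))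
      * (if b = (snd (rmul f (snd ?D)), w) then 1 else 0)"
    using valid_rmon_rmul[OF f valid_rmon_rderiv[OF g]] w
    by (intro of_fock_scaled_vket) (auto simp: valid_vbas_def, metis of_int_0)
  finally have derivative_term: "of_fock (app (rmult f * super_partial i) (vket v)) b = \<dots>" .
  have form_term: "of_fock (app (rmult (?f' p) * (relative_parity p i * form_rep p i)) (vket v)) b
      = of_int (?sign p * fst (rmul (?f' p) g))
        * (if fst b = snd (rmul (?f' p) g) then xi m p i w (snd b) else 0)"
    if p: "p < m + n" for p
  proof (cases "fst (rmul (?f' p) g) = 0")
    case False
    show ?thesis
      unfolding v_eq witt_op_summand_vket[OF valid_rmon_rderiv[OF f] p i g w]
      using of_fock_form_rep[OF w p i valid_rmon_rmul[OF valid_rmon_rderiv[OF f] g False]]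
      by (simp add: of_fock_linear)
  qed (simp add: v_eq witt_op_summand_vket[OF valid_rmon_rderiv[OF f] p i g w] of_fock_def
      del: app_ring_simps(6))
  have "of_fock (app (witt_op f i) (vket v)) b
      = of_fock (app (rmult f * super_partial i) (vket v)) b
      + (\<Sum>p<m+n. of_int (deriv_sign p f * fst (rderiv p f))
          * of_fock (app (rmult (?f' p) * (relative_parity p i * form_rep p i)) (vket v)) b)"
    by (cases "valid_vbas b") (simp_all add: of_fock_def witt_op_def del: of_int_mult)
  then show ?thesis
    unfolding derivative_term using form_term by (simp add: v_eq act_basis_rderiv mult.assoc)
qed

lemma Gcar_valid: "X \<in> Gcar m n \<Longrightarrow> X x \<noteq> 0 \<Longrightarrow> valid_rmon m n (fst x) \<and> snd x < m + n"
  by (simp add: Gcar_def)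

lemma fock_act_in_fock_space:
  assumes "X \<in> Gcar m n" "u \<in> fock_space d" shows "fock_act X u \<in> fock_space d"
  unfolding fock_act_def using Gcar_valid[OF assms(1)] assms(2)
  by (intro fock_space_sum fock_space_times has_degreeD[OF has_degree_witt_op]) simp_all

lemma fock_act_linear:
  "fock_act X (\<lambda>\<phi>. u \<phi> + v \<phi>) = (\<lambda>\<phi>. fock_act X u \<phi> + fock_act X v \<phi>)"
  "fock_act X (c \<odot> u) = c \<odot> fock_act X u"
  by (simp_all add: fock_act_def app_add app_scaled distrib_left sum.distrib sum_distrib_left
      mult.left_commute)

theorem act_eq_fock_act:
  assumes X: "X \<in> Gcar m n" and v: "v \<in> Vq m n q"
  shows "act m n X v = of_fock (fock_act X (to_fock v))"
proof
  fix b
  have "act m n X v b = (\<Sum>x\<in>{x. X x \<noteq> 0}. \<Sum>b'\<in>{b'. v b' \<noteq> 0}.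
      X x * (v b' * of_fock (app (witt_op (fst x) (snd x)) (vket b')) b))"
    unfolding act_def
  proof (intro sum.cong refl)
    fix x b' assume "x \<in> {x. X x \<noteq> 0}" "b' \<in> {b'. v b' \<noteq> 0}"
    then show "X x * v b' * act_basis m n x b' b
        = X x * (v b' * of_fock (app (witt_op (fst x) (snd x)) (vket b')) b)"
      using Gcar_valid[OF X, of x] Vq_valid[OF v, of b']
        act_basis_eq_witt_op[of "fst x" "snd x" b' b] by simp
  qed
  also have "\<dots> = of_fock (fock_act X (to_fock v)) b"
    by (simp add: fock_act_def to_fock_expansion[OF v] app_sum app_scaled of_fock_linear
        sum_distrib_left)
  finally show "act m n X v b = of_fock (fock_act X (to_fock v)) b" .
qed

lemma act_in_Vq: "X \<in> Gcar m n \<Longrightarrow> v \<in> Vq m n q \<Longrightarrow> act m n X v \<in> Vq m n q" for v :: "vbas \<Rightarrow> 'k"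
  by (simp add: act_eq_fock_act of_fock_in_Vq fock_act_in_fock_space to_fock_in_fock_space)

lemma to_fock_act: "X \<in> Gcar m n \<Longrightarrow> v \<in> Vq m n q \<Longrightarrow> to_fock (act m n X v) = fock_act X (to_fock v)"
  by (simp add: act_eq_fock_act
      to_fock_of_fock[OF fock_act_in_fock_space[OF _ to_fock_in_fock_space]])

end

context witt_char_0
begin

lemma differential_fock_act:
  assumes X: "X \<in> Gcar m n"
  shows "app differential (fock_act X u) = fock_act X (app differential u)"
proof -
  have "app differential (app (witt_op (fst x) (snd x)) u)
      = app (witt_op (fst x) (snd x)) (app differential u)"
    if "X x \<noteq> 0" for x
    using differential_witt_op[of "fst x" "snd x"] Gcar_valid[OF X that]
    by (metis app_ring_simps(6))
  then show ?thesis by (simp add: fock_act_def app_sum app_scaled)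
qed

text \<open>By Cartan's formula the action of a vector field on a closed element is exact.\<close>
lemma fock_act_closed_at_top:
  assumes X: "X \<in> Gcar m n" and closed: "app differential u = (\<lambda>_. 0)"
  shows "fock_act X u top_fock = 0"
  unfolding fock_act_def
proof (intro sum.neutral ballI)
  fix x assume "x \<in> {x. X x \<noteq> 0}"
  then have "app (witt_op (fst x) (snd x)) u top_fock = 0"
    using Gcar_valid[OF X, of x] by (simp add: witt_op_closed[OF _ _ closed] differential_at_top)
  then show "X x * app (witt_op (fst x) (snd x)) u top_fock = 0" by simp
qed

end

section \<open>Submodules and module maps\<close>

lemma gmap_vzero:
  assumes A: "submodule m n q A" and \<theta>: "gmap m n A B \<theta>" shows "\<theta> vzero = vzero"
proof -
  have "vzero \<in> A" using A by (simp add: submodule_def)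
  then have "\<theta> (0 \<odot> vzero) = 0 \<odot> \<theta> vzero" using \<theta> unfolding gmap_def by blast
  then show ?thesis by (simp add: vzero_def)
qed

lemma submodule_image:
  assumes A: "submodule m n q A" and \<theta>: "gmap m n A (Vq m n r) \<theta>"
  shows "submodule m n r (\<theta> ` A)"
  unfolding submodule_def
proof (intro conjI ballI allI impI)
  show "\<theta> ` A \<subseteq> Vq m n r" using \<theta> by (auto simp: gmap_def)
  show "vzero \<in> \<theta> ` A" using gmap_vzero[OF A \<theta>] A unfolding submodule_def by (metis imageI)
  fix u v X and c assume "u \<in> \<theta> ` A"
  then obtain u' where u': "u' \<in> A" "u = \<theta> u'" by blast
  show "c \<odot> u \<in> \<theta> ` A"
    by (rule image_eqI[of _ _ "c \<odot> u'"]) (use \<theta> A u' in \<open>auto simp: gmap_def submodule_def\<close>)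
  show "act m n X u \<in> \<theta> ` A" if "X \<in> Gcar m n"
    by (rule image_eqI[of _ _ "act m n X u'"])
      (use \<theta> A u' that in \<open>auto simp: gmap_def submodule_def\<close>)
  assume "v \<in> \<theta> ` A"
  then obtain v' where v': "v' \<in> A" "v = \<theta> v'" by blast
  show "(\<lambda>b. u b + v b) \<in> \<theta> ` A"
    by (rule image_eqI[of _ _ "\<lambda>b. u' b + v' b"])
      (use \<theta> A u' v' in \<open>auto simp: gmap_def submodule_def\<close>)
qed

lemma submodule_preimage:
  assumes "submodule m n q A" "gmap m n A B \<theta>" "submodule m n r W"
  shows "submodule m n q {v \<in> A. \<theta> v \<in> W}"
  using assms gmap_vzero[OF assms(1,2)] unfolding submodule_def gmap_def by auto

lemma submodule_equalizer:
  assumes "submodule m n q A" "gmap m n A B \<theta>" "gmap m n A B \<eta>"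
  shows "submodule m n q {v \<in> A. \<theta> v = \<eta> v}"
  using assms gmap_vzero[OF assms(1,2)] gmap_vzero[OF assms(1,3)] unfolding submodule_def gmap_def
  by auto

lemma gmod_iso_refl: "gmod_iso m n A A"
  unfolding gmod_iso_def by (rule exI[of _ "\<lambda>v. v"]) (auto simp: gmap_def bij_betw_def)

context witt
begin

lemma submodule_Vq: "submodule m n q (Vq m n q :: (vbas \<Rightarrow> 'k) set)"
  unfolding submodule_def
proof (intro conjI ballI allI impI subset_refl)
  show "vzero \<in> Vq m n q" by (simp add: Vq_def vzero_def)
  fix u v :: "vbas \<Rightarrow> 'k" and c assume u: "u \<in> Vq m n q"
  show "c \<odot> u \<in> Vq m n q"
    using of_fock_in_Vq[OF fock_space_times[OF to_fock_in_fock_space[OF u], of "\<lambda>_. c"]]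
    by (simp add: of_fock_linear of_fock_to_fock[OF u])
  show "act m n X u \<in> Vq m n q" if "X \<in> Gcar m n" for X using that u by (rule act_in_Vq)
  assume v: "v \<in> Vq m n q"
  show "(\<lambda>b. u b + v b) \<in> Vq m n q"
    using of_fock_in_Vq[OF fock_space_add[OF
          to_fock_in_fock_space[OF u] to_fock_in_fock_space[OF v]]]
    by (simp add: of_fock_linear of_fock_to_fock[OF u] of_fock_to_fock[OF v])
qed

end

section \<open>The complex of modules\<close>

context witt_char_0
begin

text \<open>The factor normalizes the value on the generating vector.  For \<open>q = 0\<close> it is \<open>0\<close>, because
  \<open>1 / 0 = 0\<close>.\<close>
definition d_mod :: "nat \<Rightarrow> (vbas \<Rightarrow> 'k) \<Rightarrow> vbas \<Rightarrow> 'k" where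
  "d_mod q v = of_fock ((- 1 / of_nat q) \<odot> app differential (to_fock v))"

definition cycles :: "nat \<Rightarrow> (vbas \<Rightarrow> 'k) set" where
  "cycles q = {v \<in> Vq m n q. d_mod q v = vzero}"

definition boundaries :: "nat \<Rightarrow> (vbas \<Rightarrow> 'k) set" where
  "boundaries q = d_mod (q + 1) ` Vq m n (q + 1)"

definition top_vbas :: vbas where "top_vbas = ((\<lambda>_. 0, [0..<n]), [0..<m])"

lemma d_mod_0: "d_mod 0 v = vzero"
  by (auto simp: d_mod_def of_fock_def vzero_def)

lemma d_mod_linear:
  "d_mod q (\<lambda>b. u b + v b) = (\<lambda>b. d_mod q u b + d_mod q v b)" "d_mod q (c \<odot> u) = c \<odot> d_mod q u"
  by (simp_all only: d_mod_def to_fock_linear app_add app_scaled distrib_left of_fock_linear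
      mult.left_commute)

lemma differential_in_fock_space:
  "u \<in> fock_space (int q) \<Longrightarrow> 1 \<le> q \<Longrightarrow> app differential u \<in> fock_space (int (q - 1))"
  by (rule has_degreeD[OF has_degree_differential]) simp_all

lemma d_mod_in_Vq:
  assumes "1 \<le> q" "v \<in> Vq m n q" shows "d_mod q v \<in> Vq m n (q - 1)"
  unfolding d_mod_def
  by (intro of_fock_in_Vq fock_space_times differential_in_fock_space to_fock_in_fock_space assms)

lemma to_fock_d_mod:
  assumes v: "v \<in> Vq m n q"
  shows "to_fock (d_mod q v) = (- 1 / of_nat q) \<odot> app differential (to_fock v)"
proof (cases "q = 0")
  case False
  then have "app differential (to_fock v) \<in> fock_space (int (q - 1))"
    by (intro differential_in_fock_space to_fock_in_fock_space[OF v]) simp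
  then show ?thesis unfolding d_mod_def by (rule to_fock_of_fock[OF fock_space_times])
qed (simp add: d_mod_0 to_fock_linear)

lemma gmap_d_mod:
  assumes q: "1 \<le> q" shows "gmap m n (Vq m n q) (Vq m n (q - 1)) (d_mod q)"
  unfolding gmap_def
proof (intro conjI ballI allI d_mod_linear)
  fix u :: "vbas \<Rightarrow> 'k" assume u: "u \<in> Vq m n q"
  show "d_mod q u \<in> Vq m n (q - 1)" using q u by (rule d_mod_in_Vq)
  fix X :: "gbas \<Rightarrow> 'k" assume X: "X \<in> Gcar m n"
  have "act m n X (d_mod q u)
      = of_fock (fock_act X ((- 1 / of_nat q) \<odot> app differential (to_fock u)))"
    using act_eq_fock_act[OF X d_mod_in_Vq[OF q u]] by (simp add: to_fock_d_mod[OF u])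
  also have "\<dots> = d_mod q (act m n X u)"
    unfolding fock_act_linear d_mod_def to_fock_act[OF X u] differential_fock_act[OF X] ..
  finally show "d_mod q (act m n X u) = act m n X (d_mod q u)" ..
qed

lemma d_mod_eq_vzero_iff:
  assumes v: "v \<in> Vq m n q" shows "d_mod q v = vzero \<longleftrightarrow> app differential (to_fock v) = (\<lambda>_. 0)"
proof (cases "q = 0")
  case True
  have "app differential (to_fock v) \<in> fock_space (- 1)"
    using True by (intro has_degreeD[OF has_degree_differential to_fock_in_fock_space[OF v]]) simp
  then show ?thesis using True fock_space_negative by (simp add: d_mod_0)
next
  case False
  have "app differential (to_fock v) = (\<lambda>_. 0)" if "d_mod q v = vzero"
    using to_fock_d_mod[OF v] False that by (simp add: to_fock_linear fun_eq_iff)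
  then show ?thesis by (auto simp: d_mod_def of_fock_linear)
qed

theorem d_mod_d_mod:
  assumes v: "v \<in> Vq m n (q + 1)" shows "d_mod q (d_mod (q + 1) v) = vzero"
  unfolding d_mod_def[of q] to_fock_d_mod[OF v] app_scaled app_differential_square
  by (simp add: of_fock_linear)

lemma valid_top_vbas: "valid_vbas top_vbas"
  by (auto simp: valid_vbas_def top_vbas_def valid_rmon_def valid_omon_def strict_sorted_iff)

lemma fock_of_top_vbas: "fock_of top_vbas = top_fock"
proof -
  have "p \<in> fermions top_vbas \<longleftrightarrow> p < m + n" for p
    using fermions_simps(1)[of p] fermions_simps(2)[of "p - m"]
    by (cases "p < m") (force simp: top_vbas_def)+
  moreover have "bosons top_vbas = (\<lambda>_. 0)"
    by (auto simp: bosons_def top_vbas_def)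
  ultimately show ?thesis by (auto simp: fock_of_def top_fock_def)
qed

lemma of_fock_ket_top: "of_fock (ket top_fock) = single top_vbas"
  using of_fock_vket[OF valid_top_vbas] by (simp add: fock_of_top_vbas)

lemma to_fock_at_top: "to_fock v top_fock = v top_vbas"
  using to_fock_fock_of[OF valid_top_vbas] by (simp add: fock_of_top_vbas)

lemma d_mod_at_top: "d_mod q v top_vbas = 0"
  by (simp add: d_mod_def of_fock_def fock_of_top_vbas differential_at_top)

lemma boundaries_subset_Vq: "boundaries q \<subseteq> Vq m n q"
  using d_mod_in_Vq[of "q + 1"] by (auto simp: boundaries_def)

lemma boundaries_subset_cycles: "boundaries q \<subseteq> cycles q"
  using boundaries_subset_Vq[of q] d_mod_d_mod by (auto simp: boundaries_def cycles_def)

lemma boundary_of_fock: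
  assumes z: "z \<in> fock_space (int q + 1)" shows "of_fock (app differential z) \<in> boundaries q"
proof -
  let ?y = "(- of_nat (q + 1)) \<odot> z"
  have y: "?y \<in> fock_space (int (q + 1))" using fock_space_times[OF z] by (simp add: add.commute)
  have "(- 1 / of_nat (q + 1)) * (- of_nat (q + 1)) = (1 :: 'k)"
    by (simp del: of_nat_add of_nat_Suc)
  then have "d_mod (q + 1) (of_fock ?y) = of_fock (app differential z)"
    unfolding d_mod_def to_fock_of_fock[OF y] app_scaled
    by (simp only: mult.assoc[symmetric] mult_1)
  then show ?thesis using of_fock_in_Vq[OF y] unfolding boundaries_def by (metis imageI)
qed

lemma cycle_decomposition:
  assumes v: "v \<in> cycles q"
  obtains u where "u \<in> boundaries q" "v = (\<lambda>b. u b + v top_vbas * single top_vbas b)"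
proof -
  have V: "v \<in> Vq m n q" and "app differential (to_fock v) = (\<lambda>_. 0)"
    using v d_mod_eq_vzero_iff by (auto simp: cycles_def)
  then obtain z where z: "z \<in> fock_space (int q + 1)"
    "to_fock v = (\<lambda>\<phi>. app differential z \<phi> + v top_vbas * ket top_fock \<phi>)"
    using poincare_lemma[OF to_fock_in_fock_space[OF V]] unfolding to_fock_at_top by metis
  have "v = of_fock (\<lambda>\<phi>. app differential z \<phi> + v top_vbas * ket top_fock \<phi>)"
    unfolding z(2)[symmetric] of_fock_to_fock[OF V] ..
  then have "v = (\<lambda>b. of_fock (app differential z) b + v top_vbas * single top_vbas b)"
    by (simp only: of_fock_linear of_fock_ket_top)
  then show ?thesis using that boundary_of_fock[OF z(1)] by blast
qed

lemma cycle_in_boundaries_iff: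
  assumes v: "v \<in> cycles q" shows "v \<in> boundaries q \<longleftrightarrow> v top_vbas = 0"
proof
  assume "v top_vbas = 0"
  then show "v \<in> boundaries q"
    by (metis cycle_decomposition[OF v] add.right_neutral mult_zero_left ext)
qed (auto simp: boundaries_def d_mod_at_top)

theorem cycles_eq_boundaries:
  assumes "q \<noteq> m" shows "cycles q = boundaries q"
proof -
  have "v top_vbas = 0" if "v \<in> cycles q" for v
    using Vq_valid[of v q top_vbas] that assms by (auto simp: cycles_def top_vbas_def)
  then show ?thesis using cycle_in_boundaries_iff boundaries_subset_cycles by blast
qed

lemma top_in_cycles: "single top_vbas \<in> cycles m"
proof -
  have "ket top_fock \<in> fock_space (int m)"
    by (simp add: ket_in_fock_space_iff top_fock_state fock_degree_top)
  then have "single top_vbas \<in> (Vq m n m :: (vbas \<Rightarrow> 'k) set)"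
    using of_fock_in_Vq[of "ket top_fock" m] by (simp add: of_fock_ket_top)
  then show ?thesis
    by (simp add: cycles_def d_mod_eq_vzero_iff to_fock_single[OF valid_top_vbas] fock_of_top_vbas
        differential_ket_top)
qed

lemma top_notin_boundaries: "single top_vbas \<notin> boundaries m"
  using cycle_in_boundaries_iff[OF top_in_cycles] by (simp add: single_def)

theorem cycles_top_degree: "cycles m = {(\<lambda>b. u b + c * single top_vbas b) | u c. u \<in> boundaries m}"
proof (intro equalityI subsetI)
  fix v assume "v \<in> cycles m"
  then show "v \<in> {(\<lambda>b. u b + c * single top_vbas b) | u c. u \<in> boundaries m}"
    by (rule cycle_decomposition) blast
next
  fix v assume "v \<in> {(\<lambda>b. u b + c * single top_vbas b) | u c. u \<in> boundaries m}"
  then obtain u c where u: "u \<in> cycles m" and v: "v = (\<lambda>b. u b + c * single top_vbas b)"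
    using boundaries_subset_cycles by blast
  have "v \<in> Vq m n m" unfolding v
    using submodule_Vq[of m] u top_in_cycles by (auto simp: submodule_def cycles_def)
  moreover have "d_mod m v = vzero"
    using u top_in_cycles by (simp add: v d_mod_linear cycles_def) (simp add: vzero_def)
  ultimately show "v \<in> cycles m" by (simp add: cycles_def)
qed

theorem act_cycle_in_boundaries:
  assumes X: "X \<in> Gcar m n" and v: "v \<in> cycles q"
  shows "act m n X v \<in> boundaries q"
proof -
  have V: "v \<in> Vq m n q" and closed: "app differential (to_fock v) = (\<lambda>_. 0)"
    using v d_mod_eq_vzero_iff by (auto simp: cycles_def)
  have "fock_act X (\<lambda>_. 0) = (\<lambda>_. 0)" by (simp add: fock_act_def app_zero)
  then have "act m n X v \<in> cycles q"
    using act_in_Vq[OF X V]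
    by (simp add: cycles_def d_mod_eq_vzero_iff to_fock_act[OF X V] differential_fock_act[OF X]
        closed)
  moreover have "act m n X v top_vbas = 0"
    using fock_act_closed_at_top[OF X closed] to_fock_act[OF X V] to_fock_at_top by metis
  ultimately show ?thesis by (simp add: cycle_in_boundaries_iff)
qed

end

section \<open>The generating vector\<close>

declare One_nat_def [simp del]

locale witt_positive = witt_char_0 scalar_type m n
  for scalar_type :: "'k::field_char_0 itself" and m n +
  assumes n_pos: "1 \<le> n"
begin

definition last_odd :: nat where "last_odd = m + n - 1"

abbreviation power_ket :: "rmon \<Rightarrow> nat \<Rightarrow> fock \<Rightarrow> 'k" where
  "power_ket g q \<equiv> vket (g, replicate q last_odd)"

lemma last_odd_ge [simp]: "m \<le> last_odd" "\<not> last_odd < m"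
  and last_odd_less [simp]: "last_odd < m + n" "\<not> m + n \<le> last_odd"
  and last_odd_diff [simp]: "last_odd - m = n - 1" "m + (n - 1) = last_odd"
  using n_pos by (auto simp: last_odd_def)

lemma coordinate_last_odd [simp]: "coordinate last_odd = (\<lambda>_. 0, [n - 1])"
  by (simp add: coordinate_def)

lemma valid_power: "valid_rmon m n g \<Longrightarrow> valid_vbas (g, replicate q last_odd)"
  by (auto simp: valid_vbas_def valid_omon_def filter_replicate)

lemma valid_y_last: "valid_rmon m n (\<lambda>_. 0, [n - 1])"
  and valid_rmon_one: "valid_rmon m n (\<lambda>_. 0, [])"
  using n_pos by (auto simp: valid_rmon_def)

lemma contract_power:
  "app (contract k) (power_ket g q) = (if k = last_odd then of_nat q else 0) \<odot> power_ket g (q - 1)"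
proof (cases "k < m")
  case True
  then have "k \<notin> fermions (g, replicate q last_odd)" "k \<noteq> last_odd" by (auto simp: fermions_def)
  then show ?thesis using True by (simp add: contract_def fock_of_def fermion_ann_ket)
next
  case False
  have fermions: "fermions (g, replicate r last_odd) = (+) m ` set (snd g)" for r
    by (auto simp: fermions_def)
  have "((+) m ` set (snd g)) \<inter> {..<m} = {}" by auto
  moreover have "bosons (g, replicate q last_odd) k = (if k = last_odd then q else 0)"
    using False by (simp add: bosons_def count_list_replicate)
  moreover have "(bosons (g, replicate q last_odd))
        (last_odd := bosons (g, replicate q last_odd) last_odd - 1)
      = bosons (g, replicate (q - 1) last_odd)"
    by (auto simp: bosons_def count_list_replicate)
  ultimately show ?thesis
    using False by (auto simp: contract_def fock_of_def fermions even_form_parity_def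
        fermion_parity_ket boson_ann_ket)
qed

lemma form_rep_power:
  "app (form_rep k last_odd) (power_ket g q)
      = (if k = last_odd then - of_nat (q + 1) else 0) \<odot> power_ket g q"
proof -
  have "app (wedge last_odd) (power_ket g r) = power_ket g (Suc r)" for r
    using wedge_vket[of "replicate r last_odd" last_odd g]
    by (simp add: filter_replicate front_sign_def)
  then have "app (wedge last_odd) (app (contract k) (power_ket g q))
      = (if k = last_odd then of_nat q else 0) \<odot> power_ket g q"
    unfolding contract_power by (cases q) (simp_all add: app_scaled app_zero)
  then show ?thesis
    by (intro ext) (simp add: form_rep_def ipar_def algebra_simps)
qed

lemma gen_vec_in_Vq: "gen_vec m n q \<in> Vq m n q"
  using n_pos by (auto simp: gen_vec_def single_def Vq_def valid_rmon_def valid_omon_def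
      filter_replicate split: if_splits)

lemma to_fock_gen_vec: "to_fock (gen_vec m n q) = power_ket (\<lambda>_. 0, [n - 1]) q"
  unfolding gen_vec_def using to_fock_single[OF valid_power[OF valid_y_last]]
  by (simp add: last_odd_def)

lemma of_fock_gen_img: "of_fock (power_ket (\<lambda>_. 0, []) (q - 1)) = gen_img m n q"
  unfolding gen_img_def using of_fock_vket[OF valid_power[OF valid_rmon_one]]
  by (simp add: last_odd_def)

lemma gen_img_nonzero: "gen_img m n q \<noteq> (vzero :: vbas \<Rightarrow> 'k)"
  by (auto simp: gen_img_def single_def vzero_def fun_eq_iff)

theorem d_mod_gen_vec:
  assumes "1 \<le> q" shows "d_mod q (gen_vec m n q) = gen_img m n q"
proof -
  have "app (partial last_odd) (power_ket (\<lambda>_. 0, [n - 1]) r) = (- 1) \<odot> power_ket (\<lambda>_. 0, []) r"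
    for r
    by (simp add: partial_def y_parity_vket[OF valid_y_last] y_deriv_vket[OF valid_y_last]
        app_scaled app_uminus rdy_def)
  then have "app (partial p) (app (contract p) (power_ket (\<lambda>_. 0, [n - 1]) q))
      = (if p = last_odd then - of_nat q else 0) \<odot> power_ket (\<lambda>_. 0, []) (q - 1)" for p
    by (simp add: contract_power app_scaled app_zero app_uminus)
  then have "app differential (power_ket (\<lambda>_. 0, [n - 1]) q)
      = (- of_nat q) \<odot> power_ket (\<lambda>_. 0, []) (q - 1)"
    by (intro ext) (simp add: differential_def if_distrib[of "\<lambda>c. c * _"] cong: if_cong)
  then show ?thesis
    using assms by (simp add: d_mod_def to_fock_gen_vec of_fock_gen_img)
qed

end

lemma sorted_max_last:
  assumes "sorted_wrt (<) S" "\<forall>s\<in>set S. s < n" "n - 1 \<in> set S"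
  obtains S' where "S = S' @ [n - 1 :: nat]"
proof -
  obtain S' s where S: "S = S' @ [s]" using assms(3) by (cases S rule: rev_cases) auto
  then have "n - 1 \<notin> set S'" using assms(1,2) by (auto simp: sorted_wrt_append)
  then have "s = n - 1" using assms(3) S by simp
  then show ?thesis using S that by blast
qed

context witt_char_0
begin

definition fock_submodule :: "int \<Rightarrow> (fock \<Rightarrow> 'k) set \<Rightarrow> bool" where
  "fock_submodule d W \<longleftrightarrow> W \<subseteq> fock_space d \<and> (\<lambda>_. 0) \<in> W
     \<and> (\<forall>u\<in>W. \<forall>v\<in>W. (\<lambda>\<phi>. u \<phi> + v \<phi>) \<in> W)
     \<and> (\<forall>c. \<forall>u\<in>W. c \<odot> u \<in> W)
     \<and> (\<forall>f i. valid_rmon m n f \<longrightarrow> i < m + n \<longrightarrow> (\<forall>u\<in>W. app (witt_op f i) u \<in> W))"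

lemma fock_submodule_closed:
  assumes "fock_submodule d W"
  shows "u \<in> W \<Longrightarrow> u \<in> fock_space d" "(\<lambda>_. 0) \<in> W" "u \<in> W \<Longrightarrow> v \<in> W \<Longrightarrow> (\<lambda>\<phi>. u \<phi> + v \<phi>) \<in> W"
    "u \<in> W \<Longrightarrow> c \<odot> u \<in> W" "u \<in> W \<Longrightarrow> valid_rmon m n f \<Longrightarrow> i < m + n \<Longrightarrow> app (witt_op f i) u \<in> W"
  using assms by (auto simp: fock_submodule_def)

lemma fock_submodule_of_submodule:
  assumes W: "submodule m n q W"
  shows "fock_submodule (int q) {u \<in> fock_space (int q). of_fock u \<in> W}" (is "fock_submodule _ ?W'")
proof -
  have witt_op: "of_fock (app (witt_op f i) u) \<in> W" if f: "valid_rmon m n f" and i: "i < m + n"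
    and u: "u \<in> fock_space (int q)" "of_fock u \<in> W" for f i u
  proof -
    define X :: "gbas \<Rightarrow> 'k" where "X = (\<lambda>x. if x = (f, i) then 1 else 0)"
    have supp: "{x. X x \<noteq> 0} = {(f, i)}" by (auto simp: X_def)
    then have X: "X \<in> Gcar m n" using f i by (auto simp: Gcar_def X_def)
    have "fock_act X u = app (witt_op f i) u" unfolding fock_act_def supp by (simp add: X_def)
    then have "act m n X (of_fock u) = of_fock (app (witt_op f i) u)"
      using act_eq_fock_act[OF X of_fock_in_Vq[OF u(1)]] by (simp add: to_fock_of_fock[OF u(1)])
    moreover have "act m n X (of_fock u) \<in> W" using W X u(2) by (simp add: submodule_def)
    ultimately show ?thesis by simp
  qed
  show ?thesis
    unfolding fock_submodule_def
  proof (intro conjI ballI allI impI)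
    show "?W' \<subseteq> fock_space (int q)" by blast
    show "(\<lambda>_. 0) \<in> ?W'" using W by (simp add: submodule_def fock_space_zero of_fock_linear)
    fix u assume u: "u \<in> ?W'"
    show "c \<odot> u \<in> ?W'" for c using W u by (simp add: submodule_def fock_space_times of_fock_linear)
    show "app (witt_op f i) u \<in> ?W'" if "valid_rmon m n f" "i < m + n" for f i
      using has_degreeD[OF has_degree_witt_op[OF that], of u "int q"] witt_op[OF that] u by simp
    show "(\<lambda>\<phi>. u \<phi> + v \<phi>) \<in> ?W'" if "v \<in> ?W'" for v
      using W u that by (simp add: submodule_def fock_space_add of_fock_linear)
  qed
qed

lemma fock_submodule_ket_cancel:
  assumes W: "fock_submodule d W" and "(\<lambda>\<psi>. u \<psi> + c * ket \<phi> \<psi>) \<in> W" "u \<in> W" "c \<noteq> 0"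
  shows "ket \<phi> \<in> W"
proof -
  have "inverse c \<odot> (\<lambda>\<psi>. (u \<psi> + c * ket \<phi> \<psi>) + (- 1) * u \<psi>) \<in> W"
    by (intro fock_submodule_closed[OF W] assms)
  moreover have "inverse c \<odot> (\<lambda>\<psi>. (u \<psi> + c * ket \<phi> \<psi>) + (- 1) * u \<psi>) = ket \<phi>"
    using assms(4) by (simp add: fun_eq_iff)
  ultimately show ?thesis by simp
qed

lemma fock_submodule_eq_fock_space:
  assumes W: "fock_submodule d W" and kets: "\<And>\<phi>. \<phi> \<in> fock_states \<Longrightarrow> fock_degree \<phi> = d \<Longrightarrow> ket \<phi> \<in> W"
  shows "W = fock_space d"
proof (intro equalityI subsetI)
  fix u assume u: "u \<in> fock_space d"
  have "(\<lambda>\<psi>. \<Sum>\<phi>\<in>I. u \<phi> * ket \<phi> \<psi>) \<in> W" if "I \<subseteq> {\<phi>. u \<phi> \<noteq> 0}" for I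
    using that
  proof (induction I rule: infinite_finite_induct)
    case (insert \<phi> I)
    then have "ket \<phi> \<in> W" using u by (intro kets) (simp_all add: fock_space_def)
    then have "u \<phi> \<odot> ket \<phi> \<in> W" by (rule fock_submodule_closed(4)[OF W])
    then show ?case using fock_submodule_closed(3)[OF W _ insert.IH] insert by simp
  qed (simp_all add: fock_submodule_closed(2)[OF W])
  then have "(\<lambda>\<psi>. \<Sum>\<phi>\<in>{\<phi>. u \<phi> \<noteq> 0}. u \<phi> * ket \<phi> \<psi>) \<in> W" by simp
  then show "u \<in> W" by (subst ket_expansion) (use u in \<open>simp_all add: fock_space_def\<close>)
qed (rule fock_submodule_closed(1)[OF W])

definition form_occupied :: "nat \<Rightarrow> fock \<Rightarrow> bool" where
  "form_occupied l \<phi> \<longleftrightarrow> (if l < m then l \<in> snd \<phi> else fst \<phi> l \<noteq> 0)"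

definition remove_form :: "nat \<Rightarrow> fock \<Rightarrow> fock" where
  "remove_form l \<phi> = (if l < m then (fst \<phi>, snd \<phi> - {l}) else ((fst \<phi>)(l := fst \<phi> l - 1), snd \<phi>))"

definition add_odd_form :: "nat \<Rightarrow> fock \<Rightarrow> fock" where
  "add_odd_form l \<phi> = ((fst \<phi>)(l := Suc (fst \<phi> l)), snd \<phi>)"

lemma contract_add_odd_form:
  assumes "\<not> l < m"
  obtains c where "c \<noteq> 0" "app (contract l) (ket (add_odd_form l \<phi>)) = c \<odot> ket \<phi>"
proof (cases \<phi>)
  case (Pair \<beta> F)
  show ?thesis
  proof (rule that)
    show "(-1) ^ card (F \<inter> {..<m}) * of_nat (Suc (\<beta> l)) \<noteq> (0 :: 'k)" by (simp del: of_nat_Suc)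
    show "app (contract l) (ket (add_odd_form l \<phi>))
        = ((-1) ^ card (F \<inter> {..<m}) * of_nat (Suc (\<beta> l))) \<odot> ket \<phi>"
      using assms by (simp add: Pair contract_def add_odd_form_def even_form_parity_def
          fermion_parity_ket boson_ann_ket app_scaled mult.assoc)
  qed
qed

lemma wedge_remove_form:
  assumes "form_occupied l \<phi>"
  obtains c where "c \<noteq> 0" "app (wedge l) (ket (remove_form l \<phi>)) = c \<odot> ket \<phi>"
proof (cases \<phi>)
  case (Pair \<beta> F)
  show ?thesis
  proof (cases "l < m")
    case True
    then show ?thesis
      using assms that[of "sign_below l F"]
      by (simp add: Pair form_occupied_def remove_form_def wedge_def fermion_cre_ket
          sign_below_remove insert_absorb)
        (simp add: sign_below_def)
  next
    case False
    then have "\<beta>(l := Suc (\<beta> l - 1)) = \<beta>" using assms by (auto simp: Pair form_occupied_def)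
    then show ?thesis
      using False that[of "(-1) ^ card (F \<inter> {..<m})"]
      by (simp add: Pair remove_form_def wedge_def even_form_parity_def fermion_parity_ket
          boson_cre_ket app_scaled)
  qed
qed

end

context witt_positive
begin

lemma rdy_y_last:
  assumes f: "valid_rmon m n f" and y_last: "n - 1 \<in> set (snd f)"
  shows "deriv_sign last_odd f * fst (rdy (n - 1) f) = 1"
    and "rmul (snd (rdy (n - 1) f)) (\<lambda>_. 0, [n - 1]) = (1, f)"
proof -
  obtain S where S: "snd f = S @ [n - 1]"
    using sorted_max_last[of "snd f" n] f y_last by (auto simp: valid_rmon_def)
  have sorted: "sorted_wrt (<) (snd f)" using f by (simp add: valid_rmon_def)
  then have notin: "n - 1 \<notin> set S" by (auto simp: S sorted_wrt_append)
  then have "takeWhile (\<lambda>s. s \<noteq> n - 1) (S @ [n - 1]) = S" by (subst takeWhile_append2) auto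
  then have rdy: "rdy (n - 1) f = ((-1) ^ length S, (fst f, S))"
    using notin by (simp add: rdy_def S remove1_append)
  show "deriv_sign last_odd f * fst (rdy (n - 1) f) = 1"
    by (simp add: deriv_sign_def rdy S flip: power_add mult_2)
  show "rmul (snd (rdy (n - 1) f)) (\<lambda>_. 0, [n - 1]) = (1, f)"
    using sorted by (simp add: rdy rmul_def ysign_sorted strict_sorted_iff sorted_sort_id
        prod_eq_iff flip: S)
qed

lemma witt_op_last_power:
  "app (witt_op f last_odd) (power_ket g q)
      = (\<lambda>\<psi>. app (rmult f * super_partial last_odd) (power_ket g q) \<psi>
    + of_int (deriv_sign last_odd f * fst (rdy (n - 1) f)) * - of_nat (q + 1)
      * app (rmult (snd (rdy (n - 1) f))) (power_ket g q) \<psi>)"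
proof -
  have "app (of_int c * (T * (relative_parity p last_odd * form_rep p last_odd))) (power_ket g q)
      = (if p = last_odd then of_int c * - of_nat (q + 1) else 0) \<odot> app T (power_ket g q)" for c T p
    by (intro ext) (simp add: form_rep_power relative_parity_def app_scaled app_zero)
  then show ?thesis
    unfolding witt_op_def
    by (intro ext) (simp add: rderiv_def[of last_odd] if_distrib[of "\<lambda>c. c * _"]
        del: app_ring_simps(6) of_int_mult cong: if_cong)
qed

lemma witt_op_y_last_power:
  assumes f: "valid_rmon m n f" and q: "1 \<le> q"
  obtains c where "c \<noteq> 0"
      "app (witt_op f last_odd) (power_ket (\<lambda>_. 0, [n - 1]) q) = c \<odot> power_ket f q"
proof -
  let ?y = "(\<lambda>_. 0, [n - 1]) :: rmon" and ?D = "rdy (n - 1) f"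
  have derivative_term: "app (rmult f * super_partial last_odd) (power_ket ?y q) = power_ket f q"
    using rmult_vket[OF f valid_rmon_one]
    by (simp add: super_partial_vket[OF valid_y_last] rderiv_def rdy_def rmul_one[OF f])
  have "app (witt_op f last_odd) (power_ket ?y q)
      = (if n - 1 \<in> set (snd f) then - of_nat q else 1) \<odot> power_ket f q"
  proof (cases "n - 1 \<in> set (snd f)")
    case True
    have "valid_rmon m n (snd ?D)" using valid_rmon_rderiv[OF f, of last_odd]
      by (simp add: rderiv_def)
    then have "app (rmult (snd ?D)) (power_ket ?y q) = power_ket f q"
      using rmult_vket[OF _ valid_y_last] by (simp add: rdy_y_last(2)[OF f True])
    then show ?thesis
      unfolding witt_op_last_power derivative_term rdy_y_last(1)[OF f True] using True
      by (simp add: algebra_simps)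
  next
    case False
    then show ?thesis unfolding witt_op_last_power derivative_term by (simp add: rdy_def)
  qed
  then show ?thesis using q by (intro that[of "if n - 1 \<in> set (snd f) then - of_nat q else 1"]) auto
qed

definition to_last_odd :: "nat \<Rightarrow> fock \<Rightarrow> fock" where
  "to_last_odd l \<phi> = add_odd_form last_odd (remove_form l \<phi>)"

lemma to_last_odd_state: "\<phi> \<in> fock_states \<Longrightarrow> to_last_odd l \<phi> \<in> fock_states"
  by (auto simp: fock_states_def to_last_odd_def add_odd_form_def remove_form_def)

lemma fock_degree_to_last_odd:
  assumes "l < m + n" "form_occupied l \<phi>"
  shows "fock_degree (to_last_odd l \<phi>) = fock_degree \<phi>"
  using assms by (cases \<phi>)
    (auto simp: to_last_odd_def add_odd_form_def remove_form_def form_occupied_def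
      fock_degree_boson_upd fock_degree_fermion_remove)

lemma to_last_odd_last: "l \<noteq> last_odd \<Longrightarrow> fst (to_last_odd l \<phi>) last_odd = Suc (fst \<phi> last_odd)"
  by (simp add: to_last_odd_def add_odd_form_def remove_form_def)

lemma form_rep_to_last_odd:
  assumes l: "l \<noteq> last_odd" "form_occupied l \<phi>"
  obtains c where "c \<noteq> 0"
    "app (relative_parity last_odd l * form_rep last_odd l) (ket (to_last_odd l \<phi>)) = c \<odot> ket \<phi>"
proof -
  obtain a where a: "a \<noteq> 0"
      "app (contract last_odd) (ket (to_last_odd l \<phi>)) = a \<odot> ket (remove_form l \<phi>)"
    unfolding to_last_odd_def using contract_add_odd_form[OF last_odd_ge(2)] by blast
  obtain b where b: "b \<noteq> 0" "app (wedge l) (ket (remove_form l \<phi>)) = b \<odot> ket \<phi>"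
    using l(2) by (rule wedge_remove_form)
  let ?sign = "- ((-1) ^ ((ipar m last_odd + ipar m l) * ipar m last_odd)) :: 'k"
  have form_rep: "app (form_rep last_odd l) (ket (to_last_odd l \<phi>)) = (?sign * a * b) \<odot> ket \<phi>"
    using l(1) by (intro ext) (simp add: form_rep_def a b app_scaled)
  have y_parity: "app y_parity (ket \<phi>) = (-1) ^ card (snd \<phi> \<inter> {m..<m+n}) \<odot> ket \<phi>"
    by (cases \<phi>) (simp add: y_parity_def fermion_parity_ket)
  show ?thesis
  proof (rule that)
    let ?r = "if l < m then (-1) ^ card (snd \<phi> \<inter> {m..<m+n}) else 1 :: 'k"
    show "?r * (?sign * a * b) \<noteq> 0" using a(1) b(1) by simp
    show "app (relative_parity last_odd l * form_rep last_odd l) (ket (to_last_odd l \<phi>))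
        = (?r * (?sign * a * b)) \<odot> ket \<phi>"
      by (simp add: form_rep relative_parity_def app_scaled app_uminus y_parity mult.assoc
          mult.left_commute)
  qed
qed

lemma rmult_y_last_ket:
  assumes "l \<noteq> last_odd"
  obtains c \<psi> where "fst \<psi> last_odd = fst \<phi> last_odd"
    "app (rmult (coordinate last_odd) * super_partial l) (ket \<phi>) = c \<odot> ket \<psi>"
proof -
  obtain \<beta> F where \<phi>: "\<phi> = (\<beta>, F)" by fastforce
  note ops = rmult_coordinate super_partial_def y_mult_def y_deriv_def even_form_parity_def
  note kets = boson_ann_ket fermion_ann_ket fermion_cre_ket fermion_parity_ket
  show ?thesis
    by (cases "l < m")
      (use assms in \<open>intro that[rotated], auto simp: \<phi> ops kets app_scaled mult.assoc[symmetric]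
        simp del: coordinate_last_odd\<close>)+
qed

lemma ex_form_occupied:
  assumes "fock_degree \<phi> = int q" "fst \<phi> last_odd < q"
  obtains l where "l < m + n" "l \<noteq> last_odd" "form_occupied l \<phi>"
proof (rule ccontr)
  assume "\<not> thesis"
  with that have none: "\<not> form_occupied l \<phi>" if "l < m + n" "l \<noteq> last_odd" for l using that by blast
  have "l \<notin> snd \<phi>" if "l < m" for l
    using none[of l] that last_odd_ge(1) by (auto simp: form_occupied_def simp del: last_odd_ge)
  then have "snd \<phi> \<inter> {..<m} = {}" by blast
  moreover have "sum (fst \<phi>) {m..<m+n} = fst \<phi> last_odd + sum (fst \<phi>) ({m..<m+n} - {last_odd})"
    by (intro sum.remove) auto
  moreover have "fst \<phi> p = 0" if "p \<in> {m..<m+n} - {last_odd}" for p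
    using none[of p] that by (auto simp: form_occupied_def)
  then have "sum (fst \<phi>) ({m..<m+n} - {last_odd}) = 0" by (rule sum.neutral[OF ballI])
  ultimately show False using assms by (simp add: fock_degree_def del: of_nat_sum)
qed

lemma state_is_power:
  assumes "\<phi> \<in> fock_states" "fock_degree \<phi> = int q" "fst \<phi> last_odd = q"
  obtains g where "valid_rmon m n g" "\<phi> = fock_of (g, replicate q last_odd)"
proof -
  obtain b where b: "valid_vbas b" "fock_of b = \<phi>" using ex_fock_of[OF assms(1)] by blast
  have "length (snd b) = q" using fock_degree_fock_of[OF b(1)] assms(2) b(2) by simp
  moreover have "count_list (snd b) last_odd = q"
    using assms(3) b count_list_fock_of[OF b(1), of last_odd] by (auto simp: fock_of_def)
  ultimately have "b = (fst b, replicate q last_odd)" using count_list_eq_length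
    by (metis prod.collapse)
  moreover have "valid_rmon m n (fst b)" using b(1) by (simp add: valid_vbas_def)
  ultimately show ?thesis using that b(2) by metis
qed

text \<open>The field \<open>y\<^sub>n \<partial>\<^sub>l\<close> or \<open>y\<^sub>n D\<^sub>l\<close> turns one factor \<open>e\<^sup>*\<^sub>m\<^sub>+\<^sub>n\<close> into \<open>e\<^sup>*\<^sub>l\<close>, up to a multiple
  of a state with as many factors \<open>e\<^sup>*\<^sub>m\<^sub>+\<^sub>n\<close> as before.\<close>
lemma fock_submodule_ket_step:
  assumes W: "fock_submodule d W" and \<phi>: "\<phi> \<in> fock_states" "fock_degree \<phi> = d"
    and l: "l < m + n" "l \<noteq> last_odd" "form_occupied l \<phi>"
    and kets: "\<And>\<psi>. \<psi> \<in> fock_states \<Longrightarrow> fock_degree \<psi> = d \<Longrightarrow> fst \<psi> last_odd = Suc (fst \<phi> last_odd)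
      \<Longrightarrow> ket \<psi> \<in> W"
  shows "ket \<phi> \<in> W"
proof -
  let ?\<phi>' = "to_last_odd l \<phi>" and ?T = "rmult (coordinate last_odd) * super_partial l"
  have \<phi>': "ket ?\<phi>' \<in> W"
    using \<phi> l by (intro kets)
      (simp_all add: to_last_odd_state fock_degree_to_last_odd to_last_odd_last)
  obtain c where c: "c \<noteq> 0"
    "app (relative_parity last_odd l * form_rep last_odd l) (ket ?\<phi>') = c \<odot> ket \<phi>"
    using l(2,3) by (rule form_rep_to_last_odd)
  obtain e \<psi> where e: "fst \<psi> last_odd = fst ?\<phi>' last_odd" "app ?T (ket ?\<phi>') = e \<odot> ket \<psi>"
    using l(2) by (rule rmult_y_last_ket)
  have "has_degree ?T 0"
    using l(1) by (intro has_degree_times_right has_degree_rmult valid_rmon_coordinate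
        has_degree_super_partial) simp_all
  then have "app ?T (ket ?\<phi>') \<in> fock_space d"
    using fock_submodule_closed(1)[OF W \<phi>'] by (rule has_degreeD) simp
  then have "ket \<psi> \<in> W" if "e \<noteq> 0"
    using that l(2) e by (intro kets) (simp_all add: scaled_ket_in_fock_space_iff to_last_odd_last)
  then have remainder: "app ?T (ket ?\<phi>') \<in> W"
    unfolding e(2) using fock_submodule_closed(2,4)[OF W] by (cases "e = 0") simp_all
  have "app (witt_op (coordinate last_odd) l) (ket ?\<phi>') \<in> W"
    by (rule fock_submodule_closed(5)[OF W \<phi>' valid_rmon_coordinate l(1)]) (rule last_odd_less)
  also have "app (witt_op (coordinate last_odd) l) (ket ?\<phi>')
      = (\<lambda>\<psi>. app ?T (ket ?\<phi>') \<psi> + c * ket \<phi> \<psi>)"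
    by (intro ext) (simp only: witt_op_coordinate[OF last_odd_less(1)] app_ring_simps(3) c(2))
  finally show ?thesis using remainder c(1) by (rule fock_submodule_ket_cancel[OF W])
qed

lemma fock_submodule_kets:
  assumes W: "fock_submodule (int q) W"
    and power: "\<And>g. valid_rmon m n g \<Longrightarrow> power_ket g q \<in> W"
    and "\<phi> \<in> fock_states" "fock_degree \<phi> = int q" "fst \<phi> last_odd + k = q"
  shows "ket \<phi> \<in> W"
  using assms(3-)
proof (induction k arbitrary: \<phi>)
  case 0
  then obtain g where "valid_rmon m n g" "\<phi> = fock_of (g, replicate q last_odd)"
    using state_is_power[of \<phi> q] by auto
  then show ?case using power by simp
next
  case (Suc k)
  obtain l where l: "l < m + n" "l \<noteq> last_odd" "form_occupied l \<phi>"
    using ex_form_occupied[of \<phi> q] Suc.prems by auto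
  show ?case
  proof (rule fock_submodule_ket_step[OF W Suc.prems(1,2) l])
    fix \<psi> assume "\<psi> \<in> fock_states" "fock_degree \<psi> = int q" "fst \<psi> last_odd = Suc (fst \<phi> last_odd)"
    then show "ket \<psi> \<in> W" using Suc.IH[of \<psi>] Suc.prems(3) by simp
  qed
qed

theorem gen_vec_generates:
  fixes W :: "(vbas \<Rightarrow> 'k) set"
  assumes q: "1 \<le> q" and W: "submodule m n q W" and gen: "gen_vec m n q \<in> W"
  shows "W = Vq m n q"
proof -
  let ?W' = "{u \<in> fock_space (int q). of_fock u \<in> W}"
  note W' = fock_submodule_of_submodule[OF W]
  have "power_ket (\<lambda>_. 0, [n - 1]) q \<in> ?W'"
    using to_fock_in_fock_space[OF gen_vec_in_Vq[of q]] of_fock_to_fock[OF gen_vec_in_Vq[of q]] gen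
    by (simp add: to_fock_gen_vec)
  then have power: "power_ket f q \<in> ?W'" if f: "valid_rmon m n f" for f
  proof -
    obtain c where c: "c \<noteq> 0"
        "app (witt_op f last_odd) (power_ket (\<lambda>_. 0, [n - 1]) q) = c \<odot> power_ket f q"
      using f q by (rule witt_op_y_last_power)
    moreover have "app (witt_op f last_odd) (power_ket (\<lambda>_. 0, [n - 1]) q) \<in> ?W'"
      using f by (intro fock_submodule_closed(5)[OF W'] \<open>power_ket (\<lambda>_. 0, [n - 1]) q \<in> ?W'\<close>)
          simp_all
    ultimately show ?thesis
      using fock_submodule_ket_cancel[OF W', of "\<lambda>_. 0" c] fock_submodule_closed(2)[OF W'] by simp
  qed
  have "ket \<phi> \<in> ?W'" if "\<phi> \<in> fock_states" "fock_degree \<phi> = int q" for \<phi>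
  proof (rule fock_submodule_kets[OF W' power that])
    have "fst \<phi> last_odd \<le> sum (fst \<phi>) {m..<m+n}" by (intro member_le_sum) auto
    then show "fst \<phi> last_odd + (q - fst \<phi> last_odd) = q"
      using that(2) unfolding fock_degree_def by linarith
  qed
  then have "?W' = fock_space (int q)" by (rule fock_submodule_eq_fock_space[OF W'])
  then have "of_fock (to_fock v) \<in> W" if "v \<in> Vq m n q" for v
    using to_fock_in_fock_space[OF that] by blast
  then show ?thesis using W of_fock_to_fock by (auto simp: submodule_def)
qed

section \<open>Uniqueness of the differential and its image\<close>

lemma dprops_d_mod: "dprops m n d_mod"
  unfolding dprops_def using gmap_d_mod d_mod_gen_vec d_mod_0 by blast

theorem dprops_unique:
  assumes d: "dprops m n d" and v: "v \<in> Vq m n q" shows "d q v = d_mod q v"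
proof (cases "q = 0")
  case True
  then show ?thesis using d by (simp add: dprops_def d_mod_0)
next
  case False
  then have q: "1 \<le> q" by simp
  have "submodule m n q {v \<in> Vq m n q. d q v = d_mod q v}"
    using d q unfolding dprops_def
    by (intro submodule_equalizer[OF submodule_Vq _ gmap_d_mod[OF q]]) blast
  then have "{v \<in> Vq m n q. d q v = d_mod q v} = Vq m n q"
    using d q gen_vec_in_Vq d_mod_gen_vec[OF q]
    by (intro gen_vec_generates) (simp_all add: dprops_def)
  then show ?thesis using v by blast
qed

lemma dprops_image:
  assumes "dprops m n d" shows "d (q + 1) ` Vq m n (q + 1) = boundaries q"
  unfolding boundaries_def by (intro image_cong refl dprops_unique[OF assms])

lemma dprops_kernel:
  assumes "dprops m n d" shows "{v \<in> Vq m n q. d q v = vzero} = cycles q"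
  using dprops_unique[OF assms] by (auto simp: cycles_def)

lemma gen_img_in_boundaries: "gen_img m n (q + 1) \<in> boundaries q"
  using d_mod_gen_vec[of "q + 1"] gen_vec_in_Vq[of "q + 1"] unfolding boundaries_def
  by (metis image_eqI le_add2)

lemma submodule_boundaries: "submodule m n q (boundaries q)"
  unfolding boundaries_def using gmap_d_mod[of "q + 1"]
  by (intro submodule_image[OF submodule_Vq]) simp

theorem boundaries_proper:
  assumes q: "1 \<le> q" shows "boundaries q \<noteq> {vzero}" "boundaries q \<noteq> Vq m n q"
proof -
  show "boundaries q \<noteq> {vzero}" using gen_img_in_boundaries[of q] gen_img_nonzero by blast
  have "gen_vec m n q \<notin> cycles q" using d_mod_gen_vec[OF q] gen_img_nonzero
    by (simp add: cycles_def)
  then show "boundaries q \<noteq> Vq m n q" using boundaries_subset_cycles gen_vec_in_Vq by blast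
qed

lemma constant_in_boundaries:
  assumes w: "valid_omon m n q w" shows "single ((\<lambda>_. 0, []), w) \<in> boundaries q"
proof -
  let ?b = "((\<lambda>_. 0, []), w) :: vbas"
  have b: "valid_vbas ?b" using w valid_rmon_one by (auto simp: valid_vbas_def valid_omon_def)
  have "app (partial p) (vket ?b) = (\<lambda>_. 0)" for p
    by (simp add: partial_def boson_ann_vket y_parity_vket[OF valid_rmon_one]
        y_deriv_vket[OF valid_rmon_one] rdx_def rdy_def)
  then have "app (partial p * contract p) (vket ?b) = (\<lambda>_. 0)" if "p < m + n" for p
    by (simp add: app_zero flip: contract_partial[OF that that])
  then have "app differential (vket ?b) = (\<lambda>_. 0)"
    by (simp add: differential_def fun_eq_iff del: app_ring_simps(6))
  moreover have "single ?b \<in> (Vq m n q :: (vbas \<Rightarrow> 'k) set)"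
    using w valid_rmon_one by (auto simp: Vq_def single_def split: if_splits)
  ultimately have "single ?b \<in> cycles q"
    by (simp add: cycles_def d_mod_eq_vzero_iff to_fock_single[OF b])
  then show ?thesis
    using n_pos by (simp add: cycle_in_boundaries_iff) (simp add: single_def top_vbas_def)
qed

theorem Lmod_eq_boundaries: "Lmod m n q = boundaries q"
proof
  show "Lmod m n q \<subseteq> boundaries q"
    unfolding Lmod_def using submodule_boundaries constant_in_boundaries by blast
  show "boundaries q \<subseteq> Lmod m n q"
    unfolding Lmod_def
  proof (rule Inter_greatest)
    fix W :: "(vbas \<Rightarrow> 'k) set"
    assume "W \<in> {W. submodule m n q W \<and> (\<forall>w. valid_omon m n q w \<longrightarrow> single ((\<lambda>_. 0, []), w) \<in> W)}"
    then have W: "submodule m n q W"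
      and constants: "\<And>w. valid_omon m n q w \<Longrightarrow> single ((\<lambda>_. 0, []), w) \<in> W" by auto
    have "valid_omon m n q (replicate q (m + n - 1))"
      using n_pos by (auto simp: valid_omon_def filter_replicate)
    then have "gen_img m n (q + 1) \<in> W" using constants by (simp add: gen_img_def)
    then have "{v \<in> Vq m n (q + 1). d_mod (q + 1) v \<in> W} = Vq m n (q + 1)"
      using gen_vec_in_Vq d_mod_gen_vec[of "q + 1"]
      by (intro gen_vec_generates submodule_preimage[OF submodule_Vq gmap_d_mod W]) simp_all
    then show "boundaries q \<subseteq> W" by (auto simp: boundaries_def)
  qed
qed

end

theorem mainTheorem11:
  fixes m n :: nat
  assumes "1 \<le> m" and "1 \<le> n" and "alg_closed TYPE('k::field_char_0)"
  shows "(\<exists>d :: nat \<Rightarrow> (vbas \<Rightarrow> 'k) \<Rightarrow> (vbas \<Rightarrow> 'k). dprops m n d)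
    \<and> (\<forall>d :: nat \<Rightarrow> (vbas \<Rightarrow> 'k) \<Rightarrow> (vbas \<Rightarrow> 'k). dprops m n d \<longrightarrow>
         (\<forall>q. \<forall>v\<in>Vq m n (q + 1). d q (d (q + 1) v) = vzero)
       \<and> (\<forall>q\<ge>1. \<exists>W :: (vbas \<Rightarrow> 'k) set. submodule m n q W \<and> W \<noteq> {vzero} \<and> W \<noteq> Vq m n q)
       \<and> (\<forall>q. gmod_iso m n (d (q + 1) ` Vq m n (q + 1)) (Lmod m n q))
       \<and> (\<forall>q. q \<noteq> m \<longrightarrow> {v \<in> Vq m n q. d q v = vzero} = d (q + 1) ` Vq m n (q + 1))
       \<and> (let K = {v \<in> Vq m n m. d m v = vzero};
              I = d (m + 1) ` Vq m n (m + 1);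
              w0 = single ((\<lambda>_. 0, [0..<n]), [0..<m]) :: vbas \<Rightarrow> 'k
          in w0 \<in> K \<and> w0 \<notin> I
           \<and> K = {(\<lambda>b. u b + c * w0 b) | u c. u \<in> I}
           \<and> (\<forall>X\<in>Gcar m n. \<forall>v\<in>K. act m n X v \<in> I)))"
proof -
  interpret witt_positive "TYPE('k)" m n using assms(2) by unfold_locales
  show ?thesis
    unfolding Let_def top_vbas_def[symmetric]
  proof (intro conjI allI impI ballI)
    show "\<exists>d :: nat \<Rightarrow> (vbas \<Rightarrow> 'k) \<Rightarrow> (vbas \<Rightarrow> 'k). dprops m n d" using dprops_d_mod by blast
    fix d :: "nat \<Rightarrow> (vbas \<Rightarrow> 'k) \<Rightarrow> (vbas \<Rightarrow> 'k)" and q assume d: "dprops m n d"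
    note image = dprops_image[OF d] and kernel = dprops_kernel[OF d]
    show "d q (d (q + 1) v) = vzero" if "v \<in> Vq m n (q + 1)" for v
      using that image kernel boundaries_subset_cycles by blast
    show "\<exists>W :: (vbas \<Rightarrow> 'k) set. submodule m n q W \<and> W \<noteq> {vzero} \<and> W \<noteq> Vq m n q" if "1 \<le> q"
      using submodule_boundaries boundaries_proper[OF that] by blast
    show "gmod_iso m n (d (q + 1) ` Vq m n (q + 1)) (Lmod m n q)"
      unfolding image Lmod_eq_boundaries by (rule gmod_iso_refl)
    show "{v \<in> Vq m n q. d q v = vzero} = d (q + 1) ` Vq m n (q + 1)" if "q \<noteq> m"
      unfolding image kernel using that by (rule cycles_eq_boundaries)
    show "single top_vbas \<in> {v \<in> Vq m n m. d m v = vzero}"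
      unfolding kernel by (rule top_in_cycles)
    show "single top_vbas \<notin> d (m + 1) ` Vq m n (m + 1)"
      unfolding image by (rule top_notin_boundaries)
    show "{v \<in> Vq m n m. d m v = vzero}
        = {(\<lambda>b. u b + c * single top_vbas b) | u c. u \<in> d (m + 1) ` Vq m n (m + 1)}"
      unfolding image kernel by (rule cycles_top_degree)
    show "act m n X v \<in> d (m + 1) ` Vq m n (m + 1)"
      if "X \<in> Gcar m n" "v \<in> {v \<in> Vq m n m. d m v = vzero}" for X v
      using that unfolding image kernel by (rule act_cycle_in_boundaries)
  qed
qed

end
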